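(* Let $\mathcal M$ be a non-empty set of probability mass functions on $\mathcal X$ and let $\mathcal Q$ be a non-empty bounded set of rate matrices that has separately specified rows, with lower transition rate operator $\underline Q$ (the lower envelope of $\mathcal Q$). Let $L_0^s$ ($s\ge0$) be the lower transition operators corresponding to $\underline Q$. Then for any $s\in\mathbb R_{\ge0}$ and any $f\in\mathcal L(\mathcal X)$: $$\underline{\mathbb E}^{\mathrm W}_{\mathcal Q,\mathcal M}[f(X_s)]=\underline{\mathbb E}^{\mathrm{WM}}_{\mathcal Q,\mathcal M}[f(X_s)]=\underline{\mathbb E}_{\mathcal M}[L_0^sf].$$
   Context: State space and operators. $\mathcal X$ is a fixed finite non-empty state space; $\mathcal L(\mathcal X)$ is the set of all $f:\mathcal X\to\mathbb R$, with $\|f\|=\max_x|f(x)|$. A non-negatively homogeneous operator $A:\mathcal L(\mathcal X)\to\mathcal L(\mathcal X)$ has norm $\|A\|=\sup\{\|Af\|:\|f\|=1\}$. Matrices are real, indexed by $\mathcal X\times\mathcal X$, and act by $[Af](x)=\sum_yA(x,y)f(y)$. $I$ is the identity. $\underline{\mathbb E}_{\mathcal M}[f]=\inf\{\sum_{x}p(x)f(x):p\in\mathcal M\}$ for $f\in\mathcal L(\mathcal X)$. A rate matrix is a matrix $Q$ with $\sum_yQ(x,y)=0$ for all $x$ and $Q(x,y)\ge0$ for $x\ne y$; $\mathcal R$ is the set of all of them. $\mathcal Q\subseteq\mathcal R$ is bounded if $\sup_{Q\in\mathcal Q}\|Q\|<\infty$, and has separately specified rows if $\mathcal Q=\{Q\in\mathcal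 R:(\forall x\in\mathcal X)\,Q(x,\cdot)\in\mathcal Q_x\}$ with $\mathcal Q_x=\{Q(x,\cdot):Q\in\mathcal Q\}$. Its lower envelope is $[\underline Qf](x)=\inf\{[Qf](x):Q\in\mathcal Q\}$. A lower transition operator is a map $\underline T:\mathcal L(\mathcal X)\to\mathcal L(\mathcal X)$ with $[\underline Tf](x)\ge\min f$, $\underline T(f+g)\ge\underline Tf+\underline Tg$ and $\underline T(\lambda f)=\lambda\underline Tf$ for $\lambda\ge0$. For $t\le s$, $\mathcal U_{[t,s]}$ is the set of finite sequences $v:\ t=t_0<\dots<t_n=s$; $\Delta_i=t_i-t_{i-1}$, $\sigma(v)=\max_i\Delta_i$ ($0$ if $n=0$), $\Phi_v=(I+\Delta_1\underline Q)\cdots(I+\Delta_n\underline Q)$ ($I$ if $n=0$). $L_t^s$ is the (existing, unique) lower transition operator such that for every $\epsilon>0$ there is $\delta>0$ with $\|L_t^s-\Phi_v\|\le\epsilon$ for all $v\in\mathcal U_{[t,s]}$ with $\sigma(v)\le\delta$. Stochastic processes. $\mathcal U$ is the set of all finite (possibly empty) strictly increasing sequences in $\mathbb R_{\ge0}$, identified with finite subsets; $\mathcal U_{<t}$ consists of those with all elements $<t$. "$t>u$" means $t$ exceeds every element of $u$ (true if $u=\emptyset$). $\mathcal X_u=\prod_{t\in u}\mathcal X$, elements $x_u=(x_t)_{t\in u}$. $\Omega$ is a fixed set of paths $\omega:\mathbb R_{\ge0}\to\mathcal X$ such that for every non-empty $u\in\mathcal U$ and $x_u\in\mathcal X_u$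 some $\omega\in\Omega$ satisfies $\omega|_u=x_u$. $(X_t=x)=\{\omega\in\Omega:\omega(t)=x\}$, $(X_u=x_u)=\{\omega\in\Omega:\omega|_u=x_u\}$ ($=\Omega$ if $u=\emptyset$). $\mathcal A_u$ is the algebra of subsets of $\Omega$ generated by the events $(X_t=x)$ with $x\in\mathcal X$ and $t\in u$ or $t>u$. $\mathcal C^{\mathrm{SP}}=\{(A,X_u=x_u):u\in\mathcal U,x_u\in\mathcal X_u,A\in\mathcal A_u\}$. A stochastic process is a map $P:\mathcal C^{\mathrm{SP}}\to\mathbb R$, written $P(A|C)$, that is coherent: for all $n\in\mathbb N$, $(A_i,C_i)\in\mathcal C^{\mathrm{SP}}$, $\lambda_i\in\mathbb R$ ($1\le i\le n$), $\max\{\sum_{i=1}^n\lambda_i\mathbb I_{C_i}(\omega)(P(A_i|C_i)-\mathbb I_{A_i}(\omega)):\omega\in\bigcup_iC_i\}\ge0$. $P(A)=P(A|\Omega)$. For $t\le s$, $u\in\mathcal U_{<t}$, $x_u\in\mathcal X_u$: $T_{t,x_u}^s(x,y)=P(X_s=y|X_t=x,X_u=x_u)$. $P$ is well-behaved if for all $t\ge0$, $u\in\mathcal U_{<t}$, $x_u\in\mathcal X_u$: $\limsup_{\Delta\to0^+}\frac1\Delta\|T_{t,x_u}^{t+\Delta}-I\|<\infty$ and, if $t>0$, $\limsup_{\Delta\to0^+}\frac1\Delta\|T_{t-\Delta,x_u}^{t}-I\|<\infty$. $P$ is a Markov chain if $P(X_s=y|X_t=x,X_u=x_u)=P(X_s=y|X_t=x)$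 always. The outer partial derivative $\overline\partial T_{t,x_u}^t$ is the set of all $Q\in\mathcal R$ that are limits of $\frac1{\Delta_i}(T_{t,x_u}^{t+\Delta_i}-I)$ or, if $t>0$, of $\frac1{\Delta_i}(T_{t-\Delta_i,x_u}^t-I)$, for some sequence $\Delta_i\to0^+$. $P$ is consistent with $\mathcal Q$ if $\overline\partial T_{t,x_u}^t\subseteq\mathcal Q$ for all $t\ge0$, $u\in\mathcal U_{<t}$, $x_u\in\mathcal X_u$, and consistent with $\mathcal M$ if the mass function $x\mapsto P(X_0=x)$ is in $\mathcal M$. $\mathbb P^{\mathrm W}_{\mathcal Q,\mathcal M}$ (resp. $\mathbb P^{\mathrm{WM}}_{\mathcal Q,\mathcal M}$) is the set of all well-behaved stochastic processes (resp. well-behaved Markov chains) consistent with $\mathcal Q$ and $\mathcal M$; $\underline{\mathbb E}^{\mathrm W}_{\mathcal Q,\mathcal M}[f(X_s)]$ and $\underline{\mathbb E}^{\mathrm{WM}}_{\mathcal Q,\mathcal M}[f(X_s)]$ are the infima of $\sum_xf(x)P(X_s=x)$ over $P$ in the respective set. *)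

theory Defs
  imports "HOL-Analysis.Analysis"
begin

text \<open>The state space is a type \<open>'x::finite\<close>; \<open>\<L>(\<X>)\<close> is \<open>real^'x\<close>, whose maximum norm is
  \<^const>\<open>infnorm\<close>; matrices are \<open>real^'x^'x\<close>, acting by \<open>*v\<close>.\<close>

section \<open>Operators\<close>

text \<open>Only applied to operators that are bounded in the maximum norm, for which the supremum is
  over a non-empty bounded set of reals. (\<^const>\<open>onorm\<close> would use the Euclidean norm instead.)\<close>

definition op_norm :: "(real^'x::finite \<Rightarrow> real^'x) \<Rightarrow> real" where
  "op_norm A = Sup {infnorm (A f) | f. infnorm f = 1}"

definition rate_matrices :: "(real^'x::finite^'x) set" where
  "rate_matrices = {Q. (\<forall>x. (\<Sum>y\<in>UNIV. Q $ x $ y) = 0) \<and> (\<forall>x y. x \<noteq> y \<longrightarrow> Q $ x $ y \<ge> 0)}"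

definition bounded_rates :: "(real^'x::finite^'x) set \<Rightarrow> bool" where
  "bounded_rates \<Q> \<longleftrightarrow> bdd_above ((\<lambda>Q. op_norm ((*v) Q)) ` \<Q>)"

definition separately_specified_rows :: "(real^'x::finite^'x) set \<Rightarrow> bool" where
  "separately_specified_rows \<Q> \<longleftrightarrow>
     \<Q> = {Q \<in> rate_matrices. \<forall>x. Q $ x \<in> (\<lambda>Q'. Q' $ x) ` \<Q>}"

definition lower_envelope :: "(real^'x::finite^'x) set \<Rightarrow> real^'x \<Rightarrow> real^'x" where
  "lower_envelope \<Q> f = (\<chi> x. INF Q\<in>\<Q>. (Q *v f) $ x)"

definition lower_transition_operator :: "(real^'x::finite \<Rightarrow> real^'x) \<Rightarrow> bool" where
  "lower_transition_operator T \<longleftrightarrow>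
     (\<forall>f x. T f $ x \<ge> Min (range (($) f))) \<and>
     (\<forall>f g x. T (f + g) $ x \<ge> T f $ x + T g $ x) \<and>
     (\<forall>f c. c \<ge> 0 \<longrightarrow> T (c *\<^sub>R f) = c *\<^sub>R T f)"

text \<open>The sequence \<open>t = t\<^sub>0 < \<dots> < t\<^sub>n = s\<close> is the list of its \<open>n + 1\<close> elements.\<close>

definition partitions :: "real \<Rightarrow> real \<Rightarrow> real list set" where
  "partitions t s = {v. v \<noteq> [] \<and> sorted_wrt (<) v \<and> hd v = t \<and> last v = s}"

definition mesh :: "real list \<Rightarrow> real" where
  "mesh v = Max (insert 0 {v ! Suc i - v ! i | i. Suc i < length v})"

fun Phi :: "(real^'x::finite \<Rightarrow> real^'x) \<Rightarrow> real list \<Rightarrow> real^'x \<Rightarrow> real^'x" where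
  "Phi Q (t0 # t1 # v) f = Phi Q (t1 # v) f + (t1 - t0) *\<^sub>R Q (Phi Q (t1 # v) f)"
| "Phi Q _ f = f"

text \<open>\<open>lower_transition Q t s\<close> is \<open>L\<^sub>t\<^sup>s\<close>.\<close>

definition lower_transition ::
    "(real^'x::finite \<Rightarrow> real^'x) \<Rightarrow> real \<Rightarrow> real \<Rightarrow> real^'x \<Rightarrow> real^'x" where
  "lower_transition Q t s =
     (THE L. lower_transition_operator L \<and>
        (\<forall>\<epsilon>>0. \<exists>\<delta>>0. \<forall>v\<in>partitions t s. mesh v \<le> \<delta> \<longrightarrow> op_norm (\<lambda>f. L f - Phi Q v f) \<le> \<epsilon>))"

definition mass_functions :: "(real^'x::finite) set" where
  "mass_functions = {p. (\<forall>x. p $ x \<ge> 0) \<and> (\<Sum>x\<in>UNIV. p $ x) = 1}"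

definition lower_expectation :: "(real^'x::finite) set \<Rightarrow> real^'x \<Rightarrow> real" where
  "lower_expectation \<M> f = (INF p\<in>\<M>. \<Sum>x\<in>UNIV. p $ x * f $ x)"

section \<open>Stochastic processes\<close>

definition time_sets :: "real set set" where
  "time_sets = {u. finite u \<and> u \<subseteq> {0..}}"

definition time_sets_below :: "real \<Rightarrow> real set set" where
  "time_sets_below t = {u \<in> time_sets. \<forall>r\<in>u. r < t}"

text \<open>A path, a function on the non-negative reals, is a function on all reals that is
  \<^const>\<open>undefined\<close> at negative arguments, so that distinct elements of \<open>\<Omega>\<close> are distinct paths.
  Likewise \<open>x\<^sub>u\<close> ranges over \<open>u \<rightarrow>\<^sub>E UNIV\<close>.\<close>

definition path_space :: "(real \<Rightarrow> 'x::finite) set \<Rightarrow> bool" where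
  "path_space \<Omega> \<longleftrightarrow>
     \<Omega> \<subseteq> ({0..} \<rightarrow>\<^sub>E UNIV) \<and>
     (\<forall>u\<in>time_sets. \<forall>xu \<in> u \<rightarrow>\<^sub>E UNIV. u \<noteq> {} \<longrightarrow> (\<exists>\<omega>\<in>\<Omega>. restrict \<omega> u = xu))"

definition ev :: "(real \<Rightarrow> 'x::finite) set \<Rightarrow> real \<Rightarrow> 'x \<Rightarrow> (real \<Rightarrow> 'x) set" where
  "ev \<Omega> t x = {\<omega> \<in> \<Omega>. \<omega> t = x}"

definition evs :: "(real \<Rightarrow> 'x::finite) set \<Rightarrow> real set \<Rightarrow> (real \<Rightarrow> 'x) \<Rightarrow> (real \<Rightarrow> 'x) set" where
  "evs \<Omega> u xu = {\<omega> \<in> \<Omega>. \<forall>r\<in>u. \<omega> r = xu r}"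

text \<open>The hull is the intersection of all algebras on \<open>\<Omega>\<close> that contain the generators.\<close>

definition event_algebra :: "(real \<Rightarrow> 'x::finite) set \<Rightarrow> real set \<Rightarrow> (real \<Rightarrow> 'x) set set" where
  "event_algebra \<Omega> u = algebra \<Omega> hull {ev \<Omega> t x | t x. t \<ge> 0 \<and> (t \<in> u \<or> (\<forall>r\<in>u. r < t))}"

definition C_SP :: "(real \<Rightarrow> 'x::finite) set \<Rightarrow> ((real \<Rightarrow> 'x) set \<times> (real \<Rightarrow> 'x) set) set" where
  "C_SP \<Omega> = {(A, evs \<Omega> u xu) | A u xu.
     u \<in> time_sets \<and> xu \<in> u \<rightarrow>\<^sub>E UNIV \<and> A \<in> event_algebra \<Omega> u}"

text \<open>\<open>P (A, C)\<close> stands for \<open>P(A|C)\<close>. The gain functions below take only finitely many values,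
  so that \<^const>\<open>Max\<close> is the actual maximum.\<close>

definition coherent ::
    "(real \<Rightarrow> 'x::finite) set \<Rightarrow> ((real \<Rightarrow> 'x) set \<times> (real \<Rightarrow> 'x) set \<Rightarrow> real) \<Rightarrow> bool" where
  "coherent \<Omega> P \<longleftrightarrow>
     (\<forall>n\<ge>1. \<forall>(A :: nat \<Rightarrow> (real \<Rightarrow> 'x) set) C (c :: nat \<Rightarrow> real).
        (\<forall>i\<in>{1..n}. (A i, C i) \<in> C_SP \<Omega>) \<longrightarrow>
        Max ((\<lambda>\<omega>. \<Sum>i=1..n. c i * indicator (C i) \<omega> * (P (A i, C i) - indicator (A i) \<omega>))
               ` (\<Union>i\<in>{1..n}. C i)) \<ge> 0)"

definition stochastic_process ::
    "(real \<Rightarrow> 'x::finite) set \<Rightarrow> ((real \<Rightarrow> 'x) set \<times> (real \<Rightarrow> 'x) set \<Rightarrow> real) \<Rightarrow> bool" where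
  "stochastic_process \<Omega> P \<longleftrightarrow> P \<in> extensional (C_SP \<Omega>) \<and> coherent \<Omega> P"

definition trans_matrix ::
    "(real \<Rightarrow> 'x::finite) set \<Rightarrow> ((real \<Rightarrow> 'x) set \<times> (real \<Rightarrow> 'x) set \<Rightarrow> real) \<Rightarrow>
     real set \<Rightarrow> (real \<Rightarrow> 'x) \<Rightarrow> real \<Rightarrow> real \<Rightarrow> real^'x^'x" where
  "trans_matrix \<Omega> P u xu t s = (\<chi> x y. P (ev \<Omega> s y, ev \<Omega> t x \<inter> evs \<Omega> u xu))"

text \<open>In the left-hand quotients, \<open>trans_matrix \<Omega> P u xu (t - \<Delta>) t\<close> is meaningful once
  \<open>t - \<Delta>\<close> is non-negative and exceeds \<open>u\<close>; as \<open>t > 0\<close> exceeds \<open>u\<close>, this is so for all small \<open>\<Delta> > 0\<close>,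
  and neither the limits superior nor the limits depend on the other \<open>\<Delta>\<close>.\<close>

definition well_behaved ::
    "(real \<Rightarrow> 'x::finite) set \<Rightarrow> ((real \<Rightarrow> 'x) set \<times> (real \<Rightarrow> 'x) set \<Rightarrow> real) \<Rightarrow> bool" where
  "well_behaved \<Omega> P \<longleftrightarrow>
     (\<forall>t\<ge>0. \<forall>u\<in>time_sets_below t. \<forall>xu \<in> u \<rightarrow>\<^sub>E UNIV.
        Limsup (at_right 0)
          (\<lambda>\<Delta>. ereal (1 / \<Delta> * op_norm ((*v) (trans_matrix \<Omega> P u xu t (t + \<Delta>) - mat 1)))) < \<infinity> \<and>
        (t > 0 \<longrightarrow>
          Limsup (at_right 0)
            (\<lambda>\<Delta>. ereal (1 / \<Delta> * op_norm ((*v) (trans_matrix \<Omega> P u xu (t - \<Delta>) t - mat 1)))) < \<infinity>))"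

definition markov_chain ::
    "(real \<Rightarrow> 'x::finite) set \<Rightarrow> ((real \<Rightarrow> 'x) set \<times> (real \<Rightarrow> 'x) set \<Rightarrow> real) \<Rightarrow> bool" where
  "markov_chain \<Omega> P \<longleftrightarrow> stochastic_process \<Omega> P \<and>
     (\<forall>t\<ge>0. \<forall>s\<ge>t. \<forall>u\<in>time_sets_below t. \<forall>xu \<in> u \<rightarrow>\<^sub>E UNIV. \<forall>x y.
        P (ev \<Omega> s y, ev \<Omega> t x \<inter> evs \<Omega> u xu) = P (ev \<Omega> s y, ev \<Omega> t x))"

definition outer_derivative ::
    "(real \<Rightarrow> 'x::finite) set \<Rightarrow> ((real \<Rightarrow> 'x) set \<times> (real \<Rightarrow> 'x) set \<Rightarrow> real) \<Rightarrow>
     real set \<Rightarrow> (real \<Rightarrow> 'x) \<Rightarrow> real \<Rightarrow> (real^'x^'x) set" where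
  "outer_derivative \<Omega> P u xu t = {Q \<in> rate_matrices. \<exists>\<Delta>. filterlim \<Delta> (at_right 0) sequentially \<and>
     ((\<lambda>i. (1 / \<Delta> i) *\<^sub>R (trans_matrix \<Omega> P u xu t (t + \<Delta> i) - mat 1)) \<longlonglongrightarrow> Q \<or>
      t > 0 \<and> (\<lambda>i. (1 / \<Delta> i) *\<^sub>R (trans_matrix \<Omega> P u xu (t - \<Delta> i) t - mat 1)) \<longlonglongrightarrow> Q)}"

definition consistent_rates ::
    "(real \<Rightarrow> 'x::finite) set \<Rightarrow> (real^'x^'x) set \<Rightarrow>
     ((real \<Rightarrow> 'x) set \<times> (real \<Rightarrow> 'x) set \<Rightarrow> real) \<Rightarrow> bool" where
  "consistent_rates \<Omega> \<Q> P \<longleftrightarrow>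
     (\<forall>t\<ge>0. \<forall>u\<in>time_sets_below t. \<forall>xu \<in> u \<rightarrow>\<^sub>E UNIV. outer_derivative \<Omega> P u xu t \<subseteq> \<Q>)"

definition consistent_initial ::
    "(real \<Rightarrow> 'x::finite) set \<Rightarrow> (real^'x) set \<Rightarrow>
     ((real \<Rightarrow> 'x) set \<times> (real \<Rightarrow> 'x) set \<Rightarrow> real) \<Rightarrow> bool" where
  "consistent_initial \<Omega> \<M> P \<longleftrightarrow> (\<chi> x. P (ev \<Omega> 0 x, \<Omega>)) \<in> \<M>"

definition P_W ::
    "(real \<Rightarrow> 'x::finite) set \<Rightarrow> (real^'x^'x) set \<Rightarrow> (real^'x) set \<Rightarrow>
     ((real \<Rightarrow> 'x) set \<times> (real \<Rightarrow> 'x) set \<Rightarrow> real) set" where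
  "P_W \<Omega> \<Q> \<M> = {P. stochastic_process \<Omega> P \<and> well_behaved \<Omega> P \<and>
     consistent_rates \<Omega> \<Q> P \<and> consistent_initial \<Omega> \<M> P}"

definition P_WM ::
    "(real \<Rightarrow> 'x::finite) set \<Rightarrow> (real^'x^'x) set \<Rightarrow> (real^'x) set \<Rightarrow>
     ((real \<Rightarrow> 'x) set \<times> (real \<Rightarrow> 'x) set \<Rightarrow> real) set" where
  "P_WM \<Omega> \<Q> \<M> = {P. markov_chain \<Omega> P \<and> well_behaved \<Omega> P \<and>
     consistent_rates \<Omega> \<Q> P \<and> consistent_initial \<Omega> \<M> P}"

definition lower_exp_of ::
    "(real \<Rightarrow> 'x::finite) set \<Rightarrow> ((real \<Rightarrow> 'x) set \<times> (real \<Rightarrow> 'x) set \<Rightarrow> real) set \<Rightarrow>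
     real \<Rightarrow> real^'x \<Rightarrow> real" where
  "lower_exp_of \<Omega> \<P> s f = (INF P\<in>\<P>. \<Sum>x\<in>UNIV. f $ x * P (ev \<Omega> s x, \<Omega>))"

end

theory Submission
  imports Defs
begin

text \<open>The operators \<open>L\<^sub>0\<^sup>t\<close> form a semigroup \<open>S\<close> of nonexpansive maps with generator the lower
  envelope, obtained as the limit of Euler schemes with dyadic step sizes.

  Lower bound: for a process \<open>P\<close> consistent with \<open>\<Q>\<close>, the function
  \<open>t \<mapsto> \<Sum>x. P(X\<^sub>t = x) * S (s - t) f $ x\<close> has non-negative lower Dini derivatives from both sides,
  hence is increasing; its values at \<open>0\<close> and \<open>s\<close> are compared. Only conditioning on a single time
  enters, so that no control over longer histories is needed.

  Upper bound: choosing, backwards in time on a fine grid, rate matrices that nearly minimise the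
  current function gives a piecewise constant family of transition matrices whose value is within
  \<open>\<epsilon>\<close> of the lower transition operator. It is realised by a Markov chain on the given path space,
  whose coherence follows because all bets are fair for the chain released at the earliest
  conditioning time.\<close>

text \<open>The lower envelope need be neither linear nor differentiable, so no exponential series
  is at hand. Everything quantitative rests on one estimate, \<open>S_first_order\<close>:
  \<open>S t f\<close> and \<open>f + t R f\<close> differ by at most \<open>t * M\<close> squared
  times the norm of \<open>f\<close>. Its derivation uses only that \<open>I + h R\<close> is a
  lower transition operator for small \<open>h\<close>. Single rate matrices are thereby covered
  too, and their exponentials come from the same construction with the same constants.

  A process in \<open>P_W\<close> need not have derivatives. Well-behavedness bounds its difference
  quotients, so these accumulate, and consistency puts the accumulation points into
  \<open>\<Q>\<close>. The resulting inequalities hold only within a distance that depends on the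
  time, hence a gluing by compactness.

  As \<open>\<Q>\<close> need not be closed, the envelope need not be attained and only near
  minimisers are available; running each of them on a whole interval keeps every one-sided
  derivative inside \<open>\<Q>\<close>.

  The paths are prescribed, and no measure is built on them: coherence concerns finitely many bets,
  hence finitely many times, so iterated finite sums suffice.\<close>

lemma infnorm_leI: "(\<And>i. \<bar>(x::real^'x::finite) $ i\<bar> \<le> B) \<Longrightarrow> infnorm x \<le> B"
  unfolding infnorm_cart by (rule cSup_least) auto

lemma minus_infnorm_le_nth: "- infnorm x \<le> (x::real^'x::finite) $ i"
  and nth_le_infnorm: "(x::real^'x::finite) $ i \<le> infnorm x"
  using component_le_infnorm_cart[of x i] by linarith+

lemma Min_ge_minus_infnorm: "Min (range (($) (x::real^'x::finite))) \<ge> - infnorm x"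
  by (subst Min_ge_iff) (auto intro: minus_infnorm_le_nth)

lemma LIMSEQ_infnormI:
  fixes X :: "nat \<Rightarrow> real^'x::finite"
  assumes "(\<lambda>n. infnorm (X n - l)) \<longlonglongrightarrow> 0"
  shows "X \<longlonglongrightarrow> l"
proof (rule Lim_transform_bound[THEN LIM_zero_cancel])
  show "(\<lambda>n. sqrt (DIM(real^'x)) * infnorm (X n - l)) \<longlonglongrightarrow> 0"
    using tendsto_mult_left[OF assms] by simp
  show "\<forall>\<^sub>F n in sequentially. norm (X n - l) \<le> norm (sqrt (DIM(real^'x)) * infnorm (X n - l))"
    by (intro always_eventually allI order_trans[OF norm_le_infnorm]) simp
qed

section \<open>Lower transition operators\<close>

context
  fixes T :: "real^'x::finite \<Rightarrow> real^'x"
  assumes T: "lower_transition_operator T"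
begin

lemma lto_ge_Min: "T f $ x \<ge> Min (range (($) f))"
  and lto_superadd: "T (f + g) $ x \<ge> T f $ x + T g $ x"
  and lto_scale: "c \<ge> 0 \<Longrightarrow> T (c *\<^sub>R f) = c *\<^sub>R T f"
  using T unfolding lower_transition_operator_def by blast+

lemma lto_zero [simp]: "T 0 = 0"
  using lto_scale[of 0 0] by simp

text \<open>Superadditivity for \<open>f = g + (f - g)\<close>. Monotonicity, nonexpansiveness and
  the effect of adding a constant are all read off from this inequality.\<close>

lemma lto_diff_ge: "T f $ x - T g $ x \<ge> Min (range (($) (f - g)))"
  using lto_superadd[of g x "f - g"] lto_ge_Min[of "f - g" x] by simp

lemma lto_mono:
  assumes "\<And>y. f $ y \<le> g $ y"
  shows "T f $ x \<le> T g $ x"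
proof -
  have "0 \<le> Min (range (($) (g - f)))"
    using assms by (subst Min_ge_iff) auto
  also have "\<dots> \<le> T g $ x - T f $ x"
    by (rule lto_diff_ge)
  finally show ?thesis by simp
qed

lemma lto_nonexpansive: "infnorm (T f - T g) \<le> infnorm (f - g)"
proof (rule infnorm_leI)
  fix i
  have "T f $ i - T g $ i \<ge> - infnorm (f - g)" "T g $ i - T f $ i \<ge> - infnorm (g - f)"
    by (rule order_trans[OF Min_ge_minus_infnorm lto_diff_ge])+
  then show "\<bar>(T f - T g) $ i\<bar> \<le> infnorm (f - g)"
    using infnorm_sub[of f g] by simp
qed

lemma lto_infnorm_le: "infnorm (T f) \<le> infnorm f"
  using lto_nonexpansive[of f 0] by simp

lemma lto_add_const: "T (f + c *\<^sub>R 1) $ x \<le> T f $ x + c"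
proof -
  have "T f $ x - T (f + c *\<^sub>R 1) $ x \<ge> Min (range (($) (f - (f + c *\<^sub>R 1))))"
    by (rule lto_diff_ge)
  also have "range (($) (f - (f + c *\<^sub>R 1))) = {- c}"
    by auto
  finally show ?thesis by simp
qed

end

lemma lto_id: "lower_transition_operator (\<lambda>f. f)"
  unfolding lower_transition_operator_def by (auto intro: Min_le)

lemma lto_compose:
  assumes T: "lower_transition_operator T" and U: "lower_transition_operator U"
  shows "lower_transition_operator (\<lambda>f. T (U f))"
  unfolding lower_transition_operator_def
proof (intro conjI allI impI)
  fix f x
  have "Min (range (($) f)) \<le> Min (range (($) (U f)))"
    using lto_ge_Min[OF U, of f] by (subst Min_ge_iff) auto
  also have "\<dots> \<le> T (U f) $ x"
    by (rule lto_ge_Min[OF T])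
  finally show "T (U f) $ x \<ge> Min (range (($) f))" .
next
  fix f g x
  have "T (U f) $ x + T (U g) $ x \<le> T (U f + U g) $ x"
    by (rule lto_superadd[OF T])
  also have "\<dots> \<le> T (U (f + g)) $ x"
    by (rule lto_mono[OF T]) (use lto_superadd[OF U] in auto)
  finally show "T (U (f + g)) $ x \<ge> T (U f) $ x + T (U g) $ x" .
next
  fix f and c :: real assume "c \<ge> 0"
  then show "T (U (c *\<^sub>R f)) = c *\<^sub>R T (U f)"
    by (simp add: lto_scale[OF T] lto_scale[OF U])
qed

lemma lto_funpow: "lower_transition_operator T \<Longrightarrow> lower_transition_operator (T ^^ n)"
  by (induction n) (auto intro: lto_id lto_compose simp: id_def comp_def)

lemma lto_limit:
  assumes "\<And>n. lower_transition_operator (T n)"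
    and lim: "\<And>f. (\<lambda>n. T n f) \<longlonglongrightarrow> U f"
  shows "lower_transition_operator U"
  unfolding lower_transition_operator_def
proof (intro conjI allI impI)
  show "U f $ x \<ge> Min (range (($) f))" for f x
    by (rule LIMSEQ_le_const[OF tendsto_vec_nth[OF lim]]) (use assms(1) lto_ge_Min in blast)
  show "U (f + g) $ x \<ge> U f $ x + U g $ x" for f g x
    by (rule LIMSEQ_le[OF tendsto_add[OF tendsto_vec_nth[OF lim] tendsto_vec_nth[OF lim]]
          tendsto_vec_nth[OF lim]]) (use assms(1) lto_superadd in blast)
  show "U (c *\<^sub>R f) = c *\<^sub>R U f" if "c \<ge> 0" for f c
    using tendsto_scaleR[OF tendsto_const lim[of f], of c] lim[of "c *\<^sub>R f"]
    by (simp add: lto_scale[OF assms(1) that] LIMSEQ_unique)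
qed

text \<open>\<open>Sup\<close> dominates its members only if they are bounded; nonexpansiveness
  supplies the bound 2. This is how information on single vectors is extracted from the condition
  that characterises the limit operator.\<close>

lemma lto_op_norm_diff:
  assumes T: "lower_transition_operator T" and U: "lower_transition_operator U"
    and "infnorm f = 1"
  shows "infnorm (T f - U f) \<le> op_norm (\<lambda>f. T f - U f)"
  unfolding op_norm_def
proof (rule cSup_upper)
  show "infnorm (T f - U f) \<in> {infnorm (T f - U f) | f. infnorm f = 1}"
    using assms(3) by blast
  have "infnorm (T f - U f) \<le> 2" if "infnorm f = 1" for f
    using infnorm_triangle[of "T f" "- U f"] lto_infnorm_le[OF T, of f] lto_infnorm_le[OF U, of f] that
    by (simp add: infnorm_neg)
  then show "bdd_above {infnorm (T f - U f) | f. infnorm f = 1}"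
    by (auto intro!: bdd_aboveI)
qed

lemma infnorm_axis: "infnorm (axis i 1 :: real^'x::finite) = 1"
  by (rule antisym) (auto intro!: infnorm_leI simp: axis_def
      intro: order_trans[OF _ component_le_infnorm_cart[of _ i]])

lemma op_norm_leI:
  assumes "\<And>f. infnorm f = 1 \<Longrightarrow> infnorm (A f) \<le> B"
  shows "op_norm A \<le> B"
  unfolding op_norm_def using infnorm_axis assms by (intro cSup_least) auto

section \<open>The semigroup of a lower transition rate operator\<close>

text \<open>The common abstraction of a lower envelope and of a single rate matrix: all that the
  construction of the semigroup needs is that short Euler steps are lower transition
  operators.\<close>

locale rate_operator =
  fixes R :: "real^'x::finite \<Rightarrow> real^'x" and h0 :: real
  assumes h0_pos: "h0 > 0"
    and lto_step: "\<lbrakk>0 \<le> h; h \<le> h0\<rbrakk> \<Longrightarrow> lower_transition_operator (\<lambda>f. f + h *\<^sub>R R f)"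
begin

text \<open>A Lipschitz constant of \<open>R\<close>: \<open>h0\<close> times \<open>R\<close> is
  the difference of the maps \<open>step h0\<close> and identity, both nonexpansive.\<close>

definition M :: real where "M = 2 / h0"

definition step :: "real \<Rightarrow> real^'x \<Rightarrow> real^'x" where "step h f = f + h *\<^sub>R R f"

lemma M_nonneg: "M \<ge> 0"
  using h0_pos by (simp add: M_def)

lemma lto_step': "\<lbrakk>0 \<le> h; h \<le> h0\<rbrakk> \<Longrightarrow> lower_transition_operator (step h)"
  unfolding step_def by (rule lto_step)

lemma R_lipschitz: "infnorm (R f - R g) \<le> M * infnorm (f - g)"
proof -
  have "h0 * infnorm (R f - R g) = infnorm (h0 *\<^sub>R (R f - R g))"
    using h0_pos by (simp add: infnorm_mul)
  also have "h0 *\<^sub>R (R f - R g) = (step h0 f - step h0 g) + - (f - g)"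
    by (simp add: step_def algebra_simps)
  also have "infnorm \<dots> \<le> infnorm (step h0 f - step h0 g) + infnorm (- (f - g))"
    by (rule infnorm_triangle)
  also have "infnorm (- (f - g)) = infnorm (f - g)"
    by (rule infnorm_neg)
  also have "infnorm (step h0 f - step h0 g) \<le> infnorm (f - g)"
    using h0_pos by (intro lto_nonexpansive lto_step') auto
  finally show ?thesis
    using h0_pos by (simp add: M_def field_simps)
qed

lemma R_zero: "R 0 = 0"
  using lto_zero[OF lto_step, of h0] h0_pos by simp

lemma R_bound: "infnorm (R f) \<le> M * infnorm f"
  using R_lipschitz[of f 0] by (simp add: R_zero)

context
  fixes h :: real
  assumes h: "0 \<le> h" "h \<le> h0"
begin

lemma lto_step_pow: "lower_transition_operator (step h ^^ k)"
  using h by (intro lto_funpow lto_step')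

lemma step_pow_diff: "infnorm ((step h ^^ k) f - f) \<le> k * h * M * infnorm f"
proof (induction k)
  case (Suc k)
  let ?g = "(step h ^^ k) f"
  have "infnorm ((step h ^^ Suc k) f - f) = infnorm ((?g - f) + h *\<^sub>R R ?g)"
    by (simp add: step_def algebra_simps)
  also have "\<dots> \<le> infnorm (?g - f) + h * infnorm (R ?g)"
    using infnorm_triangle[of "?g - f" "h *\<^sub>R R ?g"] h by (simp add: infnorm_mul)
  also have "\<dots> \<le> k * h * M * infnorm f + h * (M * infnorm f)"
    using h M_nonneg lto_infnorm_le[OF lto_step_pow]
    by (intro add_mono Suc mult_left_mono order_trans[OF R_bound]) auto
  finally show ?case by (simp add: algebra_simps)
qed (simp add: infnorm_0)

text \<open>The next step adds \<open>h (R g - R f)\<close>, where the iterate \<open>g\<close> has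
  moved at most \<open>k h M\<close> times the norm of \<open>f\<close>; so the coefficient grows
  from \<open>k^2\<close> to \<open>k^2 + k\<close>, below the square of \<open>k + 1\<close>. The
  bound sees \<open>k\<close> and \<open>h\<close> only through the elapsed time \<open>k h\<close>
  and thus survives the limit of small steps.\<close>

lemma step_pow_first_order:
  "infnorm ((step h ^^ k) f - f - (k * h) *\<^sub>R R f) \<le> (k * h * M)\<^sup>2 * infnorm f"
proof (induction k)
  case (Suc k)
  let ?g = "(step h ^^ k) f"
  have "infnorm ((step h ^^ Suc k) f - f - (Suc k * h) *\<^sub>R R f)
      = infnorm ((?g - f - (k * h) *\<^sub>R R f) + h *\<^sub>R (R ?g - R f))"
    by (simp add: step_def algebra_simps)
  also have "\<dots> \<le> infnorm (?g - f - (k * h) *\<^sub>R R f) + h * infnorm (R ?g - R f)"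
    using infnorm_triangle[of "?g - f - (k * h) *\<^sub>R R f" "h *\<^sub>R (R ?g - R f)"] h
    by (simp add: infnorm_mul)
  also have "\<dots> \<le> (k * h * M)\<^sup>2 * infnorm f + h * (M * (k * h * M * infnorm f))"
    using h M_nonneg
    by (intro add_mono Suc mult_left_mono order_trans[OF R_lipschitz] step_pow_diff) auto
  also have "\<dots> = (real k ^ 2 + k) * ((h * M)\<^sup>2 * infnorm f)"
    by (simp add: algebra_simps power2_eq_square)
  also have "\<dots> \<le> (real (Suc k))\<^sup>2 * ((h * M)\<^sup>2 * infnorm f)"
    by (intro mult_right_mono mult_nonneg_nonneg infnorm_pos_le zero_le_power2)
      (auto simp: power2_eq_square algebra_simps)
  also have "\<dots> = (Suc k * h * M)\<^sup>2 * infnorm f"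
    by (simp only: power_mult_distrib mult.assoc)
  finally show ?case .
qed (simp add: infnorm_0)

text \<open>One step of length \<open>h\<close> against two of length \<open>h / 2\<close>: the
  first-order estimate for two half steps bounds the discrepancy. Nonexpansiveness keeps earlier
  discrepancies from growing, so they merely add up.\<close>

lemma step_halve:
  "infnorm ((step (h / 2) ^^ (2 * k)) f - (step h ^^ k) f) \<le> k * (h * M)\<^sup>2 * infnorm f"
proof (induction k)
  case (Suc k)
  let ?g = "(step h ^^ k) f" and ?g' = "(step (h / 2) ^^ (2 * k)) f"
  let ?T = "step (h / 2) ^^ 2"
  have "infnorm ((step (h / 2) ^^ (2 * Suc k)) f - (step h ^^ Suc k) f)
      = infnorm ((?T ?g' - ?T ?g) + (?T ?g - step h ?g))"
    by (simp add: numeral_2_eq_2)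
  also have "\<dots> \<le> infnorm (?T ?g' - ?T ?g) + infnorm (?T ?g - step h ?g)"
    by (rule infnorm_triangle)
  also have "infnorm (?T ?g' - ?T ?g) \<le> infnorm (?g' - ?g)"
    using h by (intro lto_nonexpansive lto_funpow lto_step') auto
  also have "infnorm (?T ?g - step h ?g) \<le> (h * M)\<^sup>2 * infnorm f"
  proof -
    have "infnorm (?T ?g - step h ?g) \<le> (h * M)\<^sup>2 * infnorm ?g"
      using rate_operator.step_pow_first_order[OF rate_operator_axioms, of "h / 2" 2 ?g] h
      by (simp add: step_def algebra_simps)
    also have "\<dots> \<le> (h * M)\<^sup>2 * infnorm f"
      by (intro mult_left_mono lto_infnorm_le[OF lto_step_pow]) auto
    finally show ?thesis .
  qed
  also note Suc
  finally show ?case by (simp add: algebra_simps)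
qed (simp add: infnorm_0)

end

lemma step_bound: "\<lbrakk>0 \<le> h; h \<le> h0\<rbrakk> \<Longrightarrow> infnorm (step h f - f) \<le> h * M * infnorm f"
  using step_pow_diff[of h 1 f] by simp

text \<open>The step length does not depend on \<open>t\<close>, so that the schemes for different
  times are powers of one operator. Rounding the number of steps down loses less than one step of
  time.\<close>

definition euler :: "nat \<Rightarrow> real \<Rightarrow> real^'x \<Rightarrow> real^'x" where
  "euler n t = step (h0 / 2 ^ n) ^^ nat \<lfloor>t / (h0 / 2 ^ n)\<rfloor>"

definition S :: "real \<Rightarrow> real^'x \<Rightarrow> real^'x" where
  "S t f = lim (\<lambda>n. euler n t f)"

lemma dyadic_h: "0 < h0 / 2 ^ n" "0 \<le> h0 / 2 ^ n" "h0 / 2 ^ n \<le> h0"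
  using h0_pos by (auto simp: field_simps)

lemma lto_euler: "lower_transition_operator (euler n t)"
  unfolding euler_def by (intro lto_step_pow dyadic_h)

lemma nat_floor_double:
  assumes "0 \<le> (x::real)"
  shows "nat \<lfloor>2 * x\<rfloor> = 2 * nat \<lfloor>x\<rfloor> \<or> nat \<lfloor>2 * x\<rfloor> = Suc (2 * nat \<lfloor>x\<rfloor>)"
proof -
  have "\<lfloor>2 * x\<rfloor> = 2 * \<lfloor>x\<rfloor> \<or> \<lfloor>2 * x\<rfloor> = 2 * \<lfloor>x\<rfloor> + 1" by linarith
  moreover have "\<lfloor>x\<rfloor> \<ge> 0" using assms by simp
  ultimately show ?thesis by linarith
qed

lemma floor_nat_le: "0 \<le> t \<Longrightarrow> real (nat \<lfloor>t / (h0 / 2 ^ n)\<rfloor>) * (h0 / 2 ^ n) \<le> t"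
proof -
  assume "0 \<le> t"
  then have "real (nat \<lfloor>t / (h0 / 2 ^ n)\<rfloor>) \<le> t / (h0 / 2 ^ n)"
    using dyadic_h(1)[of n] by (intro of_nat_floor) (auto simp: field_simps)
  then show ?thesis
    using dyadic_h(1)[of n] by (simp only: pos_le_divide_eq)
qed

text \<open>Halving the step length doubles the number of steps, up to one extra step caused by
  rounding. The doubling is estimated by \<open>step_halve\<close>, the extra step by
  \<open>step_bound\<close>; both errors are proportional to the step length, so the increments are
  summable.\<close>

lemma euler_Suc:
  assumes "0 \<le> t"
  shows "infnorm (euler (Suc n) t f - euler n t f) \<le> (t * h0 * M\<^sup>2 + h0 * M) * infnorm f * (1 / 2) ^ n"
proof -
  define h where "h = h0 / 2 ^ n"
  define k where "k = nat \<lfloor>t / h\<rfloor>"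
  define g where "g = (step (h / 2) ^^ (2 * k)) f"
  have h: "0 < h" "0 \<le> h" "h \<le> h0" and h2: "h0 / 2 ^ Suc n = h / 2"
    using dyadic_h[of n] by (auto simp: h_def)
  have kh: "k * h \<le> t"
    using floor_nat_le[OF assms, of n] by (simp add: k_def h_def)
  have "t / h \<ge> 0" using assms h by simp
  then have k2: "nat \<lfloor>t / (h / 2)\<rfloor> = 2 * k \<or> nat \<lfloor>t / (h / 2)\<rfloor> = Suc (2 * k)"
    using nat_floor_double[of "t / h"] by (simp add: k_def mult.commute)
  have "euler (Suc n) t f = g \<or> euler (Suc n) t f = step (h / 2) g"
    using k2 unfolding euler_def h2 g_def by auto
  moreover have "infnorm (step (h / 2) g - g) \<le> h * M * infnorm f"
  proof (rule order_trans[OF step_bound])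
    show "h / 2 * M * infnorm g \<le> h * M * infnorm f"
      unfolding g_def using h M_nonneg
      by (intro mult_mono lto_infnorm_le[OF lto_step_pow]) (auto simp: infnorm_pos_le)
  qed (use h in auto)
  ultimately have 1: "infnorm (euler (Suc n) t f - g) \<le> h * M * infnorm f"
    using h M_nonneg by (auto simp: infnorm_0 infnorm_pos_le)
  have "infnorm (g - euler n t f) \<le> k * (h * M)\<^sup>2 * infnorm f"
    using step_halve[OF h(2,3), of k f] by (simp add: g_def euler_def k_def h_def)
  also have "\<dots> = (k * h) * (h * M\<^sup>2 * infnorm f)"
    by (simp add: power2_eq_square)
  also have "\<dots> \<le> t * (h * M\<^sup>2 * infnorm f)"
    using kh h by (intro mult_right_mono) (auto simp: infnorm_pos_le)
  finally have 2: "infnorm (g - euler n t f) \<le> t * (h * M\<^sup>2 * infnorm f)" .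
  have "infnorm (euler (Suc n) t f - euler n t f)
      \<le> h * M * infnorm f + t * (h * M\<^sup>2 * infnorm f)"
    using infnorm_triangle[of "euler (Suc n) t f - g" "g - euler n t f"] 1 2 by simp
  then show ?thesis
    by (simp add: h_def algebra_simps power_divide)
qed

lemma euler_tendsto:
  assumes "0 \<le> t"
  shows "(\<lambda>n. euler n t f) \<longlonglongrightarrow> S t f"
proof -
  let ?X = "\<lambda>n. euler n t f" and ?K = "(t * h0 * M\<^sup>2 + h0 * M) * infnorm f"
  have "summable (\<lambda>n. ?X (Suc n) - ?X n)"
  proof (rule summable_comparison_test')
    show "summable (\<lambda>n. sqrt (DIM(real^'x)) * (?K * (1 / 2) ^ n))"
      by (intro summable_mult summable_geometric) simp
    show "norm (?X (Suc n) - ?X n) \<le> sqrt (DIM(real^'x)) * (?K * (1 / 2) ^ n)" for n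
      by (intro order_trans[OF norm_le_infnorm] mult_left_mono euler_Suc assms) auto
  qed
  then have "convergent (\<lambda>n. (\<Sum>i<n. ?X (Suc i) - ?X i))"
    by (rule summable_iff_convergent[THEN iffD1])
  then have "convergent (\<lambda>n. ?X n - ?X 0)"
    by (simp only: sum_lessThan_telescope[of ?X])
  then obtain l where "(\<lambda>n. ?X n - ?X 0) \<longlonglongrightarrow> l"
    by (auto simp: convergent_def)
  from tendsto_add[OF this tendsto_const[of "?X 0"]] have "convergent ?X"
    by (auto simp: convergent_def)
  then show ?thesis
    unfolding S_def by (simp add: convergent_LIMSEQ_iff)
qed

lemma lto_S: "0 \<le> t \<Longrightarrow> lower_transition_operator (S t)"
  by (rule lto_limit[OF lto_euler euler_tendsto])

lemma tendsto_dyadic: "(\<lambda>n. c * (h0 / 2 ^ n)) \<longlonglongrightarrow> 0"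
proof -
  have "(\<lambda>n. c * h0 * (1 / 2) ^ n) \<longlonglongrightarrow> c * h0 * 0"
    by (intro tendsto_intros LIMSEQ_realpow_zero) auto
  then show ?thesis by (simp add: power_divide)
qed

text \<open>The limit of \<open>step_pow_first_order\<close>. It serves the comparison with
  \<open>Phi\<close>, the derivative of \<open>E\<close> and the local inequalities behind both
  bounds.\<close>

lemma S_first_order:
  assumes "0 \<le> t"
  shows "infnorm (S t f - f - t *\<^sub>R R f) \<le> (t * M)\<^sup>2 * infnorm f"
proof -
  \<comment> \<open>The time that the scheme of level \<open>n\<close> really covers; it falls short
    of \<open>t\<close> by at most one step.\<close>
  define k where "k n = real (nat \<lfloor>t / (h0 / 2 ^ n)\<rfloor>) * (h0 / 2 ^ n)" for n
  have kb: "k n \<le> t" "t - k n \<le> h0 / 2 ^ n" for n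
  proof -
    show "k n \<le> t"
      unfolding k_def by (rule floor_nat_le[OF assms])
    have "t / (h0 / 2 ^ n) - 1 \<le> real (nat \<lfloor>t / (h0 / 2 ^ n)\<rfloor>)"
      by linarith
    then have le: "(t / (h0 / 2 ^ n) - 1) * (h0 / 2 ^ n) \<le> k n"
      unfolding k_def using dyadic_h[of n] by (intro mult_right_mono) auto
    have "(x / d - 1) * d = x - d" if "d > 0" for x d :: real
      using that by (simp add: left_diff_distrib)
    from le[unfolded this[OF dyadic_h(1)]] show "t - k n \<le> h0 / 2 ^ n"
      by (metis diff_le_eq add.commute)
  qed
  have "(\<lambda>n. t - k n) \<longlonglongrightarrow> 0"
  proof (rule tendsto_sandwich[of "\<lambda>_. 0"])
    show "(\<lambda>n. 1 * (h0 / 2 ^ n)) \<longlonglongrightarrow> 0" by (rule tendsto_dyadic)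
    show "\<forall>\<^sub>F n in sequentially. 0 \<le> t - k n"
      by (intro always_eventually allI diff_ge_0_iff_ge[THEN iffD2] kb(1))
    show "\<forall>\<^sub>F n in sequentially. t - k n \<le> 1 * (h0 / 2 ^ n)"
      unfolding mult_1 by (intro always_eventually allI kb(2))
  qed (rule tendsto_const)
  from tendsto_diff[OF tendsto_const[of t] this] have k: "k \<longlonglongrightarrow> t"
    by simp
  show ?thesis
  proof (rule LIMSEQ_le)
    show "(\<lambda>n. infnorm (euler n t f - f - k n *\<^sub>R R f)) \<longlonglongrightarrow> infnorm (S t f - f - t *\<^sub>R R f)"
      by (intro tendsto_intros euler_tendsto assms k)
    show "(\<lambda>n. (k n * M)\<^sup>2 * infnorm f) \<longlonglongrightarrow> (t * M)\<^sup>2 * infnorm f"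
      by (intro tendsto_intros k)
    show "\<exists>N. \<forall>n\<ge>N. infnorm (euler n t f - f - k n *\<^sub>R R f) \<le> (k n * M)\<^sup>2 * infnorm f"
      unfolding euler_def k_def by (intro exI[of _ 0] allI impI step_pow_first_order dyadic_h)
  qed
qed

lemma S_zero [simp]: "S 0 f = f"
proof -
  have "infnorm (S 0 f - f) \<le> 0"
    using S_first_order[of 0 f] by simp
  then have "infnorm (S 0 f - f) = 0"
    using infnorm_pos_le antisym by blast
  then show ?thesis
    by (simp add: infnorm_eq_0)
qed

lemma nat_floor_add:
  assumes "0 \<le> (x::real)" "0 \<le> y"
  shows "nat \<lfloor>x + y\<rfloor> = nat \<lfloor>x\<rfloor> + nat \<lfloor>y\<rfloor> \<or> nat \<lfloor>x + y\<rfloor> = Suc (nat \<lfloor>x\<rfloor> + nat \<lfloor>y\<rfloor>)"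
proof -
  have "\<lfloor>x + y\<rfloor> = \<lfloor>x\<rfloor> + \<lfloor>y\<rfloor> \<or> \<lfloor>x + y\<rfloor> = \<lfloor>x\<rfloor> + \<lfloor>y\<rfloor> + 1" by linarith
  moreover have "\<lfloor>x\<rfloor> \<ge> 0" "\<lfloor>y\<rfloor> \<ge> 0" using assms by simp_all
  ultimately show ?thesis by linarith
qed

text \<open>On each level both sides are powers of the same step operator, with exponents that
  differ by at most one because of rounding; a single step moves a vector by an amount that vanishes
  with the step length.\<close>

lemma S_add:
  assumes "0 \<le> t" "0 \<le> r"
  shows "S (t + r) f = S t (S r f)"
proof -
  have 1: "(\<lambda>n. euler n t (euler n r f)) \<longlonglongrightarrow> S t (S r f)"
  proof (rule LIMSEQ_infnormI, rule tendsto_sandwich[of "\<lambda>_. 0"])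
    let ?b = "\<lambda>n. infnorm (euler n r f - S r f) + infnorm (euler n t (S r f) - S t (S r f))"
    have "infnorm (euler n t (euler n r f) - S t (S r f)) \<le> ?b n" for n
      using infnorm_triangle[of "euler n t (euler n r f) - euler n t (S r f)"
            "euler n t (S r f) - S t (S r f)"]
          lto_nonexpansive[OF lto_euler, of n t "euler n r f" "S r f"] by simp
    then show "\<forall>\<^sub>F n in sequentially. infnorm (euler n t (euler n r f) - S t (S r f)) \<le> ?b n"
      by simp
    have "?b \<longlonglongrightarrow> infnorm (S r f - S r f) + infnorm (S t (S r f) - S t (S r f))"
      by (intro tendsto_intros euler_tendsto assms)
    then show "?b \<longlonglongrightarrow> 0" by (simp add: infnorm_0)
  qed (auto simp: infnorm_pos_le)
  have "(\<lambda>n. euler n (t + r) f - euler n t (euler n r f)) \<longlonglongrightarrow> 0"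
  proof (rule LIMSEQ_infnormI, rule tendsto_sandwich[of "\<lambda>_. 0"])
    let ?b = "\<lambda>n. M * infnorm f * (h0 / 2 ^ n)"
    have "infnorm (euler n (t + r) f - euler n t (euler n r f)) \<le> ?b n" for n
    proof -
      define h where "h = h0 / 2 ^ n"
      have h: "0 < h" "0 \<le> h" "h \<le> h0"
        using dyadic_h[of n] by (auto simp: h_def)
      let ?k = "nat \<lfloor>t / h\<rfloor>" and ?l = "nat \<lfloor>r / h\<rfloor>"
      have "t / h \<ge> 0" "r / h \<ge> 0" using assms h by auto
      then have "nat \<lfloor>(t + r) / h\<rfloor> = ?k + ?l \<or> nat \<lfloor>(t + r) / h\<rfloor> = Suc (?k + ?l)"
        using nat_floor_add[of "t / h" "r / h"] by (simp add: add_divide_distrib)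
      then have "euler n (t + r) f = euler n t (euler n r f) \<or>
          euler n (t + r) f = step h (euler n t (euler n r f))"
        unfolding euler_def h_def[symmetric] by (auto simp: funpow_add)
      moreover have "infnorm (step h (euler n t (euler n r f)) - euler n t (euler n r f))
          \<le> h * M * infnorm f"
      proof (rule order_trans[OF step_bound])
        show "h * M * infnorm (euler n t (euler n r f)) \<le> h * M * infnorm f"
          using h M_nonneg lto_infnorm_le[OF lto_compose[OF lto_euler lto_euler]]
          by (intro mult_left_mono) auto
      qed (use h in auto)
      ultimately have "infnorm (euler n (t + r) f - euler n t (euler n r f)) \<le> h * M * infnorm f"
        using h M_nonneg by (auto simp: infnorm_0 infnorm_pos_le)
      then show ?thesis by (simp add: h_def mult_ac)
    qed
    then show "\<forall>\<^sub>F n in sequentially.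
        infnorm (euler n (t + r) f - euler n t (euler n r f) - 0) \<le> ?b n"
      by simp
    show "?b \<longlonglongrightarrow> 0" by (rule tendsto_dyadic)
  qed (auto simp: infnorm_pos_le)
  from tendsto_add[OF this 1] have "(\<lambda>n. euler n (t + r) f) \<longlonglongrightarrow> S t (S r f)"
    by simp
  moreover have "(\<lambda>n. euler n (t + r) f) \<longlonglongrightarrow> S (t + r) f"
    using assms by (intro euler_tendsto) simp
  ultimately show ?thesis
    by (rule LIMSEQ_unique[symmetric])
qed

end

section \<open>Identification of the semigroup with the limit over refining partitions\<close>

lemma mesh_gap:
  assumes "mesh v \<le> \<delta>" "Suc i < length v"
  shows "v ! Suc i - v ! i \<le> \<delta>"
proof -
  have "finite {v ! Suc i - v ! i | i. Suc i < length v}"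
    by (rule finite_image_set) (rule finite_subset[of _ "{..<length v}"], auto)
  then have "v ! Suc i - v ! i \<le> mesh v"
    unfolding mesh_def using assms(2) by (intro Max_ge) auto
  with assms(1) show ?thesis by simp
qed

text \<open>Needed for uniqueness of the limit operator: without partitions of small mesh its
  defining condition would be vacuous.\<close>

lemma fine_partition_exists:
  assumes "0 \<le> s" "0 < \<delta>"
  obtains v where "v \<in> partitions 0 s" "mesh v \<le> \<delta>"
proof (cases "s = 0")
  case True
  then have "[0] \<in> partitions 0 s" "mesh [0] \<le> \<delta>"
    using assms by (auto simp: partitions_def mesh_def)
  then show ?thesis by (rule that)
next
  case False
  obtain n :: nat where n: "s / \<delta> \<le> n" using real_arch_simple by blast
  have "0 < s / \<delta>" using False assms by simp
  with n have n0: "0 < n" by (cases n) auto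
  have sn: "s / n \<le> \<delta>"
    using n n0 assms by (simp add: field_simps)
  let ?v = "map (\<lambda>i. s * i / n) [0..<Suc n]"
  have nth: "?v ! i = s * i / n" if "i < length ?v" for i
    using that by (simp del: upt_Suc)
  have "sorted_wrt (<) ?v"
    unfolding sorted_wrt_iff_nth_less
  proof (intro allI impI)
    fix i j assume ij: "i < j" "j < length ?v"
    then have "s * real i / n < s * real j / n"
      using n0 assms False by (intro divide_strict_right_mono mult_strict_left_mono) auto
    with ij show "?v ! i < ?v ! j" by (simp only: nth)
  qed
  moreover have "hd ?v = 0" "last ?v = s"
    using n0 by (simp_all add: hd_map last_map del: upt_Suc)
  ultimately have "?v \<in> partitions 0 s"
    by (simp add: partitions_def)
  moreover have "mesh ?v \<le> \<delta>"
    unfolding mesh_def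
  proof (subst Max_le_iff)
    have "?v ! Suc i - ?v ! i = s / n" if "Suc i < length ?v" for i
      unfolding nth[OF that] nth[OF Suc_lessD[OF that]] using n0 by (simp add: field_simps)
    then show "\<forall>a\<in>insert 0 {?v ! Suc i - ?v ! i | i. Suc i < length ?v}. a \<le> \<delta>"
      using sn assms by auto
    have "finite {i. Suc i < length ?v}"
      by (rule finite_subset[of _ "{..<length ?v}"]) auto
    then show "finite (insert 0 {?v ! Suc i - ?v ! i | i. Suc i < length ?v})"
      by (intro finite.insertI finite_image_set)
  qed simp
  ultimately show ?thesis by (rule that)
qed

context rate_operator
begin

lemma Phi_trivial: "Phi R [] = (\<lambda>f. f)" "Phi R [t] = (\<lambda>f. f)"
  by auto

lemma lto_Phi:
  assumes "sorted_wrt (<) v" "\<And>i. Suc i < length v \<Longrightarrow> v ! Suc i - v ! i \<le> h0"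
  shows "lower_transition_operator (Phi R v)"
  using assms
proof (induction v rule: induct_list012)
  case (3 t0 t1 v)
  have "lower_transition_operator (Phi R (t1 # v))"
    using "3.prems"(1) "3.prems"(2)[of "Suc i" for i] by (intro "3.IH") auto
  moreover have "0 \<le> t1 - t0" "t1 - t0 \<le> h0"
    using "3.prems"(1) "3.prems"(2)[of 0] by auto
  ultimately have "lower_transition_operator (\<lambda>f. step (t1 - t0) (Phi R (t1 # v) f))"
    by (intro lto_compose[OF lto_step'])
  then show ?case by (simp add: step_def)
qed (simp_all only: Phi_trivial lto_id)

text \<open>A partition step of length \<open>d\<close> has local error \<open>(d M)^2\<close>,
  hence at most \<open>d * \<delta> * M^2\<close>; outer steps do not enlarge it, and the lengths
  add up. The order of the end points is carried along because the induction applies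
  \<open>S\<close> to their difference.\<close>

lemma Phi_error:
  assumes "v \<noteq> []" "sorted_wrt (<) v" "\<delta> \<le> h0"
    and "\<And>i. Suc i < length v \<Longrightarrow> v ! Suc i - v ! i \<le> \<delta>"
  shows "hd v \<le> last v \<and>
    infnorm (Phi R v f - S (last v - hd v) f) \<le> (last v - hd v) * \<delta> * M\<^sup>2 * infnorm f"
  using assms
proof (induction v rule: induct_list012)
  case (3 t0 t1 v)
  define b where "b = last (t1 # v)"
  have IH: "t1 \<le> b" "infnorm (Phi R (t1 # v) f - S (b - t1) f) \<le> (b - t1) * \<delta> * M\<^sup>2 * infnorm f"
    unfolding b_def using "3.IH"(2) "3.prems"(2,3) "3.prems"(4)[of "Suc i" for i] by auto
  have gap: "0 \<le> t1 - t0" "t1 - t0 \<le> \<delta>" "t1 - t0 \<le> h0"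
    using "3.prems"(2,3) "3.prems"(4)[of 0] by auto
  let ?g = "Phi R (t1 # v) f" and ?g' = "S (b - t1) f"
  have "S (b - t0) f = S (t1 - t0) ?g'"
    using S_add[of "t1 - t0" "b - t1" f] gap IH(1) by simp
  then have "infnorm (Phi R (t0 # t1 # v) f - S (b - t0) f)
      = infnorm ((step (t1 - t0) ?g - step (t1 - t0) ?g') + (step (t1 - t0) ?g' - S (t1 - t0) ?g'))"
    by (simp add: step_def algebra_simps)
  also have "\<dots> \<le> infnorm (step (t1 - t0) ?g - step (t1 - t0) ?g')
      + infnorm (step (t1 - t0) ?g' - S (t1 - t0) ?g')"
    by (rule infnorm_triangle)
  also have "infnorm (step (t1 - t0) ?g - step (t1 - t0) ?g') \<le> infnorm (?g - ?g')"
    using gap by (intro lto_nonexpansive lto_step')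
  also have "infnorm (step (t1 - t0) ?g' - S (t1 - t0) ?g') \<le> (t1 - t0) * \<delta> * M\<^sup>2 * infnorm f"
  proof -
    have "infnorm (step (t1 - t0) ?g' - S (t1 - t0) ?g')
        = infnorm (S (t1 - t0) ?g' - ?g' - (t1 - t0) *\<^sub>R R ?g')"
      by (subst infnorm_sub) (simp add: step_def algebra_simps)
    also have "\<dots> \<le> ((t1 - t0) * M)\<^sup>2 * infnorm ?g'"
      using gap by (intro S_first_order)
    also have "\<dots> \<le> ((t1 - t0) * \<delta> * M\<^sup>2) * infnorm f"
    proof (rule mult_mono)
      have "(t1 - t0) * (t1 - t0) * M\<^sup>2 \<le> (t1 - t0) * \<delta> * M\<^sup>2"
        using gap by (intro mult_right_mono mult_left_mono) auto
      then show "((t1 - t0) * M)\<^sup>2 \<le> (t1 - t0) * \<delta> * M\<^sup>2"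
        by (simp add: power2_eq_square mult_ac)
      show "infnorm ?g' \<le> infnorm f"
        using IH(1) by (intro lto_infnorm_le lto_S) simp
      show "0 \<le> (t1 - t0) * \<delta> * M\<^sup>2"
        using gap by simp
    qed (rule infnorm_pos_le)
    finally show ?thesis .
  qed
  also note IH(2)
  finally show ?case
    using gap IH(1) by (simp add: b_def algebra_simps)
qed (auto simp: infnorm_0)

lemma lower_transition_eq_S:
  assumes "0 \<le> s"
  shows "lower_transition R 0 s = S s"
  unfolding lower_transition_def
proof (rule the_equality)
  let ?P = "\<lambda>L. \<forall>\<epsilon>>0. \<exists>\<delta>>0. \<forall>v\<in>partitions 0 s. mesh v \<le> \<delta> \<longrightarrow> op_norm (\<lambda>f. L f - Phi R v f) \<le> \<epsilon>"
  have S: "?P (S s)"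
  proof (intro allI impI)
    fix \<epsilon> :: real assume \<epsilon>: "\<epsilon> > 0"
    \<comment> \<open>The minimum with \<open>h0\<close> makes each factor of \<open>Phi\<close> a
      lower transition operator, and the summand 1 keeps the denominator positive for
      \<open>s = 0\<close>.\<close>
    define \<delta> where "\<delta> = min h0 (\<epsilon> / (s * M\<^sup>2 + 1))"
    have K: "s * M\<^sup>2 + 1 > 0" using assms by (simp add: add_nonneg_pos)
    then have \<delta>: "\<delta> > 0" "\<delta> \<le> h0"
      using h0_pos \<epsilon> by (simp_all add: \<delta>_def)
    have "\<delta> \<le> \<epsilon> / (s * M\<^sup>2 + 1)"
      by (simp add: \<delta>_def)
    with K have \<delta>3: "\<delta> * (s * M\<^sup>2 + 1) \<le> \<epsilon>"
      by (simp only: pos_le_divide_eq)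
    show "\<exists>\<delta>>0. \<forall>v\<in>partitions 0 s. mesh v \<le> \<delta> \<longrightarrow> op_norm (\<lambda>f. S s f - Phi R v f) \<le> \<epsilon>"
    proof (intro exI[of _ \<delta>] conjI ballI impI op_norm_leI)
      fix v and f :: "real^'x"
      assume v: "v \<in> partitions 0 s" "mesh v \<le> \<delta>" and f: "infnorm f = 1"
      have "infnorm (S s f - Phi R v f) \<le> s * \<delta> * M\<^sup>2"
        using Phi_error[of v \<delta> f] mesh_gap[OF v(2)] v(1) \<delta> f
        by (subst infnorm_sub) (auto simp: partitions_def)
      also have "\<dots> \<le> \<delta> * (s * M\<^sup>2 + 1)"
        using \<delta>(1) by (simp add: algebra_simps)
      finally show "infnorm (S s f - Phi R v f) \<le> \<epsilon>"
        using \<delta>3 by simp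
    qed fact
  qed
  with lto_S[OF assms] show "lower_transition_operator (S s) \<and> ?P (S s)" by blast
  fix L assume L: "lower_transition_operator L \<and> ?P L"
  \<comment> \<open>Uniqueness: compare \<open>L\<close> and \<open>S s\<close> with
    \<open>Phi\<close> for one common fine partition. \<open>op_norm\<close> looks at unit vectors
    only; homogeneity extends the equality to all others. The mesh is also kept below
    \<open>h0\<close> so that \<open>lto_op_norm_diff\<close> applies to \<open>Phi\<close>.\<close>
  have unit: "L g = S s g" if g: "infnorm g = 1" for g
  proof -
    have "infnorm (L g - S s g) \<le> \<epsilon>" if \<epsilon>: "\<epsilon> > 0" for \<epsilon> :: real
    proof -
      obtain \<delta>1 where \<delta>1: "\<delta>1 > 0"
        "\<And>v. v \<in> partitions 0 s \<Longrightarrow> mesh v \<le> \<delta>1 \<Longrightarrow> op_norm (\<lambda>f. L f - Phi R v f) \<le> \<epsilon> / 2"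
        using conjunct2[OF L, rule_format, of "\<epsilon> / 2"] \<epsilon> by auto
      obtain \<delta>2 where \<delta>2: "\<delta>2 > 0"
        "\<And>v. v \<in> partitions 0 s \<Longrightarrow> mesh v \<le> \<delta>2 \<Longrightarrow> op_norm (\<lambda>f. S s f - Phi R v f) \<le> \<epsilon> / 2"
        using S[rule_format, of "\<epsilon> / 2"] \<epsilon> by auto
      obtain v where v: "v \<in> partitions 0 s" "mesh v \<le> min h0 (min \<delta>1 \<delta>2)"
        using fine_partition_exists[OF assms, of "min h0 (min \<delta>1 \<delta>2)"] h0_pos \<delta>1(1) \<delta>2(1) by auto
      have Phi: "lower_transition_operator (Phi R v)"
        using v mesh_gap[of v h0] by (intro lto_Phi) (auto simp: partitions_def)
      have "infnorm (L g - Phi R v g) \<le> \<epsilon> / 2"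
        by (rule order_trans[OF lto_op_norm_diff[OF conjunct1[OF L] Phi g] \<delta>1(2)]) (use v in auto)
      moreover have "infnorm (S s g - Phi R v g) \<le> \<epsilon> / 2"
        by (rule order_trans[OF lto_op_norm_diff[OF lto_S[OF assms] Phi g] \<delta>2(2)]) (use v in auto)
      ultimately show ?thesis
        using infnorm_triangle[of "L g - Phi R v g" "Phi R v g - S s g"]
          infnorm_sub[of "S s g" "Phi R v g"] by simp
    qed
    then have "infnorm (L g - S s g) \<le> 0"
      by (rule dense_ge)
    then have "infnorm (L g - S s g) = 0"
      by (intro antisym infnorm_pos_le)
    then show ?thesis
      by (simp add: infnorm_eq_0)
  qed
  show "L = S s"
  proof
    fix f
    show "L f = S s f"
    proof (cases "f = 0")
      case True
      then show ?thesis
        using conjunct1[OF L] lto_S[OF assms] by (simp add: lto_zero)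
    next
      case False
      then have pos: "infnorm f > 0" by (simp add: infnorm_pos_lt)
      define g where "g = (1 / infnorm f) *\<^sub>R f"
      have "infnorm g = 1" and f: "f = infnorm f *\<^sub>R g"
        using pos by (auto simp: g_def infnorm_mul)
      from unit[OF this(1)] have "L (infnorm f *\<^sub>R g) = S s (infnorm f *\<^sub>R g)"
        using conjunct1[OF L] lto_S[OF assms] pos by (simp add: lto_scale)
      then show ?thesis using f by simp
    qed
  qed
qed

end

section \<open>Lower envelopes of sets of rate matrices\<close>

lemma mult_vec_nth: "((A::real^'x::finite^'x) *v f) $ x = (\<Sum>y\<in>UNIV. A $ x $ y * f $ y)"
  by (simp add: matrix_vector_mult_def)

text \<open>As rows sum to zero, \<open>f\<close> may be replaced by \<open>f - m \<ge> 0\<close>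
  with \<open>m\<close> its minimum. Off-diagonal terms are then non-negative, and the diagonal one
  is at worst \<open>- B (f x - m)\<close>, which \<open>f x - m\<close> itself absorbs as
  \<open>h * B \<le> 1\<close>.\<close>

lemma rate_matrix_step_ge:
  assumes Q: "Q \<in> rate_matrices" and B: "\<bar>Q $ x $ x\<bar> \<le> B" and h: "0 \<le> h" "h * B \<le> 1"
  shows "f $ x + h * (Q *v f) $ x \<ge> Min (range (($) f))"
proof -
  define m where "m = Min (range (($) f))"
  have m: "m \<le> f $ y" for y
    unfolding m_def by (intro Min_le) auto
  have "(Q *v f) $ x = (\<Sum>y\<in>UNIV. Q $ x $ y * (f $ y - m))"
    using Q by (simp add: mult_vec_nth rate_matrices_def right_diff_distrib sum_subtractf
        flip: sum_distrib_right)
  also have "\<dots> = Q $ x $ x * (f $ x - m) + (\<Sum>y\<in>UNIV - {x}. Q $ x $ y * (f $ y - m))"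
    by (simp add: sum.remove)
  also have "\<dots> \<ge> - B * (f $ x - m) + 0"
    using Q m B by (intro add_mono mult_right_mono sum_nonneg) (auto simp: rate_matrices_def)
  finally have "h * (Q *v f) $ x \<ge> h * (- B * (f $ x - m))"
    using h by (intro mult_left_mono) auto
  moreover have "h * B * (f $ x - m) \<le> 1 * (f $ x - m)"
    using h m by (intro mult_right_mono) auto
  ultimately show ?thesis
    by (simp add: m_def algebra_simps)
qed

lemma lower_envelope_singleton [simp]: "lower_envelope {Q} f = Q *v f"
  by (simp add: lower_envelope_def vec_eq_iff)

context
  fixes \<Q> :: "(real^'x::finite^'x) set" and B :: real
  assumes ne: "\<Q> \<noteq> {}" and rate: "\<Q> \<subseteq> rate_matrices"
    and bound: "\<And>Q x y. Q \<in> \<Q> \<Longrightarrow> \<bar>Q $ x $ y\<bar> \<le> B"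
begin

lemma lower_envelope_le:
  assumes "Q \<in> \<Q>"
  shows "lower_envelope \<Q> f $ x \<le> (Q *v f) $ x"
proof -
  have "(Q *v f) $ x \<ge> (\<Sum>y\<in>UNIV. - (B * \<bar>f $ y\<bar>))" if "Q \<in> \<Q>" for Q
    unfolding mult_vec_nth
  proof (rule sum_mono)
    fix y
    have "\<bar>Q $ x $ y * f $ y\<bar> \<le> B * \<bar>f $ y\<bar>"
      unfolding abs_mult by (intro mult_right_mono bound that) simp
    then show "- (B * \<bar>f $ y\<bar>) \<le> Q $ x $ y * f $ y" by linarith
  qed
  then have "bdd_below ((\<lambda>Q. (Q *v f) $ x) ` \<Q>)"
    by (intro bdd_belowI2) auto
  then show ?thesis
    unfolding lower_envelope_def using assms by (auto intro: cINF_lower)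
qed

lemma lower_envelope_ge: "(\<And>Q. Q \<in> \<Q> \<Longrightarrow> c \<le> (Q *v f) $ x) \<Longrightarrow> c \<le> lower_envelope \<Q> f $ x"
  unfolding lower_envelope_def using ne by (simp add: cINF_greatest)

text \<open>Each \<open>I + h Q\<close> is linear and stays above the minimum of its argument;
  coordinatewise infima keep the lower bound and the homogeneity and turn additivity into
  superadditivity.\<close>

lemma lower_envelope_rate_operator:
  assumes "h0 > 0" "h0 * B \<le> 1"
  shows "rate_operator (lower_envelope \<Q>) h0"
proof
  fix h :: real assume h: "0 \<le> h" "h \<le> h0"
  have "B \<ge> 0"
    using ne bound abs_ge_zero order_trans by (metis ex_in_conv)
  with h assms have hB: "h * B \<le> 1"
    using mult_right_mono[of h h0 B] by linarith
  let ?R = "lower_envelope \<Q>"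
  show "lower_transition_operator (\<lambda>f. f + h *\<^sub>R ?R f)"
    unfolding lower_transition_operator_def
  proof (intro conjI allI impI)
    fix f x
    show "Min (range (($) f)) \<le> (f + h *\<^sub>R ?R f) $ x"
    proof (cases "h = 0")
      case False
      with h have h': "h > 0" by simp
      have "(Min (range (($) f)) - f $ x) / h \<le> ?R f $ x"
      proof (rule lower_envelope_ge)
        fix Q assume "Q \<in> \<Q>"
        then have "Min (range (($) f)) \<le> f $ x + h * (Q *v f) $ x"
          using rate bound h hB by (intro rate_matrix_step_ge[of _ _ B]) auto
        with h' show "(Min (range (($) f)) - f $ x) / h \<le> (Q *v f) $ x"
          by (simp add: field_simps)
      qed
      with h' show ?thesis by (simp add: field_simps)
    qed (auto intro: Min_le)
  next
    fix f g x
    have "?R f $ x + ?R g $ x \<le> ?R (f + g) $ x"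
    proof (rule lower_envelope_ge)
      fix Q assume Q: "Q \<in> \<Q>"
      show "?R f $ x + ?R g $ x \<le> (Q *v (f + g)) $ x"
        using lower_envelope_le[OF Q, of f x] lower_envelope_le[OF Q, of g x]
        by (simp add: matrix_vector_right_distrib)
    qed
    then have "h * (?R f $ x + ?R g $ x) \<le> h * ?R (f + g) $ x"
      using h by (intro mult_left_mono) auto
    then show "(f + g + h *\<^sub>R ?R (f + g)) $ x \<ge> (f + h *\<^sub>R ?R f) $ x + (g + h *\<^sub>R ?R g) $ x"
      by (simp add: algebra_simps)
  next
    fix f :: "real^'x" and c :: real assume c: "c \<ge> 0"
    have "?R (c *\<^sub>R f) $ x = c * ?R f $ x" for x
    proof (rule antisym)
      show "c * ?R f $ x \<le> ?R (c *\<^sub>R f) $ x"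
        using c lower_envelope_le
        by (intro lower_envelope_ge) (auto simp: matrix_vector_mult_scaleR intro: mult_left_mono)
      show "?R (c *\<^sub>R f) $ x \<le> c * ?R f $ x"
      proof (cases "c = 0")
        case True
        then show ?thesis
          using ne lower_envelope_le[of _ 0 x] by (auto simp: ex_in_conv[symmetric])
      next
        case False
        with c have c: "c > 0" by simp
        have "?R (c *\<^sub>R f) $ x / c \<le> ?R f $ x"
        proof (rule lower_envelope_ge)
          fix Q assume "Q \<in> \<Q>"
          from lower_envelope_le[OF this, of "c *\<^sub>R f" x] c
          show "?R (c *\<^sub>R f) $ x / c \<le> (Q *v f) $ x"
            by (simp add: matrix_vector_mult_scaleR field_simps)
        qed
        with c show ?thesis by (simp add: field_simps)
      qed
    qed
    then show "c *\<^sub>R f + h *\<^sub>R ?R (c *\<^sub>R f) = c *\<^sub>R (f + h *\<^sub>R ?R f)"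
      by (simp add: vec_eq_iff algebra_simps)
  qed
qed fact

end

lemma infnorm_mult_vec_le:
  "infnorm ((A::real^'x::finite^'x) *v f) \<le> (\<Sum>x\<in>UNIV. \<Sum>y\<in>UNIV. \<bar>A $ x $ y\<bar>) * infnorm f"
proof (rule infnorm_leI)
  fix x
  have "\<bar>(A *v f) $ x\<bar> \<le> (\<Sum>y\<in>UNIV. \<bar>A $ x $ y * f $ y\<bar>)"
    unfolding mult_vec_nth by (rule sum_abs)
  also have "\<dots> \<le> (\<Sum>y\<in>UNIV. \<bar>A $ x $ y\<bar> * infnorm f)"
    unfolding abs_mult by (intro sum_mono mult_left_mono component_le_infnorm_cart) auto
  also have "\<dots> = (\<Sum>y\<in>UNIV. \<bar>A $ x $ y\<bar>) * infnorm f"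
    by (simp add: sum_distrib_right)
  also have "\<dots> \<le> (\<Sum>x\<in>UNIV. \<Sum>y\<in>UNIV. \<bar>A $ x $ y\<bar>) * infnorm f"
    by (intro mult_right_mono infnorm_pos_le
        member_le_sum[of x UNIV "\<lambda>x. \<Sum>y\<in>UNIV. \<bar>A $ x $ y\<bar>"]) (auto intro: sum_nonneg)
  finally show "\<bar>(A *v f) $ x\<bar> \<le> \<dots>" .
qed

text \<open>Basis vectors have norm 1. This turns the two bounds stated with \<open>op_norm\<close>,
  on \<open>\<Q>\<close> and on difference quotients, into entrywise ones.\<close>

lemma abs_entry_le_op_norm: "\<bar>(A::real^'x::finite^'x) $ x $ y\<bar> \<le> op_norm ((*v) A)"
proof -
  have "\<bar>A $ x $ y\<bar> = \<bar>(A *v axis y 1) $ x\<bar>"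
    by (simp add: matrix_vector_mult_basis column_def)
  also have "\<dots> \<le> infnorm (A *v axis y 1)"
    by (rule component_le_infnorm_cart)
  also have "\<dots> \<le> op_norm ((*v) A)"
    unfolding op_norm_def
  proof (rule cSup_upper)
    have "infnorm (A *v f) \<le> (\<Sum>x\<in>UNIV. \<Sum>y\<in>UNIV. \<bar>A $ x $ y\<bar>)" if "infnorm f = 1" for f
      using infnorm_mult_vec_le[of A f] that by simp
    then show "bdd_above {infnorm (A *v f) | f. infnorm f = 1}"
      by (intro bdd_aboveI) blast
  qed (use infnorm_axis in blast)
  finally show ?thesis .
qed

lemma bounded_rates_entries:
  assumes "bounded_rates \<Q>"
  obtains B where "B > 0" "\<And>Q x y. Q \<in> \<Q> \<Longrightarrow> \<bar>Q $ x $ y\<bar> \<le> B"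
proof -
  obtain B where "\<And>Q. Q \<in> \<Q> \<Longrightarrow> op_norm ((*v) Q) \<le> B"
    using assms by (auto simp: bounded_rates_def bdd_above_def)
  then have "\<bar>Q $ x $ y\<bar> \<le> \<bar>B\<bar> + 1" if "Q \<in> \<Q>" for Q x y
    using abs_entry_le_op_norm[of Q x y] that by fastforce
  then show ?thesis
    by (intro that[of "\<bar>B\<bar> + 1"]) auto
qed

section \<open>Transition families\<close>

definition stochastic_matrix :: "real^'x::finite^'x \<Rightarrow> bool" where
  "stochastic_matrix A \<longleftrightarrow> (\<forall>x y. A $ x $ y \<ge> 0) \<and> (\<forall>x. (\<Sum>y\<in>UNIV. A $ x $ y) = 1)"

lemma stochastic_matrix_mult:
  assumes A: "stochastic_matrix A" and B: "stochastic_matrix B"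
  shows "stochastic_matrix (A ** B)"
  unfolding stochastic_matrix_def
proof (intro conjI allI)
  show "(A ** B) $ x $ y \<ge> 0" for x y
    using A B by (auto simp: matrix_matrix_mult_def stochastic_matrix_def intro: sum_nonneg)
  show "(\<Sum>y\<in>UNIV. (A ** B) $ x $ y) = 1" for x
    using A B by (simp add: matrix_matrix_mult_def stochastic_matrix_def sum.swap[of _ UNIV UNIV]
        flip: sum_distrib_left)
qed

text \<open>The one-sided derivatives are required to exist, which holds for the piecewise constant
  families used here; well-behavedness and consistency are then immediate.\<close>

definition transition_family ::
    "(real^'x::finite^'x) set \<Rightarrow> (real \<Rightarrow> real \<Rightarrow> real^'x^'x) \<Rightarrow> bool" where
  "transition_family \<Q> T \<longleftrightarrow>
     (\<forall>t\<ge>0. \<forall>r\<ge>t. stochastic_matrix (T t r)) \<and>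
     (\<forall>t\<ge>0. T t t = mat 1) \<and>
     (\<forall>t\<ge>0. \<forall>r\<ge>t. \<forall>q\<ge>r. T t r ** T r q = T t q) \<and>
     (\<forall>t\<ge>0. \<exists>Q\<in>\<Q>. ((\<lambda>\<Delta>. (1 / \<Delta>) *\<^sub>R (T t (t + \<Delta>) - mat 1)) \<longlongrightarrow> Q) (at_right 0)) \<and>
     (\<forall>t>0. \<exists>Q\<in>\<Q>. ((\<lambda>\<Delta>. (1 / \<Delta>) *\<^sub>R (T (t - \<Delta>) t - mat 1)) \<longlongrightarrow> Q) (at_right 0))"

context
  fixes \<Q> :: "(real^'x::finite^'x) set" and T
  assumes T: "transition_family \<Q> T"
begin

lemma family_stochastic: "0 \<le> t \<Longrightarrow> t \<le> r \<Longrightarrow> stochastic_matrix (T t r)"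
  and family_refl: "0 \<le> t \<Longrightarrow> T t t = mat 1"
  and family_comp: "0 \<le> t \<Longrightarrow> t \<le> r \<Longrightarrow> r \<le> q \<Longrightarrow> T t r ** T r q = T t q"
  and family_right: "0 \<le> t \<Longrightarrow>
    \<exists>Q\<in>\<Q>. ((\<lambda>\<Delta>. (1 / \<Delta>) *\<^sub>R (T t (t + \<Delta>) - mat 1)) \<longlongrightarrow> Q) (at_right 0)"
  and family_left: "0 < t \<Longrightarrow>
    \<exists>Q\<in>\<Q>. ((\<lambda>\<Delta>. (1 / \<Delta>) *\<^sub>R (T (t - \<Delta>) t - mat 1)) \<longlongrightarrow> Q) (at_right 0)"
  using T unfolding transition_family_def by blast+

end

text \<open>Follows \<open>T1\<close> until \<open>a\<close> and \<open>T2\<close> afterwards. By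
  the order of the tests, left quotients at \<open>a\<close> see only \<open>T1\<close> and right
  quotients only \<open>T2\<close>, so that the two regimes never mix within one derivative.\<close>

definition concat_family ::
    "real \<Rightarrow> (real \<Rightarrow> real \<Rightarrow> real^'x::finite^'x) \<Rightarrow> (real \<Rightarrow> real \<Rightarrow> real^'x^'x) \<Rightarrow>
     real \<Rightarrow> real \<Rightarrow> real^'x^'x" where
  "concat_family a T1 T2 t r =
     (if r \<le> a then T1 t r else if a \<le> t then T2 t r else T1 t a ** T2 a r)"

lemma concat_family_across:
  assumes "transition_family \<Q> T1" "0 \<le> t" "t \<le> a" "a < r"
  shows "concat_family a T1 T2 t r = T1 t a ** T2 a r"
  using assms family_refl[OF assms(1), of a] by (cases "t = a") (auto simp: concat_family_def)

lemma concat_transition_family: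
  assumes T1: "transition_family \<Q> T1" and T2: "transition_family \<Q> T2" and a: "0 \<le> a"
  shows "transition_family \<Q> (concat_family a T1 T2)" (is "transition_family \<Q> ?T")
proof -
  have 1: "stochastic_matrix (?T t r)" if "0 \<le> t" "t \<le> r" for t r
    using that a family_stochastic[OF T1] family_stochastic[OF T2]
    by (auto simp: concat_family_def intro!: stochastic_matrix_mult)
  have 2: "?T t t = mat 1" if "0 \<le> t" for t
    using that family_refl[OF T1] family_refl[OF T2] by (simp add: concat_family_def)
  have 3: "?T t r ** ?T r q = ?T t q" if "0 \<le> t" "t \<le> r" "r \<le> q" for t r q
  proof -
    consider "q \<le> a" | "r \<le> a" "a < q" | "a < r" "t < a" | "a \<le> t" "a < r"
      by linarith
    then show ?thesis
    proof cases
      case 1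
      with that show ?thesis
        by (simp add: concat_family_def family_comp[OF T1])
    next
      case 2
      then have "?T r q = T1 r a ** T2 a q" "?T t q = T1 t a ** T2 a q"
        using that by (auto intro: concat_family_across[OF T1])
      with 2 that show ?thesis
        by (simp add: concat_family_def matrix_mul_assoc family_comp[OF T1])
    next
      case 3
      then have "?T t r = T1 t a ** T2 a r" "?T t q = T1 t a ** T2 a q"
        using that by (auto intro: concat_family_across[OF T1])
      moreover have "?T r q = T2 r q"
        using 3 that by (simp add: concat_family_def)
      ultimately show ?thesis
        using 3 that a by (simp add: family_comp[OF T2] flip: matrix_mul_assoc)
    next
      case 4
      with that a show ?thesis
        by (simp add: concat_family_def family_comp[OF T2])
    qed
  qed
  have near: "\<forall>\<^sub>F \<Delta> in at_right 0. 0 < \<Delta> \<and> \<Delta> < d" if "0 < d" for d :: real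
    using eventually_at_right_less[of 0] eventually_at_right[of 0 d "\<lambda>x. x < d"] that
    by (auto elim: eventually_elim2 intro: eventually_conj)
  have 4: "\<exists>Q\<in>\<Q>. ((\<lambda>\<Delta>. (1 / \<Delta>) *\<^sub>R (?T t (t + \<Delta>) - mat 1)) \<longlongrightarrow> Q) (at_right 0)" if "0 \<le> t" for t
  proof (cases "t < a")
    case True
    have "\<forall>\<^sub>F \<Delta> in at_right 0. (1 / \<Delta>) *\<^sub>R (?T t (t + \<Delta>) - mat 1) = (1 / \<Delta>) *\<^sub>R (T1 t (t + \<Delta>) - mat 1)"
      by (rule eventually_mono[OF near[of "a - t"]]) (use True in \<open>auto simp: concat_family_def\<close>)
    from tendsto_cong[OF this] show ?thesis
      using family_right[OF T1 that] by simp
  next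
    case False
    have "\<forall>\<^sub>F \<Delta> in at_right 0. (1 / \<Delta>) *\<^sub>R (?T t (t + \<Delta>) - mat 1) = (1 / \<Delta>) *\<^sub>R (T2 t (t + \<Delta>) - mat 1)"
      by (rule eventually_mono[OF near[of 1]]) (use False in \<open>auto simp: concat_family_def\<close>)
    from tendsto_cong[OF this] show ?thesis
      using family_right[OF T2 that] by simp
  qed
  have 5: "\<exists>Q\<in>\<Q>. ((\<lambda>\<Delta>. (1 / \<Delta>) *\<^sub>R (?T (t - \<Delta>) t - mat 1)) \<longlongrightarrow> Q) (at_right 0)" if "0 < t" for t
  proof (cases "t \<le> a")
    case True
    then have "?T (t - \<Delta>) t = T1 (t - \<Delta>) t" for \<Delta>
      by (simp add: concat_family_def)
    then show ?thesis
      using family_left[OF T1 that] by simp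
  next
    case False
    have "\<forall>\<^sub>F \<Delta> in at_right 0. (1 / \<Delta>) *\<^sub>R (?T (t - \<Delta>) t - mat 1) = (1 / \<Delta>) *\<^sub>R (T2 (t - \<Delta>) t - mat 1)"
      by (rule eventually_mono[OF near[of "t - a"]]) (use False in \<open>auto simp: concat_family_def\<close>)
    from tendsto_cong[OF this] show ?thesis
      using family_left[OF T2 that] by simp
  qed
  show ?thesis
    unfolding transition_family_def using 1 2 3 4 5 by blast
qed

section \<open>Exponentials of a single rate matrix\<close>

context rate_operator
begin

lemma linear_S:
  assumes "linear R" "0 \<le> t"
  shows "linear (S t)"
proof -
  have step: "linear (step h)" for h
    unfolding step_def by (intro linear_compose_add linear_ident linear_compose_scale_right assms)
  have pow: "linear (step h ^^ k)" for h k
  proof (induction k)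
    case (Suc k)
    show ?case
      unfolding funpow.simps by (rule linear_compose[OF Suc step])
  qed (simp add: id_def linear_ident)
  have euler: "linear (euler n t)" for n
    unfolding euler_def by (rule pow)
  show ?thesis
  proof (rule linearI)
    fix f g :: "real^'x" and c :: real
    have "(\<lambda>n. euler n t (f + g)) \<longlonglongrightarrow> S t f + S t g"
      unfolding linear_add[OF euler] by (intro tendsto_add euler_tendsto assms)
    then show "S t (f + g) = S t f + S t g"
      using euler_tendsto[OF assms(2)] LIMSEQ_unique by blast
    have "(\<lambda>n. euler n t (c *\<^sub>R f)) \<longlonglongrightarrow> c *\<^sub>R S t f"
      unfolding linear_scale[OF euler] by (intro tendsto_scaleR tendsto_const euler_tendsto assms)
    then show "S t (c *\<^sub>R f) = c *\<^sub>R S t f"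
      using euler_tendsto[OF assms(2)] LIMSEQ_unique by blast
  qed
qed

end

locale rate_matrix = rate_operator "(*v) Q" h0 for Q :: "real^'x::finite^'x" and h0
begin

text \<open>The exponential of \<open>t\<close> times \<open>Q\<close>: for linear \<open>R\<close>
  the Euler schemes are linear, hence so is their limit, which is therefore given by a
  matrix.\<close>

definition E :: "real \<Rightarrow> real^'x^'x" where "E t = matrix (S t)"

lemma E_mult: "0 \<le> t \<Longrightarrow> E t *v f = S t f"
  unfolding E_def
  by (intro matrix_works linear_matrix_vector_mul_eq[THEN iffD2] linear_S matrix_vector_mul_linear)

lemma E_entry: "0 \<le> t \<Longrightarrow> E t $ x $ y = S t (axis y 1) $ x"
  using E_mult[of t "axis y 1"] by (simp add: matrix_vector_mult_basis column_def vec_eq_iff)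

lemma E_stochastic:
  assumes "0 \<le> t"
  shows "stochastic_matrix (E t)"
  unfolding stochastic_matrix_def
proof (intro conjI allI)
  fix x y
  have "0 \<le> Min (range (($) (axis y 1 :: real^'x)))"
    by (subst Min_ge_iff) (auto simp: axis_def)
  also have "\<dots> \<le> S t (axis y 1) $ x"
    by (rule lto_ge_Min[OF lto_S[OF assms]])
  finally show "0 \<le> E t $ x $ y"
    by (simp add: E_entry assms)
next
  fix x
  \<comment> \<open>Row sums: the lower bounds for the constants 1 and -1, combined by linearity,
    leave only the value 1.\<close>
  have r: "range (($) (1 :: real^'x)) = {1}" "range (($) (- 1 :: real^'x)) = {-1}" by auto
  have "1 \<le> S t 1 $ x" "- 1 \<le> S t (- 1) $ x"
    using lto_ge_Min[OF lto_S[OF assms], of 1 x] lto_ge_Min[OF lto_S[OF assms], of "- 1" x]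
    by (simp_all add: r)
  moreover have "S t (- 1) = - S t 1"
    by (intro linear_neg linear_S assms) (simp add: matrix_vector_mul_linear)
  ultimately have "S t 1 $ x = 1" by simp
  then have "(E t *v 1) $ x = 1"
    by (simp add: E_mult assms)
  then show "(\<Sum>y\<in>UNIV. E t $ x $ y) = 1"
    by (simp add: mult_vec_nth)
qed

lemma E_deriv: "((\<lambda>\<Delta>. (1 / \<Delta>) *\<^sub>R (E \<Delta> - mat 1)) \<longlongrightarrow> Q) (at_right 0)"
proof (intro vec_tendstoI)
  fix x y
  have "\<bar>((1 / \<Delta>) *\<^sub>R (E \<Delta> - mat 1)) $ x $ y - Q $ x $ y\<bar> \<le> \<Delta> * M\<^sup>2" if "0 < \<Delta>" for \<Delta>
  proof -
    let ?f = "axis y 1 :: real^'x"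
    have "\<bar>(S \<Delta> ?f - ?f - \<Delta> *\<^sub>R (Q *v ?f)) $ x\<bar> \<le> (\<Delta> * M)\<^sup>2"
      using order_trans[OF component_le_infnorm_cart S_first_order, of \<Delta> ?f x] that
      by (simp add: infnorm_axis)
    moreover have "(S \<Delta> ?f - ?f - \<Delta> *\<^sub>R (Q *v ?f)) $ x
        = \<Delta> * (((1 / \<Delta>) *\<^sub>R (E \<Delta> - mat 1)) $ x $ y - Q $ x $ y)"
      using that by (simp add: E_entry matrix_vector_mult_basis column_def mat_def right_diff_distrib)
        (simp add: axis_def)
    ultimately have "\<Delta> * \<bar>((1 / \<Delta>) *\<^sub>R (E \<Delta> - mat 1)) $ x $ y - Q $ x $ y\<bar> \<le> \<Delta> * (\<Delta> * M\<^sup>2)"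
      using that by (simp only: abs_mult abs_of_pos) (simp add: power2_eq_square mult_ac)
    then show ?thesis
      using that by (simp only: mult_le_cancel_left_pos)
  qed
  then have "\<forall>\<^sub>F \<Delta> in at_right 0.
      norm (((1 / \<Delta>) *\<^sub>R (E \<Delta> - mat 1)) $ x $ y - Q $ x $ y) \<le> \<Delta> * M\<^sup>2"
    unfolding real_norm_def by (intro eventually_mono[OF eventually_at_right_less])
  moreover have "((\<lambda>\<Delta>. \<Delta> * M\<^sup>2) \<longlongrightarrow> 0 * M\<^sup>2) (at_right 0)"
    by (intro tendsto_intros)
  ultimately have "((\<lambda>\<Delta>. ((1 / \<Delta>) *\<^sub>R (E \<Delta> - mat 1)) $ x $ y - Q $ x $ y) \<longlongrightarrow> 0) (at_right 0)"
    unfolding mult_zero_left by (rule Lim_null_comparison)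
  then show "((\<lambda>\<Delta>. ((1 / \<Delta>) *\<^sub>R (E \<Delta> - mat 1)) $ x $ y) \<longlongrightarrow> Q $ x $ y) (at_right 0)"
    by (rule LIM_zero_cancel)
qed

lemma E_transition_family:
  assumes "Q \<in> \<Q>"
  shows "transition_family \<Q> (\<lambda>t r. E (r - t))"
proof -
  have "E (r - t) ** E (q - r) = E (q - t)" if "t \<le> r" "r \<le> q" for t r q
  proof -
    have "(E (r - t) ** E (q - r)) *v f = E (q - t) *v f" for f
      using S_add[of "r - t" "q - r" f] that
      by (simp add: E_mult flip: matrix_vector_mul_assoc)
    then show ?thesis
      by (simp add: matrix_eq)
  qed
  moreover have "E 0 = mat 1"
    using E_mult[of 0] by (simp add: matrix_eq)
  ultimately show ?thesis
    unfolding transition_family_def using E_stochastic E_deriv assms by auto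
qed

end

text \<open>Separately specified rows enter here: each state picks its own near minimiser, and the
  chosen rows form one matrix that still belongs to \<open>\<Q>\<close>. A positive tolerance is
  allowed because the infimum need not be attained.\<close>

lemma near_minimising_matrix:
  fixes \<Q> :: "(real^'x::finite^'x) set"
  assumes "\<Q> \<noteq> {}" "\<Q> \<subseteq> rate_matrices" "\<And>Q x y. Q \<in> \<Q> \<Longrightarrow> \<bar>Q $ x $ y\<bar> \<le> B"
    and sep: "separately_specified_rows \<Q>" and "\<epsilon> > 0"
  shows "\<exists>Q\<in>\<Q>. \<forall>x. (Q *v f) $ x \<le> lower_envelope \<Q> f $ x + \<epsilon>"
proof -
  have "\<exists>Q\<in>\<Q>. (Q *v f) $ x \<le> lower_envelope \<Q> f $ x + \<epsilon>" for x
  proof (rule ccontr)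
    assume "\<not> ?thesis"
    then have "lower_envelope \<Q> f $ x + \<epsilon> \<le> lower_envelope \<Q> f $ x"
      by (intro lower_envelope_ge[OF assms(1-3)]) auto
    with \<open>\<epsilon> > 0\<close> show False by simp
  qed
  then obtain q where q: "\<And>x. q x \<in> \<Q>" "\<And>x. (q x *v f) $ x \<le> lower_envelope \<Q> f $ x + \<epsilon>"
    by metis
  define Q where "Q = (\<chi> x. q x $ x)"
  have "Q \<in> rate_matrices"
    using subsetD[OF assms(2) q(1)] by (simp add: Q_def rate_matrices_def)
  then have "Q \<in> {Q \<in> rate_matrices. \<forall>x. Q $ x \<in> (\<lambda>Q'. Q' $ x) ` \<Q>}"
    using q(1) by (auto simp: Q_def)
  then have "Q \<in> \<Q>"
    using sep unfolding separately_specified_rows_def by blast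
  moreover have "(Q *v f) $ x \<le> lower_envelope \<Q> f $ x + \<epsilon>" for x
    using q(2)[of x] by (simp add: mult_vec_nth Q_def)
  ultimately show ?thesis by blast
qed

lemma rate_operator_single:
  assumes "Q \<in> rate_matrices" "\<And>x y. \<bar>Q $ x $ y\<bar> \<le> B" "h0 > 0" "h0 * B \<le> 1"
  shows "rate_operator ((*v) Q) h0"
proof -
  have "rate_operator (lower_envelope {Q}) h0"
    using assms by (intro lower_envelope_rate_operator[of _ B]) auto
  moreover have "lower_envelope {Q} = (*v) Q"
    by auto
  ultimately show ?thesis by simp
qed

text \<open>Backwards in time: on the last of \<open>n\<close> steps of length \<open>h\<close>, a matrix that nearly minimises
  \<open>Q *v f\<close> loses only \<open>O(h\<^sup>2)\<close> against the lower transition operator.\<close>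

lemma approximating_family_steps:
  fixes \<Q> :: "(real^'x::finite^'x) set" and f :: "real^'x" and n :: nat and h h0 K B e :: real
  assumes \<Q>: "\<Q> \<noteq> {}" "\<Q> \<subseteq> rate_matrices" "\<And>Q x y. Q \<in> \<Q> \<Longrightarrow> \<bar>Q $ x $ y\<bar> \<le> B"
    and sep: "separately_specified_rows \<Q>" and h0: "h0 > 0" "h0 * B \<le> 1"
    and h: "h > 0" and K: "infnorm f \<le> K"
  defines "R \<equiv> lower_envelope \<Q>"
  defines "e \<equiv> 2 * (h * (2 / h0))\<^sup>2 * K + h\<^sup>2"
  shows "\<exists>T. transition_family \<Q> T \<and>
    (\<forall>x. (T 0 (n * h) *v f) $ x \<le> rate_operator.S R h0 (n * h) f $ x + n * e)"
  using K
proof (induction n arbitrary: f)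
  case 0
  interpret R: rate_operator R h0
    unfolding R_def by (rule lower_envelope_rate_operator[OF \<Q> h0])
  obtain Q where Q: "Q \<in> \<Q>" using \<Q>(1) by blast
  interpret Q: rate_matrix Q h0
    unfolding rate_matrix_def by (rule rate_operator_single[OF subsetD[OF \<Q>(2) Q] \<Q>(3)[OF Q] h0])
  show ?case
    using Q.E_transition_family[OF Q] by (intro exI[of _ "\<lambda>t r. Q.E (r - t)"]) (simp add: Q.E_mult)
next
  case (Suc n)
  interpret R: rate_operator R h0
    unfolding R_def by (rule lower_envelope_rate_operator[OF \<Q> h0])
  obtain Q where Q: "Q \<in> \<Q>" and Qf: "\<And>x. (Q *v f) $ x \<le> R f $ x + h"
    using near_minimising_matrix[OF \<Q> sep h, of f] unfolding R_def by auto
  interpret Q: rate_matrix Q h0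
    unfolding rate_matrix_def by (rule rate_operator_single[OF subsetD[OF \<Q>(2) Q] \<Q>(3)[OF Q] h0])
  have MM: "R.M = 2 / h0" "Q.M = 2 / h0"
    by (simp_all add: R.M_def Q.M_def)
  \<comment> \<open>The final interval is settled first: \<open>g\<close> is what remains of
    \<open>f\<close> after running \<open>Q\<close> for time \<open>h\<close>. The induction
    hypothesis is applied to \<open>g\<close>, whose norm is still at most \<open>K\<close>; hence
    \<open>f\<close> varies in the induction while \<open>K\<close> is fixed.\<close>
  define g where "g = Q.S h f"
  have "infnorm g \<le> infnorm f"
    unfolding g_def using h by (intro lto_infnorm_le Q.lto_S) simp
  with Suc.prems have "infnorm g \<le> K" by simp
  from Suc.IH[OF this] obtain T1 where T1: "transition_family \<Q> T1"
    and le1: "\<And>x. (T1 0 (n * h) *v g) $ x \<le> R.S (n * h) g $ x + n * e"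
    by auto
  \<comment> \<open>The error \<open>e\<close> consists of the second-order remainders of the two
    semigroups, which share the constant \<open>2 / h0\<close>, and of \<open>h\<close> times the
    tolerance \<open>h\<close> with which \<open>Q\<close> was chosen.\<close>
  have g_le: "g $ x \<le> R.S h f $ x + e" for x
  proof -
    have K2: "(h * (2 / h0))\<^sup>2 * infnorm f \<le> (h * (2 / h0))\<^sup>2 * K"
      using Suc.prems by (intro mult_left_mono) auto
    have "infnorm (R.S h f - f - h *\<^sub>R R f) \<le> (h * (2 / h0))\<^sup>2 * K"
      using order_trans[OF R.S_first_order, of h f] h K2 unfolding MM by simp
    from order_trans[OF component_le_infnorm_cart this, of x]
    have "R.S h f $ x \<ge> f $ x + h * R f $ x - (h * (2 / h0))\<^sup>2 * K"
      by (simp add: abs_le_iff)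
    moreover have "infnorm (g - f - h *\<^sub>R (Q *v f)) \<le> (h * (2 / h0))\<^sup>2 * K"
      unfolding g_def using order_trans[OF Q.S_first_order, of h f] h K2 unfolding MM by simp
    from order_trans[OF component_le_infnorm_cart this, of x]
    have "g $ x \<le> f $ x + h * (Q *v f) $ x + (h * (2 / h0))\<^sup>2 * K"
      by (simp add: abs_le_iff)
    moreover have "h * (Q *v f) $ x \<le> h * R f $ x + h\<^sup>2"
      using mult_left_mono[OF Qf[of x], of h] h by (simp add: algebra_simps power2_eq_square)
    ultimately show ?thesis
      unfolding e_def by (simp add: mult.assoc)
  qed
  let ?T = "concat_family (n * h) T1 (\<lambda>t r. Q.E (r - t))"
  have "transition_family \<Q> ?T"
    using T1 Q.E_transition_family[OF Q] h by (intro concat_transition_family) auto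
  moreover have "(?T 0 (Suc n * h) *v f) $ x \<le> R.S (Suc n * h) f $ x + Suc n * e" for x
  proof -
    have "?T 0 (Suc n * h) = T1 0 (n * h) ** Q.E h"
      using h by (subst concat_family_across[OF T1]) (auto simp: algebra_simps)
    then have "(?T 0 (Suc n * h) *v f) $ x = (T1 0 (n * h) *v g) $ x"
      using h by (simp add: g_def Q.E_mult flip: matrix_vector_mul_assoc)
    also have "\<dots> \<le> R.S (n * h) g $ x + n * e"
      by (rule le1)
    also have "R.S (n * h) g $ x \<le> R.S (n * h) (R.S h f + e *\<^sub>R 1) $ x"
      using h g_le by (intro lto_mono[OF R.lto_S]) auto
    also have "\<dots> \<le> R.S (n * h) (R.S h f) $ x + e"
      using h by (intro lto_add_const[OF R.lto_S]) auto
    also have "R.S (n * h) (R.S h f) = R.S (Suc n * h) f"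
      using R.S_add[of "n * h" h f] h by (simp add: algebra_simps)
    finally show ?thesis by (simp add: algebra_simps)
  qed
  ultimately show ?case by blast
qed

lemma approximating_family:
  fixes \<Q> :: "(real^'x::finite^'x) set" and f :: "real^'x"
  assumes \<Q>: "\<Q> \<noteq> {}" "\<Q> \<subseteq> rate_matrices" "\<And>Q x y. Q \<in> \<Q> \<Longrightarrow> \<bar>Q $ x $ y\<bar> \<le> B"
    and sep: "separately_specified_rows \<Q>" and h0: "h0 > 0" "h0 * B \<le> 1"
    and s: "0 \<le> s" and \<epsilon>: "\<epsilon> > 0"
  obtains T where "transition_family \<Q> T"
    "\<And>x. (T 0 s *v f) $ x \<le> rate_operator.S (lower_envelope \<Q>) h0 s f $ x + \<epsilon>"
proof (cases "s = 0")
  case True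
  obtain T where T: "transition_family \<Q> T \<and>
    (\<forall>x. (T 0 (real 0 * 1) *v f) $ x \<le> rate_operator.S (lower_envelope \<Q>) h0 (real 0 * 1) f $ x
      + real 0 * (2 * (1 * (2 / h0))\<^sup>2 * infnorm f + 1\<^sup>2))"
    using approximating_family_steps[OF \<Q> sep h0 zero_less_one order_refl] by (rule exE)
  have "(T 0 s *v f) $ x \<le> rate_operator.S (lower_envelope \<Q>) h0 s f $ x + \<epsilon>" for x
    using spec[OF conjunct2[OF T], of x] \<epsilon> unfolding True by simp
  then show ?thesis
    by (rule that[OF conjunct1[OF T]])
next
  case False
  \<comment> \<open>With \<open>n\<close> steps of length \<open>s / n\<close> the accumulated error
    \<open>n * e\<close> equals \<open>C / n\<close>.\<close>
  define C where "C = s\<^sup>2 * (2 * (2 / h0)\<^sup>2 * infnorm f + 1)"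
  obtain n :: nat where n: "C / \<epsilon> \<le> n" using real_arch_simple by blast
  have "C > 0"
    using False by (auto simp: C_def infnorm_pos_le intro!: mult_pos_pos add_nonneg_pos)
  then have "0 < C / \<epsilon>" using \<epsilon> by simp
  with n have n0: "0 < n" by (cases n) auto
  define h where "h = s / n"
  have h: "h > 0" and nh: "n * h = s"
    using n0 s False by (simp_all add: h_def)
  have "n * (2 * (s / n * c)\<^sup>2 * F + (s / n)\<^sup>2) = s\<^sup>2 * (2 * c\<^sup>2 * F + 1) / n" for c F
    using n0 by (simp add: power2_eq_square field_simps)
  then have "n * (2 * (h * (2 / h0))\<^sup>2 * infnorm f + h\<^sup>2) = C / n"
    unfolding C_def h_def .
  also have "\<dots> \<le> \<epsilon>"
    using n n0 \<epsilon> by (simp add: field_simps)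
  finally have err: "n * (2 * (h * (2 / h0))\<^sup>2 * infnorm f + h\<^sup>2) \<le> \<epsilon>" .
  obtain T where T: "transition_family \<Q> T \<and>
    (\<forall>x. (T 0 s *v f) $ x \<le> rate_operator.S (lower_envelope \<Q>) h0 s f $ x
      + n * (2 * (h * (2 / h0))\<^sup>2 * infnorm f + h\<^sup>2))"
    using approximating_family_steps[OF \<Q> sep h0 h order_refl, where n = n and f = f] unfolding nh by (rule exE)
  have "(T 0 s *v f) $ x \<le> rate_operator.S (lower_envelope \<Q>) h0 s f $ x + \<epsilon>" for x
    using spec[OF conjunct2[OF T], of x] err by linarith
  then show ?thesis
    by (rule that[OF conjunct1[OF T]])
qed

section \<open>Consequences of coherence\<close>

text \<open>A gain depends on \<open>\<omega>\<close> only through the set of indices whose events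
  contain it; so \<open>Max\<close> ranges over a finite set.\<close>

lemma finite_gains:
  assumes "finite J"
  shows "finite ((\<lambda>\<omega>. \<Sum>j\<in>J. c j * indicator (C j) \<omega> * (p j - indicator (A j) \<omega>) :: real) ` X)"
proof (rule finite_subset)
  let ?g = "\<lambda>(a, b). \<Sum>j\<in>J. c j * indicator a j * (p j - indicator b j) :: real"
  show "(\<lambda>\<omega>. \<Sum>j\<in>J. c j * indicator (C j) \<omega> * (p j - indicator (A j) \<omega>)) ` X \<subseteq> ?g ` (Pow J \<times> Pow J)"
  proof (rule image_subsetI)
    fix \<omega>
    show "(\<Sum>j\<in>J. c j * indicator (C j) \<omega> * (p j - indicator (A j) \<omega>)) \<in> ?g ` (Pow J \<times> Pow J)"
      by (rule image_eqI[of _ _ "({j\<in>J. \<omega> \<in> C j}, {j\<in>J. \<omega> \<in> A j})"])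
        (auto intro!: sum.cong simp: indicator_def)
  qed
qed (use assms in auto)

lemma path_space_extend:
  assumes "path_space \<Omega>" "finite v" "v \<subseteq> {0..}"
  obtains \<omega> where "\<omega> \<in> \<Omega>" "\<And>r. r \<in> v \<Longrightarrow> \<omega> r = w r"
proof -
  \<comment> \<open>\<open>path_space\<close> speaks of non-empty time sets only; inserting 0 admits
    empty \<open>v\<close>.\<close>
  let ?v = "insert 0 v"
  have "?v \<in> time_sets" "restrict w ?v \<in> ?v \<rightarrow>\<^sub>E UNIV"
    using assms by (auto simp: time_sets_def)
  then obtain \<omega> where \<omega>: "\<omega> \<in> \<Omega>" "restrict \<omega> ?v = restrict w ?v"
    using assms(1) unfolding path_space_def by blast
  have "\<omega> r = w r" if "r \<in> v" for r
    using fun_cong[OF \<omega>(2), of r] that by simp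
  with \<omega>(1) show ?thesis by (rule that)
qed

lemma evs_nonempty: "\<lbrakk>path_space \<Omega>; u \<in> time_sets\<rbrakk> \<Longrightarrow> evs \<Omega> u xu \<noteq> {}"
  by (rule path_space_extend[of \<Omega> u xu]) (auto simp: evs_def time_sets_def)

lemma C_SP_nonempty: "\<lbrakk>path_space \<Omega>; (A, C) \<in> C_SP \<Omega>\<rbrakk> \<Longrightarrow> C \<noteq> {}"
  using evs_nonempty by (auto simp: C_SP_def)

lemma C_SP_cond_subset: "(A, C) \<in> C_SP \<Omega> \<Longrightarrow> C \<subseteq> \<Omega>"
  by (auto simp: C_SP_def evs_def)

text \<open>Arbitrary finite index sets let bets of different kinds be indexed by a sum type, and
  the attained maximum yields an actual path.\<close>

lemma coherentD:
  assumes coh: "coherent \<Omega> P" and \<Omega>: "path_space \<Omega>" and J: "finite J" "J \<noteq> {}"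
    and C_SP: "\<And>j. j \<in> J \<Longrightarrow> (A j, C j) \<in> C_SP \<Omega>"
  shows "\<exists>\<omega>\<in>(\<Union>j\<in>J. C j).
    (\<Sum>j\<in>J. c j * indicator (C j) \<omega> * (P (A j, C j) - indicator (A j) \<omega>)) \<ge> 0"
proof -
  obtain h where h: "bij_betw h {1..card J} J"
    using ex_bij_betw_nat_finite_1[OF J(1)] by blast
  let ?g = "\<lambda>\<omega>. \<Sum>i=1..card J. c (h i) * indicator (C (h i)) \<omega> *
    (P (A (h i), C (h i)) - indicator (A (h i)) \<omega>)"
  have g: "?g \<omega> = (\<Sum>j\<in>J. c j * indicator (C j) \<omega> * (P (A j, C j) - indicator (A j) \<omega>))" for \<omega>
    by (rule sum.reindex_bij_betw[OF h])
  have im: "h ` {1..card J} = J"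
    using h by (simp add: bij_betw_def)
  have card: "1 \<le> card J"
    using J by (simp add: Suc_le_eq card_gt_0_iff)
  have mem: "\<forall>i\<in>{1..card J}. (A (h i), C (h i)) \<in> C_SP \<Omega>"
    using im C_SP by blast
  have max: "Max (?g ` (\<Union>i\<in>{1..card J}. C (h i))) \<ge> 0"
    by (rule coh[unfolded coherent_def, THEN spec, THEN mp, OF card, THEN spec, THEN spec, THEN spec,
          THEN mp, OF mem])
  have U: "(\<Union>i\<in>{1..card J}. C (h i)) = (\<Union>j\<in>J. C j)"
    using arg_cong[OF im, of "\<lambda>S. \<Union> (C ` S)"] by (simp only: image_image)
  have "(\<Union>j\<in>J. C j) \<noteq> {}"
    using J(2) C_SP C_SP_nonempty[OF \<Omega>] by blast
  then have "Max (?g ` (\<Union>j\<in>J. C j)) \<in> ?g ` (\<Union>j\<in>J. C j)"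
    by (intro Max_in finite_gains) auto
  then obtain \<omega> where \<omega>: "Max (?g ` (\<Union>j\<in>J. C j)) = ?g \<omega>" "\<omega> \<in> (\<Union>j\<in>J. C j)"
    by (rule imageE)
  have "?g \<omega> \<ge> 0"
    using max unfolding U \<omega>(1) .
  then show ?thesis
    unfolding g using \<omega>(2) by (rule bexI)
qed

text \<open>Coherence gives \<open>k \<ge> 0\<close>, and the same bets with reversed stakes give
  \<open>- k \<ge> 0\<close>. Linear identities between probabilities follow by choosing stakes for
  which all indicators cancel.\<close>

lemma coherent_constant:
  assumes coh: "coherent \<Omega> P" and \<Omega>: "path_space \<Omega>" and J: "finite J" "J \<noteq> {}"
    and C_SP: "\<And>j. j \<in> J \<Longrightarrow> (A j, C j) \<in> C_SP \<Omega>"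
    and k: "\<And>\<omega>. \<omega> \<in> (\<Union>j\<in>J. C j) \<Longrightarrow>
      (\<Sum>j\<in>J. c j * indicator (C j) \<omega> * (P (A j, C j) - indicator (A j) \<omega>)) = k"
  shows "k = 0"
proof (rule antisym)
  obtain \<omega> where \<omega>: "\<omega> \<in> (\<Union>j\<in>J. C j)"
    "(\<Sum>j\<in>J. c j * indicator (C j) \<omega> * (P (A j, C j) - indicator (A j) \<omega>)) \<ge> 0"
    using coherentD[OF coh \<Omega> J C_SP, where c = c] by (rule bexE)
  from \<omega>(2) show "0 \<le> k"
    unfolding k[OF \<omega>(1)] .
  obtain \<omega> where \<omega>: "\<omega> \<in> (\<Union>j\<in>J. C j)"
    "(\<Sum>j\<in>J. (- c j) * indicator (C j) \<omega> * (P (A j, C j) - indicator (A j) \<omega>)) \<ge> 0"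
    using coherentD[OF coh \<Omega> J C_SP, where c = "\<lambda>j. - c j"] by (rule bexE)
  have "(\<Sum>j\<in>J. (- c j) * indicator (C j) \<omega> * (P (A j, C j) - indicator (A j) \<omega>)) = - k"
    unfolding mult_minus_left sum_negf using k[OF \<omega>(1)] by simp
  with \<omega>(2) show "k \<le> 0" by linarith
qed

lemma ev_in_event_algebra:
  "\<lbrakk>0 \<le> t; t \<in> u \<or> (\<forall>r\<in>u. r < t)\<rbrakk> \<Longrightarrow> ev \<Omega> t x \<in> event_algebra \<Omega> u"
  unfolding event_algebra_def by (rule hull_inc) blast

lemma C_SP_I: "\<lbrakk>u \<in> time_sets; A \<in> event_algebra \<Omega> u\<rbrakk> \<Longrightarrow> (A, evs \<Omega> u xu) \<in> C_SP \<Omega>"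
proof -
  assume "u \<in> time_sets" "A \<in> event_algebra \<Omega> u"
  moreover have "evs \<Omega> u xu = evs \<Omega> u (restrict xu u)"
    by (simp add: evs_def)
  moreover have "restrict xu u \<in> u \<rightarrow>\<^sub>E UNIV"
    by simp
  ultimately show ?thesis
    unfolding C_SP_def by blast
qed

lemma evs_empty [simp]: "evs \<Omega> {} xu = \<Omega>"
  by (simp add: evs_def)

lemma C_SP_unconditional: "0 \<le> t \<Longrightarrow> (ev \<Omega> t x, \<Omega>) \<in> C_SP \<Omega>"
  using C_SP_I[of "{}" "ev \<Omega> t x" \<Omega> "\<lambda>_. undefined"] ev_in_event_algebra[of t "{}" \<Omega> x]
  by (simp add: time_sets_def)

lemma C_SP_transition: "\<lbrakk>0 \<le> t; t \<le> s\<rbrakk> \<Longrightarrow> (ev \<Omega> s y, ev \<Omega> t x) \<in> C_SP \<Omega>"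
  using C_SP_I[of "{t}" "ev \<Omega> s y" \<Omega> "\<lambda>_. x"] ev_in_event_algebra[of s "{t}" \<Omega> y]
  by (force simp: time_sets_def evs_def ev_def)

lemma sum_UNIV_sum_type:
  fixes g :: "'a::finite + 'b::finite \<Rightarrow> real"
  shows "sum g UNIV = (\<Sum>a\<in>UNIV. g (Inl a)) + (\<Sum>b\<in>UNIV. g (Inr b))"
  unfolding UNIV_Plus_UNIV[symmetric] by (simp only: sum.Plus[OF finite finite] comp_def)

context
  fixes \<Omega> :: "(real \<Rightarrow> 'x::finite) set" and P
  assumes \<Omega>: "path_space \<Omega>" and coh: "coherent \<Omega> P"
begin

lemma coherent_nonneg:
  assumes "(A, C) \<in> C_SP \<Omega>"
  shows "P (A, C) \<ge> 0"
proof -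
  obtain \<omega> where \<omega>: "\<omega> \<in> C" "indicator C \<omega> * (P (A, C) - indicator A \<omega>) \<ge> 0"
    using coherentD[OF coh \<Omega>, of "{()}" "\<lambda>_. A" "\<lambda>_. C" "\<lambda>_. 1"] assms by auto
  have "P (A, C) \<ge> indicator A \<omega>"
    using \<omega> by simp
  also have "indicator A \<omega> \<ge> (0::real)" by simp
  finally show ?thesis .
qed

lemma coherent_sum:
  assumes "\<And>y. (ev \<Omega> s y, C) \<in> C_SP \<Omega>"
  shows "(\<Sum>y\<in>UNIV. P (ev \<Omega> s y, C)) = 1"
proof -
  have "(\<Sum>y\<in>UNIV. P (ev \<Omega> s y, C)) - 1 = 0"
  proof (rule coherent_constant[OF coh \<Omega>, of UNIV "\<lambda>y. ev \<Omega> s y" "\<lambda>_. C" "\<lambda>_. 1"])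
    fix \<omega> assume "\<omega> \<in> (\<Union>j\<in>(UNIV::'x set). C)"
    then have \<omega>: "\<omega> \<in> C" "\<omega> \<in> \<Omega>"
      using C_SP_cond_subset[OF assms] by auto
    have "(\<Sum>y\<in>UNIV. indicator (ev \<Omega> s y) \<omega>) = (\<Sum>y\<in>UNIV. if \<omega> s = y then 1 else (0::real))"
      by (rule sum.cong) (auto simp: ev_def indicator_def \<omega>)
    then show "(\<Sum>y\<in>UNIV. 1 * indicator C \<omega> * (P (ev \<Omega> s y, C) - indicator (ev \<Omega> s y) \<omega>))
        = (\<Sum>y\<in>UNIV. P (ev \<Omega> s y, C)) - 1"
      using \<omega> by (simp add: sum_subtractf)
  qed (use assms in auto)
  then show ?thesis by simp
qed

lemma coherent_total_probability:
  assumes "0 \<le> t" "t \<le> s"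
  shows "P (ev \<Omega> s y, \<Omega>) = (\<Sum>x\<in>UNIV. P (ev \<Omega> t x, \<Omega>) * P (ev \<Omega> s y, ev \<Omega> t x))"
proof -
  let ?T = "\<lambda>x. P (ev \<Omega> s y, ev \<Omega> t x)"
  \<comment> \<open>Three groups of bets: on \<open>X_s = y\<close> with stake 1, on
    \<open>X_s = y\<close> given each \<open>X_t = x\<close> with stake -1, and on each
    \<open>X_t = x\<close> with stake \<open>- ?T x\<close>. The indicator of \<open>X_s = y\<close>
    cancels between the first two, and \<open>?T (\<omega> t)\<close> between the last two.\<close>
  define A :: "unit + 'x + 'x \<Rightarrow> _" where "A = case_sum (\<lambda>_::unit. ev \<Omega> s y) (case_sum (\<lambda>_. ev \<Omega> s y) (ev \<Omega> t))"
  define C :: "unit + 'x + 'x \<Rightarrow> _" where "C = case_sum (\<lambda>_::unit. \<Omega>) (case_sum (ev \<Omega> t) (\<lambda>_. \<Omega>))"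
  define c :: "unit + 'x + 'x \<Rightarrow> _" where "c = case_sum (\<lambda>_::unit. 1) (case_sum (\<lambda>_. - 1) (\<lambda>x. - ?T x))"
  have "P (ev \<Omega> s y, \<Omega>) - (\<Sum>x\<in>UNIV. P (ev \<Omega> t x, \<Omega>) * ?T x) = 0"
  proof (rule coherent_constant[OF coh \<Omega>, of UNIV A C c])
    show csp: "(A j, C j) \<in> C_SP \<Omega>" for j
      using assms by (auto simp: A_def C_def C_SP_unconditional C_SP_transition split: sum.split)
    fix \<omega> assume "\<omega> \<in> (\<Union>j\<in>UNIV. C j)"
    then have \<omega>: "\<omega> \<in> \<Omega>"
      using C_SP_cond_subset[OF csp] by blast
    have i: "indicator (ev \<Omega> t x) \<omega> = (if \<omega> t = x then 1 else (0::real))" for x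
      using \<omega> by (auto simp: ev_def)
    have "(\<Sum>j\<in>UNIV. c j * indicator (C j) \<omega> * (P (A j, C j) - indicator (A j) \<omega>))
        = (P (ev \<Omega> s y, \<Omega>) - indicator (ev \<Omega> s y) \<omega>)
        + ((\<Sum>x\<in>UNIV. - indicator (ev \<Omega> t x) \<omega> * (?T x - indicator (ev \<Omega> s y) \<omega>))
          + (\<Sum>x\<in>UNIV. - ?T x * (P (ev \<Omega> t x, \<Omega>) - indicator (ev \<Omega> t x) \<omega>)))"
      by (simp add: sum_UNIV_sum_type UNIV_unit A_def C_def c_def \<omega>)
    also have "(\<Sum>x\<in>UNIV. - indicator (ev \<Omega> t x) \<omega> * (?T x - indicator (ev \<Omega> s y) \<omega>))
        = (\<Sum>x\<in>UNIV. if \<omega> t = x then indicator (ev \<Omega> s y) \<omega> - ?T x else 0)"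
      unfolding i by (rule sum.cong) auto
    also have "\<dots> = indicator (ev \<Omega> s y) \<omega> - ?T (\<omega> t)"
      by simp
    also have "(\<Sum>x\<in>UNIV. - ?T x * (P (ev \<Omega> t x, \<Omega>) - indicator (ev \<Omega> t x) \<omega>))
        = (\<Sum>x\<in>UNIV. if \<omega> t = x then ?T x else 0) - (\<Sum>x\<in>UNIV. P (ev \<Omega> t x, \<Omega>) * ?T x)"
      unfolding i sum_subtractf[symmetric] by (rule sum.cong) (auto simp: algebra_simps)
    also have "(\<Sum>x\<in>UNIV. if \<omega> t = x then ?T x else 0) = ?T (\<omega> t)"
      by simp
    finally show "(\<Sum>j\<in>UNIV. c j * indicator (C j) \<omega> * (P (A j, C j) - indicator (A j) \<omega>))
        = P (ev \<Omega> s y, \<Omega>) - (\<Sum>x\<in>UNIV. P (ev \<Omega> t x, \<Omega>) * ?T x)"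
      by simp
  qed auto
  then show ?thesis by simp
qed

end


section \<open>The lower bound\<close>

lemma bounded_vec_of_entries:
  fixes A :: "real^'x::finite^'x"
  assumes "\<And>x y. \<bar>A $ x $ y\<bar> \<le> B"
  shows "norm A \<le> real CARD('x) * (real CARD('x) * B)"
proof -
  have row: "norm (A $ x) \<le> real CARD('x) * B" for x
  proof -
    have "norm (A $ x) \<le> (\<Sum>y\<in>UNIV. \<bar>A $ x $ y\<bar>)"
      by (rule norm_le_l1_cart)
    also have "\<dots> \<le> (\<Sum>y\<in>(UNIV::'x set). B)"
      by (rule sum_mono) (rule assms)
    finally show ?thesis by simp
  qed
  have "norm A \<le> (\<Sum>x\<in>UNIV. norm (A $ x))"
    unfolding norm_vec_def by (rule L2_set_le_sum) simp
  also have "\<dots> \<le> (\<Sum>x\<in>(UNIV::'x set). real CARD('x) * B)"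
    by (rule sum_mono) (rule row)
  finally show ?thesis by simp
qed

text \<open>\<open>outer_derivative\<close> collects only those limits that are rate matrices.
  Limits of quotients of stochastic matrices always are, so no accumulation point escapes the
  consistency condition.\<close>

lemma rate_matrix_limit:
  fixes T :: "nat \<Rightarrow> real^'x::finite^'x"
  assumes lim: "(\<lambda>i. (1 / \<Delta> i) *\<^sub>R (T i - mat 1)) \<longlonglongrightarrow> Q"
    and pos: "\<And>i. \<Delta> i > 0" and st: "\<And>i. stochastic_matrix (T i)"
  shows "Q \<in> rate_matrices"
proof -
  have entry: "(\<lambda>i. (T i $ x $ y - mat 1 $ x $ y) / \<Delta> i) \<longlonglongrightarrow> Q $ x $ y" for x y
    using tendsto_vec_nth[OF tendsto_vec_nth[OF lim, of x], of y] by simp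
  have "(\<Sum>y\<in>UNIV. Q $ x $ y) = 0" for x
  proof (rule LIMSEQ_unique)
    show "(\<lambda>i. \<Sum>y\<in>UNIV. (T i $ x $ y - mat 1 $ x $ y) / \<Delta> i) \<longlonglongrightarrow> (\<Sum>y\<in>UNIV. Q $ x $ y)"
      by (rule tendsto_sum) (rule entry)
    have "(\<Sum>y\<in>UNIV. (T i $ x $ y - mat 1 $ x $ y) / \<Delta> i) = 0" for i
      using st[of i] by (simp add: stochastic_matrix_def mat_def sum_subtractf flip: sum_divide_distrib)
    then show "(\<lambda>i. \<Sum>y\<in>UNIV. (T i $ x $ y - mat 1 $ x $ y) / \<Delta> i) \<longlonglongrightarrow> 0"
      by simp
  qed
  moreover have "Q $ x $ y \<ge> 0" if "x \<noteq> y" for x y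
  proof (rule LIMSEQ_le_const[OF entry], rule exI, intro allI impI)
    fix i
    show "0 \<le> (T i $ x $ y - mat 1 $ x $ y) / \<Delta> i"
      using st[of i] pos[of i] that by (simp add: stochastic_matrix_def mat_def)
  qed
  ultimately show ?thesis
    by (simp add: rate_matrices_def)
qed

lemma eventually_at_right_0I:
  assumes "(d::real) > 0" "\<And>\<Delta>. 0 < \<Delta> \<Longrightarrow> \<Delta> < d \<Longrightarrow> P \<Delta>"
  shows "eventually P (at_right 0)"
  unfolding eventually_at_right_field using assms by (intro exI[of _ d]) auto

text \<open>By compactness, without any derivative: if the inequality failed for arbitrarily small
  increments, the bounded quotients along such increments would have a convergent subsequence. Its
  limit \<open>Q\<close> lies in \<open>\<Q>\<close>, so \<open>Q *v g\<close> is above the envelope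
  in every coordinate, and the inequality holds along the subsequence after all.\<close>

lemma difference_quotient_lower_bound:
  fixes \<Q> :: "(real^'x::finite^'x) set" and T :: "real \<Rightarrow> real^'x^'x"
  assumes \<Q>: "\<Q> \<noteq> {}" "\<Q> \<subseteq> rate_matrices" "\<And>Q x y. Q \<in> \<Q> \<Longrightarrow> \<bar>Q $ x $ y\<bar> \<le> B"
    and st: "\<forall>\<^sub>F \<Delta> in at_right 0. stochastic_matrix (T \<Delta>)"
    and bd: "\<forall>\<^sub>F \<Delta> in at_right 0. \<forall>x y. \<bar>((1 / \<Delta>) *\<^sub>R (T \<Delta> - mat 1)) $ x $ y\<bar> \<le> b"
    and lim: "\<And>Q \<Delta>. \<lbrakk>Q \<in> rate_matrices; filterlim \<Delta> (at_right 0) sequentially;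
      (\<lambda>i. (1 / \<Delta> i) *\<^sub>R (T (\<Delta> i) - mat 1)) \<longlonglongrightarrow> Q\<rbrakk> \<Longrightarrow> Q \<in> \<Q>"
    and \<epsilon>: "\<epsilon> > 0"
  shows "\<forall>\<^sub>F \<Delta> in at_right 0. \<forall>x.
    (((1 / \<Delta>) *\<^sub>R (T \<Delta> - mat 1)) *v g) $ x \<ge> lower_envelope \<Q> g $ x - \<epsilon>"
proof (rule ccontr)
  let ?D = "\<lambda>\<Delta>. (1 / \<Delta>) *\<^sub>R (T \<Delta> - mat 1)"
  let ?good = "\<lambda>\<Delta>. \<forall>x. (?D \<Delta> *v g) $ x \<ge> lower_envelope \<Q> g $ x - \<epsilon>"
  assume not: "\<not> (\<forall>\<^sub>F \<Delta> in at_right 0. ?good \<Delta>)"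
  have "\<exists>\<Delta>>0. \<Delta> < 1 / Suc n \<and> \<not> ?good \<Delta> \<and> stochastic_matrix (T \<Delta>) \<and>
      (\<forall>x y. \<bar>?D \<Delta> $ x $ y\<bar> \<le> b)" for n :: nat
  proof (rule ccontr)
    assume no: "\<not> ?thesis"
    have "\<forall>\<^sub>F \<Delta> in at_right 0. 0 < \<Delta> \<and> \<Delta> < 1 / Suc n"
      by (rule eventually_at_right_0I[of "1 / Suc n"]) auto
    with st bd have "\<forall>\<^sub>F \<Delta> in at_right 0. ?good \<Delta>"
    proof eventually_elim
      case (elim \<Delta>)
      show ?case
        using no elim by blast
    qed
    with not show False by simp
  qed
  then have "\<exists>\<Delta>. \<forall>n. 0 < \<Delta> n \<and> \<Delta> n < 1 / Suc n \<and> \<not> ?good (\<Delta> n) \<and> stochastic_matrix (T (\<Delta> n)) \<and>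
      (\<forall>x y. \<bar>?D (\<Delta> n) $ x $ y\<bar> \<le> b)"
    by (intro choice allI)
  then obtain \<Delta> where \<Delta>: "\<And>n. 0 < \<Delta> n" "\<And>n::nat. \<Delta> n < 1 / Suc n" "\<And>n. \<not> ?good (\<Delta> n)"
    "\<And>n. stochastic_matrix (T (\<Delta> n))" "\<And>n x y. \<bar>?D (\<Delta> n) $ x $ y\<bar> \<le> b"
    by blast
  have lim0: "\<Delta> \<longlonglongrightarrow> 0"
  proof (rule tendsto_sandwich)
    show "\<forall>\<^sub>F n in sequentially. 0 \<le> \<Delta> n"
      using \<Delta>(1) by (simp add: less_imp_le)
    show "\<forall>\<^sub>F n in sequentially. \<Delta> n \<le> 1 / Suc n"
      using \<Delta>(2) by (simp add: less_imp_le)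
    show "(\<lambda>n. 1 / real (Suc n)) \<longlonglongrightarrow> 0"
      by (rule LIMSEQ_Suc[OF lim_1_over_n])
  qed (rule tendsto_const)
  have "norm (?D (\<Delta> n)) \<le> real CARD('x) * (real CARD('x) * b)" for n
    by (rule bounded_vec_of_entries) (rule \<Delta>(5))
  then have "\<forall>n. ?D (\<Delta> n) \<in> cball 0 (real CARD('x) * (real CARD('x) * b))"
    by simp
  from compact_imp_seq_compact[OF compact_cball, unfolded seq_compact_def, THEN spec, THEN mp, OF this]
  obtain Q r where r: "strict_mono r" and Q: "((\<lambda>n. ?D (\<Delta> n)) \<circ> r) \<longlonglongrightarrow> Q"
    by (elim bexE exE conjE)
  have Q': "(\<lambda>n. ?D (\<Delta> (r n))) \<longlonglongrightarrow> Q"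
    using Q by (simp only: comp_def)
  have "Q \<in> rate_matrices"
    by (rule rate_matrix_limit[OF Q']) (rule \<Delta>(1), rule \<Delta>(4))
  moreover have "filterlim (\<lambda>n. \<Delta> (r n)) (at_right 0) sequentially"
    unfolding filterlim_at
    using LIMSEQ_subseq_LIMSEQ[OF lim0 r] \<Delta>(1) by (auto simp: comp_def less_imp_neq[symmetric])
  ultimately have "Q \<in> \<Q>"
    using Q' by (rule lim)
  have "\<forall>\<^sub>F n in sequentially. lower_envelope \<Q> g $ x - \<epsilon> < (?D (\<Delta> (r n)) *v g) $ x" for x
  proof (rule order_tendstoD(1))
    show "(\<lambda>n. (?D (\<Delta> (r n)) *v g) $ x) \<longlonglongrightarrow> (Q *v g) $ x"
      unfolding mult_vec_nth by (intro tendsto_sum tendsto_mult tendsto_const tendsto_vec_nth Q')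
    show "lower_envelope \<Q> g $ x - \<epsilon> < (Q *v g) $ x"
      using lower_envelope_le[OF \<Q> \<open>Q \<in> \<Q>\<close>, of g x] \<epsilon> by simp
  qed
  then have "\<forall>\<^sub>F n in sequentially. \<forall>x. lower_envelope \<Q> g $ x - \<epsilon> < (?D (\<Delta> (r n)) *v g) $ x"
    by (rule eventually_all_finite)
  then obtain n where "\<forall>x. lower_envelope \<Q> g $ x - \<epsilon> < (?D (\<Delta> (r n)) *v g) $ x"
    by (auto simp: eventually_sequentially)
  then have "?good (\<Delta> (r n))"
    by (simp add: less_imp_le)
  with \<Delta>(3) show False by blast
qed

text \<open>The perturbation \<open>g'\<close> of \<open>g\<close> is needed for right derivatives, where the function to which
  the transition matrix is applied varies with \<open>\<Delta>\<close>.\<close>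

lemma transition_lower_bound:
  fixes \<Q> :: "(real^'x::finite^'x) set" and T :: "real \<Rightarrow> real^'x^'x"
  assumes \<Q>: "\<Q> \<noteq> {}" "\<Q> \<subseteq> rate_matrices" "\<And>Q x y. Q \<in> \<Q> \<Longrightarrow> \<bar>Q $ x $ y\<bar> \<le> B"
    and h0: "h0 > 0" "h0 * B \<le> 1"
    and st: "\<forall>\<^sub>F \<Delta> in at_right 0. stochastic_matrix (T \<Delta>)"
    and ls: "Limsup (at_right 0) (\<lambda>\<Delta>. ereal (1 / \<Delta> * op_norm ((*v) (T \<Delta> - mat 1)))) < \<infinity>"
    and lim: "\<And>Q \<Delta>. \<lbrakk>Q \<in> rate_matrices; filterlim \<Delta> (at_right 0) sequentially;
      (\<lambda>i. (1 / \<Delta> i) *\<^sub>R (T (\<Delta> i) - mat 1)) \<longlonglongrightarrow> Q\<rbrakk> \<Longrightarrow> Q \<in> \<Q>"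
    and \<epsilon>: "\<epsilon> > 0" and K: "K \<ge> 0" and F: "F \<ge> 0"
  shows "\<forall>\<^sub>F \<Delta> in at_right 0. \<forall>g' x. infnorm g' \<le> F \<longrightarrow> infnorm (g' - g) \<le> K * \<Delta> \<longrightarrow>
    (T \<Delta> *v g') $ x \<ge> rate_operator.S (lower_envelope \<Q>) h0 \<Delta> g' $ x - \<epsilon> * \<Delta>"
proof -
  let ?D = "\<lambda>\<Delta>. (1 / \<Delta>) *\<^sub>R (T \<Delta> - mat 1)"
  let ?R = "lower_envelope \<Q>"
  interpret rate_operator ?R h0
    by (rule lower_envelope_rate_operator[OF \<Q> h0])
  obtain b :: nat where b: "Limsup (at_right 0) (\<lambda>\<Delta>. ereal (1 / \<Delta> * op_norm ((*v) (T \<Delta> - mat 1)))) < ereal b"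
    using ls less_PInf_Ex_of_nat by auto
  have "\<forall>\<^sub>F \<Delta> in at_right 0. ereal (1 / \<Delta> * op_norm ((*v) (T \<Delta> - mat 1))) < ereal b"
    by (rule Limsup_lessD[OF b])
  then have bd: "\<forall>\<^sub>F \<Delta> in at_right 0. \<forall>x y. \<bar>?D \<Delta> $ x $ y\<bar> \<le> b"
    using eventually_at_right_less[of 0]
  proof eventually_elim
    case (elim \<Delta>)
    show ?case
    proof (intro allI)
      fix x y
      have "\<bar>?D \<Delta> $ x $ y\<bar> = 1 / \<Delta> * \<bar>(T \<Delta> - mat 1) $ x $ y\<bar>"
        using elim(2) by (simp add: abs_mult)
      also have "\<dots> \<le> 1 / \<Delta> * op_norm ((*v) (T \<Delta> - mat 1))"
        by (rule mult_left_mono[OF abs_entry_le_op_norm]) (use elim(2) in simp)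
      finally show "\<bar>?D \<Delta> $ x $ y\<bar> \<le> b"
        using elim(1) by simp
    qed
  qed
  have quot: "\<forall>\<^sub>F \<Delta> in at_right 0. \<forall>x. (?D \<Delta> *v g) $ x \<ge> ?R g $ x - \<epsilon> / 2"
    by (rule difference_quotient_lower_bound[OF \<Q> st bd lim]) (use \<epsilon> in auto)
  \<comment> \<open>\<open>N\<close> bounds the sum of the absolute entries of the quotients.
    \<open>C\<close> gathers the second-order errors: the perturbation of \<open>g\<close> seen
    through the quotient (\<open>N\<close>) and through the envelope (\<open>M\<close>), and the
    remainder of \<open>S\<close>; the summand 1 makes it positive.\<close>
  define N where "N = real CARD('x) * (real CARD('x) * real b)"
  define C where "C = (N + M) * K + M\<^sup>2 * F + 1"
  have "N \<ge> 0" by (simp add: N_def)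
  then have C: "C > 0"
    unfolding C_def using M_nonneg K F by (intro add_nonneg_pos add_nonneg_nonneg mult_nonneg_nonneg) auto
  have small: "\<forall>\<^sub>F \<Delta> in at_right 0. 0 < \<Delta> \<and> \<Delta> * C \<le> \<epsilon> / 2"
    by (rule eventually_at_right_0I[of "\<epsilon> / 2 / C"]) (use C \<epsilon> in \<open>auto simp: pos_less_divide_eq\<close>)
  from quot bd small show ?thesis
  proof eventually_elim
    case (elim \<Delta>)
    then have \<Delta>: "0 < \<Delta>" by blast
    show ?case
    proof (intro allI impI)
      fix g' x assume F': "infnorm g' \<le> F" and K': "infnorm (g' - g) \<le> K * \<Delta>"
      have "infnorm (S \<Delta> g' - g' - \<Delta> *\<^sub>R ?R g') \<le> (\<Delta> * M)\<^sup>2 * F"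
        by (rule order_trans[OF S_first_order]) (use \<Delta> F' in \<open>auto intro: mult_left_mono\<close>)
      from order_trans[OF nth_le_infnorm this, of x]
      have 1: "S \<Delta> g' $ x \<le> g' $ x + \<Delta> * ?R g' $ x + (\<Delta> * M)\<^sup>2 * F"
        by simp
      have "infnorm (?R g' - ?R g) \<le> M * (K * \<Delta>)"
        by (rule order_trans[OF R_lipschitz]) (rule mult_left_mono[OF K' M_nonneg])
      from order_trans[OF nth_le_infnorm this, of x]
      have 2: "?R g' $ x \<le> ?R g $ x + M * (K * \<Delta>)"
        by simp
      have "infnorm (?D \<Delta> *v (g' - g)) \<le> N * (K * \<Delta>)"
      proof (rule order_trans[OF infnorm_mult_vec_le], rule mult_mono)
        have "(\<Sum>x\<in>UNIV. \<Sum>y\<in>UNIV. \<bar>?D \<Delta> $ x $ y\<bar>) \<le> (\<Sum>x\<in>(UNIV::'x set). \<Sum>y\<in>(UNIV::'x set). real b)"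
          by (intro sum_mono elim(2)[rule_format])
        then show "(\<Sum>x\<in>UNIV. \<Sum>y\<in>UNIV. \<bar>?D \<Delta> $ x $ y\<bar>) \<le> N"
          by (simp add: N_def)
      qed (use K' \<open>N \<ge> 0\<close> infnorm_pos_le in auto)
      then have "(?D \<Delta> *v (g' - g)) $ x \<ge> - (N * (K * \<Delta>))"
        using minus_infnorm_le_nth[of "?D \<Delta> *v (g' - g)" x] by linarith
      then have 3: "(?D \<Delta> *v g') $ x \<ge> (?D \<Delta> *v g) $ x - N * (K * \<Delta>)"
        by (simp add: matrix_vector_mult_diff_distrib)
      have D: "(T \<Delta> *v g') $ x = g' $ x + \<Delta> * (?D \<Delta> *v g') $ x"
        using \<Delta> by (simp add: matrix_vector_mult_diff_rdistrib scaleR_matrix_vector_assoc[symmetric])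
      have "(?D \<Delta> *v g') $ x \<ge> ?R g' $ x - \<epsilon> / 2 - (N + M) * (K * \<Delta>)"
        using 2 3 elim(1)[rule_format, of x] unfolding distrib_right by linarith
      from mult_left_mono[OF this, of \<Delta>] \<Delta>
      have "(T \<Delta> *v g') $ x \<ge> g' $ x + \<Delta> * ?R g' $ x - \<Delta> * (\<epsilon> / 2) - \<Delta> * ((N + M) * (K * \<Delta>))"
        unfolding D right_diff_distrib by linarith
      with 1 have "(T \<Delta> *v g') $ x \<ge> S \<Delta> g' $ x - \<Delta> * (\<epsilon> / 2) - \<Delta> * (\<Delta> * ((N + M) * K + M\<^sup>2 * F))"
        by (simp add: algebra_simps power2_eq_square)
      moreover have "\<Delta> * (\<Delta> * ((N + M) * K + M\<^sup>2 * F)) \<le> \<Delta> * (\<epsilon> / 2)"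
      proof (rule mult_left_mono)
        have "\<Delta> * ((N + M) * K + M\<^sup>2 * F) \<le> \<Delta> * C"
          unfolding C_def using \<Delta> by (intro mult_left_mono) auto
        then show "\<Delta> * ((N + M) * K + M\<^sup>2 * F) \<le> \<epsilon> / 2"
          using elim(3) by linarith
      qed (use \<Delta> in simp)
      ultimately show "(T \<Delta> *v g') $ x \<ge> S \<Delta> g' $ x - \<epsilon> * \<Delta>"
        by (simp add: field_simps)
    qed
  qed
qed

lemma expectation_lower_bound:
  fixes \<Q> :: "(real^'x::finite^'x) set" and \<Omega> :: "(real \<Rightarrow> 'x) set"
  assumes \<Q>: "\<Q> \<noteq> {}" "\<Q> \<subseteq> rate_matrices" "\<And>Q x y. Q \<in> \<Q> \<Longrightarrow> \<bar>Q $ x $ y\<bar> \<le> B"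
    and h0: "h0 > 0" "h0 * B \<le> 1" and \<Omega>: "path_space \<Omega>" and P: "P \<in> P_W \<Omega> \<Q> \<M>" and s: "0 \<le> s"
  shows "(\<Sum>x\<in>UNIV. P (ev \<Omega> 0 x, \<Omega>) * rate_operator.S (lower_envelope \<Q>) h0 s f $ x)
    \<le> (\<Sum>x\<in>UNIV. f $ x * P (ev \<Omega> s x, \<Omega>))"
proof -
  interpret rate_operator "lower_envelope \<Q>" h0
    by (rule lower_envelope_rate_operator[OF \<Q> h0])
  have coh: "coherent \<Omega> P" and wb: "well_behaved \<Omega> P" and cons: "consistent_rates \<Omega> \<Q> P"
    using P by (auto simp: P_W_def stochastic_process_def)
  have od: "outer_derivative \<Omega> P {} (\<lambda>_. undefined) t \<subseteq> \<Q>" if "0 \<le> t" for t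
  proof (rule cons[unfolded consistent_rates_def, THEN spec, THEN mp, OF that, THEN bspec, THEN bspec])
    show "{} \<in> time_sets_below t"
      by (simp add: time_sets_below_def time_sets_def)
  qed simp
  define T where "T = trans_matrix \<Omega> P {} (\<lambda>_. undefined)"
  have "ev \<Omega> t x \<inter> \<Omega> = ev \<Omega> t x" for t x
    by (auto simp: ev_def)
  then have T: "T t r $ x $ y = P (ev \<Omega> r y, ev \<Omega> t x)" for t r x y
    by (simp add: T_def trans_matrix_def)
  have st: "stochastic_matrix (T t r)" if "0 \<le> t" "t \<le> r" for t r
    unfolding stochastic_matrix_def T
    using coherent_nonneg[OF \<Omega> coh C_SP_transition[OF that]]
      coherent_sum[OF \<Omega> coh C_SP_transition[OF that]] by simp
  define p where "p t x = P (ev \<Omega> t x, \<Omega>)" for t x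
  have p_nonneg: "p t x \<ge> 0" and p_sum: "(\<Sum>x\<in>UNIV. p t x) = 1" if "0 \<le> t" for t x
    unfolding p_def
    using coherent_nonneg[OF \<Omega> coh C_SP_unconditional[OF that]]
      coherent_sum[OF \<Omega> coh C_SP_unconditional[OF that]] by simp_all
  have total: "(\<Sum>y\<in>UNIV. p r y * g $ y) = (\<Sum>x\<in>UNIV. p t x * (T t r *v g) $ x)"
    if "0 \<le> t" "t \<le> r" for t r g
  proof -
    have "(\<Sum>y\<in>UNIV. p r y * g $ y) = (\<Sum>y\<in>UNIV. \<Sum>x\<in>UNIV. p t x * (T t r $ x $ y * g $ y))"
      unfolding p_def T coherent_total_probability[OF \<Omega> coh that]
      by (simp add: sum_distrib_right mult.assoc)
    also have "\<dots> = (\<Sum>x\<in>UNIV. \<Sum>y\<in>UNIV. p t x * (T t r $ x $ y * g $ y))"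
      by (rule sum.swap)
    finally show ?thesis
      by (simp add: mult_vec_nth sum_distrib_left)
  qed
  define \<phi> where "\<phi> t = (\<Sum>x\<in>UNIV. p t x * S (s - t) f $ x)" for t
  \<comment> \<open>Total probability expresses \<open>\<phi> b\<close>, and the semigroup law
    \<open>\<phi> a\<close>, as an average over the law at time \<open>a\<close> of an operator
    applied to \<open>S (s - b) f\<close>. A pointwise comparison of \<open>T a b\<close> with
    \<open>S (b - a)\<close> is thereby averaged into one of \<open>\<phi>\<close>.\<close>
  have diff: "\<phi> b - \<phi> a \<ge> - (\<epsilon> * (b - a))"
    if ab: "0 \<le> a" "a \<le> b" "b \<le> s"
      and le: "\<And>x. (T a b *v S (s - b) f) $ x \<ge> S (b - a) (S (s - b) f) $ x - \<epsilon> * (b - a)" for a b \<epsilon>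
  proof -
    have "\<phi> a = (\<Sum>x\<in>UNIV. p a x * S (b - a) (S (s - b) f) $ x)"
      using S_add[of "b - a" "s - b" f] ab by (simp add: \<phi>_def)
    also have "\<dots> \<le> (\<Sum>x\<in>UNIV. p a x * ((T a b *v S (s - b) f) $ x + \<epsilon> * (b - a)))"
    proof (intro sum_mono mult_left_mono p_nonneg ab)
      show "S (b - a) (S (s - b) f) $ x \<le> (T a b *v S (s - b) f) $ x + \<epsilon> * (b - a)" for x
        using le[of x] by linarith
    qed
    also have "\<dots> = (\<Sum>x\<in>UNIV. p a x * (T a b *v S (s - b) f) $ x) + \<epsilon> * (b - a)"
      using p_sum[OF ab(1)] by (simp add: distrib_left sum.distrib flip: sum_distrib_right)
    also have "(\<Sum>x\<in>UNIV. p a x * (T a b *v S (s - b) f) $ x) = \<phi> b"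
      unfolding \<phi>_def by (rule total[OF ab(1,2), symmetric])
    finally show ?thesis by linarith
  qed
  define F where "F = infnorm f"
  have F: "F \<ge> 0" by (simp add: F_def infnorm_pos_le)
  have SF: "infnorm (S t f) \<le> F" if "0 \<le> t" for t
    unfolding F_def by (rule lto_infnorm_le[OF lto_S[OF that]])
  \<comment> \<open>For \<open>0 < b - t < 1\<close> the functions \<open>S (s - b) f\<close> and
    \<open>S (s - t) f\<close> are at most \<open>K * (b - t)\<close> apart: the first-order term
    contributes \<open>M * F\<close>, the remainder \<open>M^2 * F\<close>.\<close>
  define K where "K = M * F + M\<^sup>2 * F"
  have K: "K \<ge> 0" unfolding K_def using M_nonneg F by simp
  have "- (\<epsilon> * s) \<le> \<phi> s - \<phi> 0" if \<epsilon>: "\<epsilon> > 0" for \<epsilon>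
  proof -
    have right: "\<exists>d>0. \<forall>b. t < b \<and> b < t + d \<and> b \<le> s \<longrightarrow> \<phi> b - \<phi> t \<ge> - (\<epsilon> * (b - t))"
      if t: "0 \<le> t" "t \<le> s" for t
    proof -
      have "\<forall>\<^sub>F \<Delta> in at_right 0. \<forall>g' x. infnorm g' \<le> F \<longrightarrow> infnorm (g' - S (s - t) f) \<le> K * \<Delta> \<longrightarrow>
        (T t (t + \<Delta>) *v g') $ x \<ge> S \<Delta> g' $ x - \<epsilon> * \<Delta>"
      proof (rule transition_lower_bound[OF \<Q> h0 _ _ _ \<epsilon> K F])
        show "\<forall>\<^sub>F \<Delta> in at_right 0. stochastic_matrix (T t (t + \<Delta>))"
          by (rule eventually_at_right_0I[of 1]) (use st t in auto)
        show "Limsup (at_right 0) (\<lambda>\<Delta>. ereal (1 / \<Delta> * op_norm ((*v) (T t (t + \<Delta>) - mat 1)))) < \<infinity>"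
          using wb t(1) by (simp add: well_behaved_def T_def time_sets_below_def time_sets_def)
        show "Q \<in> \<Q>" if "Q \<in> rate_matrices" "filterlim \<Delta> (at_right 0) sequentially"
          "(\<lambda>i. (1 / \<Delta> i) *\<^sub>R (T t (t + \<Delta> i) - mat 1)) \<longlonglongrightarrow> Q" for Q \<Delta>
        proof -
          have "Q \<in> outer_derivative \<Omega> P {} (\<lambda>_. undefined) t"
            using that unfolding outer_derivative_def T_def by blast
          with t(1) show ?thesis
            using od[of t] by auto
        qed
      qed
      moreover have "\<forall>\<^sub>F \<Delta> in at_right 0. \<Delta> < (1::real)"
        by (rule eventually_at_right_0I[of 1]) auto
      ultimately have "\<forall>\<^sub>F \<Delta> in at_right 0. \<Delta> < 1 \<and> (\<forall>g' x. infnorm g' \<le> F \<longrightarrow>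
        infnorm (g' - S (s - t) f) \<le> K * \<Delta> \<longrightarrow> (T t (t + \<Delta>) *v g') $ x \<ge> S \<Delta> g' $ x - \<epsilon> * \<Delta>)"
        by eventually_elim blast
      then obtain d where d: "d > 0" and le: "\<And>\<Delta>. \<lbrakk>0 < \<Delta>; \<Delta> < d\<rbrakk> \<Longrightarrow> \<Delta> < 1 \<and> (\<forall>g' x. infnorm g' \<le> F \<longrightarrow>
        infnorm (g' - S (s - t) f) \<le> K * \<Delta> \<longrightarrow> (T t (t + \<Delta>) *v g') $ x \<ge> S \<Delta> g' $ x - \<epsilon> * \<Delta>)"
        unfolding eventually_at_right_field by blast
      have "\<phi> b - \<phi> t \<ge> - (\<epsilon> * (b - t))" if b: "t < b" "b < t + d" "b \<le> s" for b
      proof (rule diff)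
        fix x
        let ?g' = "S (s - b) f" and ?D = "b - t"
        have D: "0 < ?D" "?D < d" using b by auto
        have D1: "?D < 1" using le[OF D] by blast
        have g: "S (s - t) f = S ?D ?g'"
          using S_add[of ?D "s - b" f] b by simp
        have "infnorm (?g' - S (s - t) f) = infnorm (?D *\<^sub>R lower_envelope \<Q> ?g'
            + (S ?D ?g' - ?g' - ?D *\<^sub>R lower_envelope \<Q> ?g'))"
          unfolding g by (subst infnorm_sub) simp
        also have "\<dots> \<le> infnorm (?D *\<^sub>R lower_envelope \<Q> ?g')
            + infnorm (S ?D ?g' - ?g' - ?D *\<^sub>R lower_envelope \<Q> ?g')"
          by (rule infnorm_triangle)
        also have "infnorm (?D *\<^sub>R lower_envelope \<Q> ?g') \<le> ?D * (M * F)"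
          unfolding infnorm_mul using D b SF[of "s - b"] M_nonneg
          by (auto intro!: mult_left_mono order_trans[OF R_bound])
        also have "infnorm (S ?D ?g' - ?g' - ?D *\<^sub>R lower_envelope \<Q> ?g') \<le> (?D * M)\<^sup>2 * F"
        proof (rule order_trans[OF S_first_order])
          show "(?D * M)\<^sup>2 * infnorm ?g' \<le> (?D * M)\<^sup>2 * F"
            by (rule mult_left_mono) (use SF b in auto)
        qed (use D in simp)
        also have "(?D * M)\<^sup>2 * F \<le> ?D * (M\<^sup>2 * F)"
        proof -
          have "(?D * M)\<^sup>2 * F = ?D * (?D * (M\<^sup>2 * F))"
            by (simp add: power2_eq_square)
          also have "\<dots> \<le> ?D * (1 * (M\<^sup>2 * F))"
            by (rule mult_left_mono, rule mult_right_mono) (use D D1 F in auto)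
          finally show ?thesis by simp
        qed
        finally have "infnorm (?g' - S (s - t) f) \<le> K * ?D"
          by (simp add: K_def algebra_simps)
        moreover have "infnorm ?g' \<le> F" using SF b by simp
        ultimately show "(T t b *v ?g') $ x \<ge> S ?D ?g' $ x - \<epsilon> * ?D"
          using le[OF D] by simp
      qed (use b t in auto)
      with d show ?thesis by blast
    qed
    \<comment> \<open>Here the function \<open>S (s - t) f\<close> stays fixed and only the starting
      time moves, so the perturbation bound is taken with \<open>K = 0\<close>.\<close>
    have left: "\<exists>d>0. \<forall>a. t - d < a \<and> a < t \<and> 0 \<le> a \<longrightarrow> \<phi> t - \<phi> a \<ge> - (\<epsilon> * (t - a))"
      if t: "0 < t" "t \<le> s" for t
    proof -
      let ?g = "S (s - t) f"
      have "\<forall>\<^sub>F \<Delta> in at_right 0. \<forall>g' x. infnorm g' \<le> F \<longrightarrow> infnorm (g' - ?g) \<le> 0 * \<Delta> \<longrightarrow>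
        (T (t - \<Delta>) t *v g') $ x \<ge> S \<Delta> g' $ x - \<epsilon> * \<Delta>"
      proof (rule transition_lower_bound[OF \<Q> h0 _ _ _ \<epsilon> order_refl F])
        show "\<forall>\<^sub>F \<Delta> in at_right 0. stochastic_matrix (T (t - \<Delta>) t)"
          by (rule eventually_at_right_0I[of t]) (use st t in auto)
        show "Limsup (at_right 0) (\<lambda>\<Delta>. ereal (1 / \<Delta> * op_norm ((*v) (T (t - \<Delta>) t - mat 1)))) < \<infinity>"
          using wb t(1) by (simp add: well_behaved_def T_def time_sets_below_def time_sets_def)
        show "Q \<in> \<Q>" if "Q \<in> rate_matrices" "filterlim \<Delta> (at_right 0) sequentially"
          "(\<lambda>i. (1 / \<Delta> i) *\<^sub>R (T (t - \<Delta> i) t - mat 1)) \<longlonglongrightarrow> Q" for Q \<Delta>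
        proof -
          have "Q \<in> outer_derivative \<Omega> P {} (\<lambda>_. undefined) t"
            using that t unfolding outer_derivative_def T_def by blast
          with t(1) show ?thesis
            using od[of t] by auto
        qed
      qed
      then obtain d where d: "d > 0" and le: "\<And>\<Delta> g' x. \<lbrakk>0 < \<Delta>; \<Delta> < d; infnorm g' \<le> F;
        infnorm (g' - ?g) \<le> 0 * \<Delta>\<rbrakk> \<Longrightarrow> (T (t - \<Delta>) t *v g') $ x \<ge> S \<Delta> g' $ x - \<epsilon> * \<Delta>"
        unfolding eventually_at_right_field by blast
      have "\<phi> t - \<phi> a \<ge> - (\<epsilon> * (t - a))" if a: "t - d < a" "a < t" "0 \<le> a" for a
      proof (rule diff)
        show "(T a t *v ?g) $ x \<ge> S (t - a) ?g $ x - \<epsilon> * (t - a)" for x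
          using le[of "t - a" ?g x] a t SF[of "s - t"] by (simp add: infnorm_0)
      qed (use a t in auto)
      with d show ?thesis by blast
    qed
    \<comment> \<open>The radius of validity depends on \<open>t\<close>, so the local inequalities
      are glued by the compactness principle \<open>Bolzano\<close>: the relation is additive over
      adjacent intervals and holds for all short intervals around each point. The guard makes it
      trivial for intervals that stick out of \<open>[0, s]\<close>.\<close>
    define I where "I a b \<longleftrightarrow> (0 \<le> a \<and> b \<le> s \<longrightarrow> \<phi> b - \<phi> a \<ge> - (\<epsilon> * (b - a)))" for a b
    have "I 0 s"
    proof (rule Bolzano[OF s])
      fix a b c assume "I a b" "I b c" "a \<le> b" "b \<le> c"
      then show "I a c"
        by (auto simp: I_def right_diff_distrib)
    next
      fix t assume t: "0 \<le> t" "t \<le> s"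
      obtain d1 where d1: "d1 > 0" "\<And>b. \<lbrakk>t < b; b < t + d1; b \<le> s\<rbrakk> \<Longrightarrow> \<phi> b - \<phi> t \<ge> - (\<epsilon> * (b - t))"
        using right[OF t] by blast
      obtain d2 where d2: "d2 > 0"
        "\<And>a. \<lbrakk>t - d2 < a; a < t; 0 \<le> a\<rbrakk> \<Longrightarrow> \<phi> t - \<phi> a \<ge> - (\<epsilon> * (t - a))"
      proof (cases "t = 0")
        case True
        then show ?thesis by (intro that[of 1]) auto
      next
        case False
        then show ?thesis using left[of t] t that by force
      qed
      show "\<exists>d>0. \<forall>a b. a \<le> t \<and> t \<le> b \<and> b - a < d \<longrightarrow> I a b"
        unfolding I_def
      proof (intro exI[of _ "min d1 d2"] conjI allI impI)
        fix a b assume ab: "a \<le> t \<and> t \<le> b \<and> b - a < min d1 d2" "0 \<le> a \<and> b \<le> s"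
        have "\<phi> b - \<phi> t \<ge> - (\<epsilon> * (b - t))"
          using d1(2)[of b] ab by (cases "b = t") auto
        moreover have "\<phi> t - \<phi> a \<ge> - (\<epsilon> * (t - a))"
          using d2(2)[of a] ab by (cases "a = t") auto
        ultimately show "\<phi> b - \<phi> a \<ge> - (\<epsilon> * (b - a))"
          unfolding right_diff_distrib by linarith
      qed (use d1 d2 in auto)
    qed
    then show ?thesis by (simp add: I_def s)
  qed
  then have le: "\<phi> 0 - \<phi> s \<le> \<epsilon> * s" if "\<epsilon> > 0" for \<epsilon>
    using that by (metis minus_diff_eq neg_le_iff_le)
  have "\<phi> 0 - \<phi> s \<le> 0"
  proof (rule field_le_epsilon)
    fix e :: real assume e: "e > 0"
    have "\<phi> 0 - \<phi> s \<le> e / (s + 1) * s"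
      using e s by (intro le) simp
    also have "\<dots> \<le> e"
      using e s by (simp add: field_simps)
    finally show "\<phi> 0 - \<phi> s \<le> 0 + e" by simp
  qed
  then show ?thesis
    by (simp add: \<phi>_def p_def mult.commute)
qed

section \<open>Markov chains from transition kernels\<close>

text \<open>\<open>expect K t w rs F\<close> is the expectation of \<open>F\<close> for the chain that follows the path \<open>w\<close> up to
  time \<open>t\<close>, moves with kernel \<open>K\<close> along the increasing times \<open>rs\<close>, and has the values of \<open>w\<close>
  at all other times.\<close>

fun expect :: "(real \<Rightarrow> real \<Rightarrow> 'x \<Rightarrow> 'x::finite \<Rightarrow> real) \<Rightarrow> real \<Rightarrow> (real \<Rightarrow> 'x) \<Rightarrow> real list \<Rightarrow>
    ((real \<Rightarrow> 'x) \<Rightarrow> real) \<Rightarrow> real" where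
  "expect K t w [] F = F w"
| "expect K t w (r # rs) F = (\<Sum>y\<in>UNIV. K t r (w t) y * expect K r (w(r := y)) rs F)"

text \<open>Paths remain total functions throughout; finite dimensionality is a property of the
  function on them, which avoids a separate type for each time set.\<close>

definition depends_on :: "((real \<Rightarrow> 'x) \<Rightarrow> 'b) \<Rightarrow> real set \<Rightarrow> bool" where
  "depends_on F D \<longleftrightarrow> (\<forall>w w'. (\<forall>r\<in>D. w r = w' r) \<longrightarrow> F w = F w')"

lemma depends_onD: "depends_on F D \<Longrightarrow> (\<And>r. r \<in> D \<Longrightarrow> w r = w' r) \<Longrightarrow> F w = F w'"
  unfolding depends_on_def by blast

lemma depends_onI: "(\<And>w w'. (\<And>r. r \<in> D \<Longrightarrow> w r = w' r) \<Longrightarrow> F w = F w') \<Longrightarrow> depends_on F D"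
  unfolding depends_on_def by blast

text \<open>\<open>0 \<le> r\<close> is required separately because \<open>t\<close> may be a
  negative time that precedes the process.\<close>

definition increasing_after :: "real \<Rightarrow> real list \<Rightarrow> bool" where
  "increasing_after t rs \<longleftrightarrow> sorted_wrt (<) rs \<and> (\<forall>r\<in>set rs. t < r \<and> 0 \<le> r)"

lemma increasing_after_Cons:
  "increasing_after t (r # rs) \<longleftrightarrow> t < r \<and> 0 \<le> r \<and> increasing_after r rs"
  by (auto simp: increasing_after_def)

lemma increasing_after_sorted_list:
  "\<lbrakk>finite V; \<And>r. r \<in> V \<Longrightarrow> t < r \<and> 0 \<le> r\<rbrakk> \<Longrightarrow> increasing_after t (sorted_list_of_set V)"
  by (simp add: increasing_after_def)

lemma expect_cong:
  assumes "\<And>w'. (\<And>r. r \<notin> set rs \<Longrightarrow> w' r = w r) \<Longrightarrow> F w' = G w'"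
  shows "expect K t w rs F = expect K t w rs G"
  using assms
proof (induction rs arbitrary: t w)
  case (Cons r rs)
  have "expect K r (w(r := y)) rs F = expect K r (w(r := y)) rs G" for y
    by (rule Cons.IH, rule Cons.prems) auto
  then show ?case by simp
qed simp

lemma expect_sum:
  "expect K t w rs (\<lambda>w. \<Sum>j\<in>J. c j * G j w) = (\<Sum>j\<in>J. c j * expect K t w rs (G j))"
proof (induction rs arbitrary: t w)
  case (Cons r rs)
  have "expect K t w (r # rs) (\<lambda>w. \<Sum>j\<in>J. c j * G j w)
      = (\<Sum>y\<in>UNIV. \<Sum>j\<in>J. c j * (K t r (w t) y * expect K r (w(r := y)) rs (G j)))"
    by (simp add: Cons.IH sum_distrib_left mult.left_commute del: fun_upd_apply)
  also have "\<dots> = (\<Sum>j\<in>J. \<Sum>y\<in>UNIV. c j * (K t r (w t) y * expect K r (w(r := y)) rs (G j)))"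
    by (rule sum.swap)
  finally show ?case
    by (simp add: sum_distrib_left)
qed simp

lemma expect_append:
  "expect K t w (rs @ rs') F = expect K t w rs (\<lambda>w'. expect K (last (t # rs)) w' rs' F)"
  by (induction rs arbitrary: t w) simp_all

text \<open>The coordinates in \<open>rs\<close> get overwritten, the value at \<open>t\<close> is
  used by the first transition, and the remaining ones matter only through \<open>D\<close>.\<close>

lemma expect_agree:
  assumes "depends_on F D" "\<And>r. r \<in> D \<Longrightarrow> r \<notin> set rs \<Longrightarrow> w r = w' r" "w t = w' t"
  shows "expect K t w rs F = expect K t w' rs F"
  using assms(2,3)
proof (induction rs arbitrary: t w w')
  case Nil
  show ?case
    unfolding expect.simps by (rule depends_onD[OF assms(1)]) (use Nil in auto)
next
  case (Cons r rs)
  have "expect K r (w(r := y)) rs F = expect K r (w'(r := y)) rs F" for y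
    by (rule Cons.IH) (use Cons.prems in auto)
  then show ?case
    using Cons.prems(2) by simp
qed

text \<open>Negative times stand for a time before the process starts; they serve as conditioning
  time when the history is empty.\<close>

locale markov_kernel =
  fixes K :: "real \<Rightarrow> real \<Rightarrow> 'x::finite \<Rightarrow> 'x \<Rightarrow> real"
  assumes K_nonneg: "\<lbrakk>t < r; 0 \<le> r\<rbrakk> \<Longrightarrow> K t r x y \<ge> 0"
    and K_sum: "\<lbrakk>t < r; 0 \<le> r\<rbrakk> \<Longrightarrow> (\<Sum>y\<in>UNIV. K t r x y) = 1"
    and K_comp: "\<lbrakk>t < r; 0 \<le> r; r < q\<rbrakk> \<Longrightarrow> (\<Sum>y\<in>UNIV. K t r x y * K r q y z) = K t q x z"
    and K_initial: "t < 0 \<Longrightarrow> K t r x y = K t r x' y"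
begin

text \<open>From a negative time the first transition ignores the current state by
  \<open>K_initial\<close>, so agreement at \<open>t\<close> can be dispensed with.\<close>

lemma expect_agree_initial:
  assumes "depends_on F D" "\<And>r. r \<in> D \<Longrightarrow> r \<notin> set rs \<Longrightarrow> w r = w' r" "t < 0"
  shows "expect K t w rs F = expect K t w' rs F"
proof (cases rs)
  case Nil
  show ?thesis
    unfolding Nil expect.simps by (rule depends_onD[OF assms(1)]) (use assms(2) Nil in auto)
next
  case (Cons r rs')
  have "expect K r (w(r := y)) rs' F = expect K r (w'(r := y)) rs' F" for y
    by (rule expect_agree[OF assms(1)]) (use assms(2) Cons in auto)
  moreover have "K t r (w t) y = K t r (w' t) y" for y
    by (rule K_initial[OF assms(3)])
  ultimately show ?thesis
    using Cons by simp
qed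

lemma expect_const: "increasing_after t rs \<Longrightarrow> expect K t w rs (\<lambda>_. c) = c"
  by (induction rs arbitrary: t w)
    (simp_all add: increasing_after_Cons K_sum flip: sum_distrib_right)

text \<open>An average does not exceed its largest term: picking at every time a successor that
  maximises the remaining expectation builds the path. Coherence will obtain its path with
  non-negative gain in this way.\<close>

lemma expect_attained:
  "increasing_after t rs \<Longrightarrow> \<exists>w'. (\<forall>r. r \<notin> set rs \<longrightarrow> w' r = w r) \<and> expect K t w rs F \<le> F w'"
proof (induction rs arbitrary: t w)
  case Nil
  then show ?case by auto
next
  case (Cons r rs)
  then have tr: "t < r" "0 \<le> r" and inc: "increasing_after r rs"
    by (auto simp: increasing_after_Cons)
  let ?e = "\<lambda>y. expect K r (w(r := y)) rs F"
  have "Max (range ?e) \<in> range ?e"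
    by (intro Max_in) auto
  then obtain z where z: "Max (range ?e) = ?e z"
    by blast
  have "?e y \<le> ?e z" for y
    unfolding z[symmetric] by (intro Max_ge) auto
  then have "expect K t w (r # rs) F \<le> (\<Sum>y\<in>UNIV. K t r (w t) y * ?e z)"
    by (simp add: sum_mono mult_left_mono K_nonneg[OF tr])
  also have "\<dots> = ?e z"
    using K_sum[OF tr] by (simp flip: sum_distrib_right)
  finally have le: "expect K t w (r # rs) F \<le> ?e z" .
  obtain w' where w': "\<forall>q. q \<notin> set rs \<longrightarrow> w' q = (w(r := z)) q" "?e z \<le> F w'"
    using Cons.IH[OF inc, of "w(r := z)"] by blast
  show ?case
    by (rule exI[of _ w']) (use w' le in auto)
qed

text \<open>A time on which \<open>F\<close> does not depend is summed out, by the
  Chapman-Kolmogorov identity \<open>K_comp\<close> when a later time follows and by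
  \<open>K_sum\<close> when it is the last one.\<close>

lemma expect_insort:
  assumes "increasing_after t rs" "t < r" "0 \<le> r" "r \<notin> set rs" "depends_on F D" "r \<notin> D"
  shows "expect K t w (insort r rs) F = expect K t w rs F"
  using assms(1-4)
proof (induction rs arbitrary: t w)
  case Nil
  have "F (w(r := y)) = F w" for y
    by (rule depends_onD[OF assms(5)]) (use assms(6) in auto)
  then show ?case
    using K_sum[OF Nil(2,3)] by (simp flip: sum_distrib_right)
next
  case (Cons q rs)
  from Cons.prems have q: "t < q" "0 \<le> q" "increasing_after q rs" "r \<noteq> q"
    by (auto simp: increasing_after_Cons)
  show ?case
  proof (cases "r < q")
    case True
    have eq: "expect K q (w(r := z, q := y)) rs F = expect K q (w(q := y)) rs F" for y z
      by (rule expect_agree[OF assms(5)]) (use assms(6) in auto)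
    have "expect K t w (insort r (q # rs)) F = (\<Sum>z\<in>UNIV. \<Sum>y\<in>UNIV.
        K t r (w t) z * K r q z y * expect K q (w(q := y)) rs F)"
      using True by (simp add: eq sum_distrib_left mult.assoc)
    also have "\<dots> = (\<Sum>y\<in>UNIV. \<Sum>z\<in>UNIV. K t r (w t) z * K r q z y * expect K q (w(q := y)) rs F)"
      by (rule sum.swap)
    also have "\<dots> = (\<Sum>y\<in>UNIV. K t q (w t) y * expect K q (w(q := y)) rs F)"
      by (simp add: K_comp[OF Cons.prems(2,3) True] flip: sum_distrib_right)
    finally show ?thesis by simp
  next
    case False
    with q have "q < r" by simp
    with q Cons.prems show ?thesis
      by (simp add: Cons.IH del: fun_upd_apply)
  qed
qed

text \<open>Consistency of the finite-dimensional laws, obtained by inserting the irrelevant times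
  one by one.\<close>

lemma expect_mono_times:
  assumes V': "finite V'" "\<And>r. r \<in> V' \<Longrightarrow> t < r \<and> 0 \<le> r" and "V \<subseteq> V'"
    and F: "depends_on F D" "(V' - V) \<inter> D = {}"
  shows "expect K t w (sorted_list_of_set V') F = expect K t w (sorted_list_of_set V) F"
proof -
  have V: "finite V"
    using assms(3) V'(1) by (rule finite_subset)
  have "expect K t w (sorted_list_of_set (V \<union> W)) F = expect K t w (sorted_list_of_set V) F"
    if "finite W" "W \<subseteq> V' - V" for W
    using that
  proof (induction W)
    case (insert r W)
    have "expect K t w (insort r (sorted_list_of_set (V \<union> W))) F
        = expect K t w (sorted_list_of_set (V \<union> W)) F"
    proof (rule expect_insort[OF _ _ _ _ F(1)])
      show "increasing_after t (sorted_list_of_set (V \<union> W))"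
        by (rule increasing_after_sorted_list) (use V V'(2) insert assms(3) in auto)
      show "t < r" "0 \<le> r" "r \<notin> D"
        using V'(2)[of r] insert.prems F(2) by auto
      show "r \<notin> set (sorted_list_of_set (V \<union> W))"
        using V insert by auto
    qed
    moreover have "sorted_list_of_set (V \<union> insert r W) = insort r (sorted_list_of_set (V \<union> W))"
      using V insert by (simp add: sorted_list_of_set_insert_remove)
    ultimately show ?case
      using insert by simp
  qed simp
  from this[of "V' - V"] show ?thesis
    using V'(1) assms(3) by (simp add: Un_absorb1)
qed

end

section \<open>Events as cylinder sets\<close>

text \<open>Sets of this form are an algebra containing the generators, hence contain the hull.
  \<open>B\<close> is a set of arbitrary functions rather than of members of
  \<open>\<Omega>\<close>, because \<open>expect\<close> changes paths pointwise and may leave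
  \<open>\<Omega>\<close>.\<close>

lemma event_algebra_cylinder:
  assumes "u \<in> time_sets" "A \<in> event_algebra \<Omega> u"
  shows "\<exists>v B. finite v \<and> v \<subseteq> {0..} \<and> (\<forall>r\<in>v. r \<in> u \<or> (\<forall>q\<in>u. q < r)) \<and> A = \<Omega> \<inter> B \<and>
    depends_on (\<lambda>w. w \<in> B) v"
proof -
  define cyl where "cyl A v B \<longleftrightarrow> finite v \<and> v \<subseteq> {0..} \<and> (\<forall>r\<in>v. r \<in> u \<or> (\<forall>q\<in>u. q < r)) \<and>
    A = \<Omega> \<inter> B \<and> depends_on (\<lambda>w. w \<in> B) v" for A v B
  have "event_algebra \<Omega> u \<subseteq> {A. \<exists>v B. cyl A v B}"
    unfolding event_algebra_def
  proof (rule hull_minimal)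
    have "cyl (ev \<Omega> t x) {t} {w. w t = x}" if "0 \<le> t" "t \<in> u \<or> (\<forall>r\<in>u. r < t)" for t x
      using that by (auto simp: cyl_def ev_def depends_on_def)
    then show "{ev \<Omega> t x | t x. 0 \<le> t \<and> (t \<in> u \<or> (\<forall>r\<in>u. r < t))} \<subseteq> {A. \<exists>v B. cyl A v B}"
      by blast
    show "algebra \<Omega> {A. \<exists>v B. cyl A v B}"
      unfolding algebra_iff_Un
    proof (intro conjI ballI)
      show "{A. \<exists>v B. cyl A v B} \<subseteq> Pow \<Omega>"
        by (auto simp: cyl_def)
      have "cyl {} {} {}"
        by (auto simp: cyl_def depends_on_def)
      then show "{} \<in> {A. \<exists>v B. cyl A v B}"
        by blast
    next
      fix A assume "A \<in> {A. \<exists>v B. cyl A v B}"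
      then obtain v B where "cyl A v B" by blast
      then have "cyl (\<Omega> - A) v (- B)"
        by (auto simp: cyl_def depends_on_def)
      then show "\<Omega> - A \<in> {A. \<exists>v B. cyl A v B}"
        by blast
    next
      fix A A' assume "A \<in> {A. \<exists>v B. cyl A v B}" "A' \<in> {A. \<exists>v B. cyl A v B}"
      then obtain v B v' B' where c: "cyl A v B" "cyl A' v' B'" by blast
      have "depends_on (\<lambda>w. w \<in> B \<union> B') (v \<union> v')"
      proof (rule depends_onI)
        fix w w' :: "real \<Rightarrow> 'a" assume "\<And>r. r \<in> v \<union> v' \<Longrightarrow> w r = w' r"
        then have "(w \<in> B) = (w' \<in> B)" "(w \<in> B') = (w' \<in> B')"
          using c depends_onD[of "\<lambda>w. w \<in> B" v w w'] depends_onD[of "\<lambda>w. w \<in> B'" v' w w']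
          by (simp_all add: cyl_def)
        then show "(w \<in> B \<union> B') = (w' \<in> B \<union> B')" by simp
      qed
      moreover have "A \<union> A' = \<Omega> \<inter> (B \<union> B')"
        using c by (auto simp: cyl_def)
      ultimately have "cyl (A \<union> A') (v \<union> v') (B \<union> B')"
        using c unfolding cyl_def by blast
      then show "A \<union> A' \<in> {A. \<exists>v B. cyl A v B}"
        by blast
    qed
  qed
  with assms(2) show ?thesis
    unfolding cyl_def by blast
qed

text \<open>\<open>\<Omega>\<close> realises every finite pattern, so any \<open>w\<close> may be
  exchanged for a member of \<open>\<Omega>\<close> that agrees with it on \<open>v\<close> and
  \<open>v'\<close>.\<close>

lemma cylinder_unique:
  assumes \<Omega>: "path_space \<Omega>" and eq: "\<Omega> \<inter> B = \<Omega> \<inter> B'"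
    and v: "finite v" "v \<subseteq> {0..}" "depends_on (\<lambda>w. w \<in> B) v"
    and v': "finite v'" "v' \<subseteq> {0..}" "depends_on (\<lambda>w. w \<in> B') v'"
  shows "B = B'"
proof (rule set_eqI)
  fix w
  obtain \<omega> where \<omega>: "\<omega> \<in> \<Omega>" "\<And>r. r \<in> v \<union> v' \<Longrightarrow> \<omega> r = w r"
    using path_space_extend[OF \<Omega>, of "v \<union> v'" w] v v' by auto
  have "w \<in> B \<longleftrightarrow> \<omega> \<in> B"
    by (rule depends_onD[OF v(3)]) (use \<omega>(2) in auto)
  also have "\<dots> \<longleftrightarrow> \<omega> \<in> B'"
    using eq \<omega>(1) by blast
  also have "\<dots> \<longleftrightarrow> w \<in> B'"
    by (rule depends_onD[OF v'(3)]) (use \<omega>(2) in auto)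
  finally show "w \<in> B \<longleftrightarrow> w \<in> B'" .
qed

text \<open>A time in one set but not in the other could be given a wrong value along a path that
  satisfies the first condition. This takes two states: with only one, every condition is all of
  \<open>\<Omega>\<close>.\<close>

lemma evs_inject:
  fixes a b :: "'x::finite"
  assumes \<Omega>: "path_space \<Omega>" and u: "u \<in> time_sets" "u' \<in> time_sets"
    and eq: "evs \<Omega> u xu = evs \<Omega> u' xu'" and ne: "a \<noteq> b"
  shows "u = u' \<and> (\<forall>r\<in>u. xu r = (xu' r :: 'x))"
proof -
  have sub: "u' \<subseteq> u \<and> (\<forall>r\<in>u'. xu r = xu' r)"
    if u: "u \<in> time_sets" "u' \<in> time_sets" and eq: "evs \<Omega> u xu = evs \<Omega> u' xu'" for u u' xu xu'
  proof (intro conjI subsetI ballI)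
    fix r assume r: "r \<in> u'"
    have uu: "finite (u \<union> u')" "u \<union> u' \<subseteq> {0..}"
      using u by (auto simp: time_sets_def)
    show "r \<in> u"
    proof (rule ccontr)
      assume "r \<notin> u"
      define y where "y = (if xu' r = a then b else a)"
      have y: "y \<noteq> xu' r" using ne by (auto simp: y_def)
      obtain \<omega> where \<omega>: "\<omega> \<in> \<Omega>" "\<And>q. q \<in> u \<union> u' \<Longrightarrow> \<omega> q = (xu(r := y)) q"
        using path_space_extend[OF \<Omega> uu] by blast
      have "\<omega> \<in> evs \<Omega> u xu"
        using \<omega> \<open>r \<notin> u\<close> by (auto simp: evs_def)
      moreover have "\<omega> \<notin> evs \<Omega> u' xu'"
        using \<omega>(2)[of r] r y by (auto simp: evs_def)
      ultimately show False using eq by blast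
    qed
    obtain \<omega> where \<omega>: "\<omega> \<in> evs \<Omega> u xu"
      using evs_nonempty[OF \<Omega> u(1), of xu] by blast
    then have "\<omega> r = xu r"
      using \<open>r \<in> u\<close> by (simp add: evs_def)
    moreover have "\<omega> r = xu' r"
      using \<omega> r unfolding eq by (simp add: evs_def)
    ultimately show "xu r = xu' r" by simp
  qed
  show ?thesis
    using sub[OF u eq] sub[OF u(2,1) eq[symmetric]] by blast
qed

text \<open>The last conditioning time; -1, below every admissible time, encodes the empty
  history.\<close>

definition start :: "real set \<Rightarrow> real" where "start u = Max (insert (- 1) u)"

lemma start_empty [simp]: "start {} = - 1"
  by (simp add: start_def)

lemma start_less_iff: "\<lbrakk>u \<in> time_sets; 0 \<le> r\<rbrakk> \<Longrightarrow> start u < r \<longleftrightarrow> (\<forall>q\<in>u. q < r)"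
  by (auto simp: start_def time_sets_def)

lemma le_start: "\<lbrakk>u \<in> time_sets; r \<in> u\<rbrakk> \<Longrightarrow> r \<le> start u"
  by (auto simp: start_def time_sets_def)

lemma start_cases: "u \<in> time_sets \<Longrightarrow> u = {} \<and> start u = - 1 \<or> start u \<in> u \<and> 0 \<le> start u"
proof -
  assume u: "u \<in> time_sets"
  have "start u \<in> insert (- 1) u"
    unfolding start_def by (rule Max_in) (use u in \<open>auto simp: time_sets_def\<close>)
  moreover have "0 \<le> start u" if "r \<in> u" for r
    using le_start[OF u that] u that by (force simp: time_sets_def)
  ultimately show ?thesis by fastforce
qed

lemma start_insert: "u \<in> time_sets_below t \<Longrightarrow> 0 \<le> t \<Longrightarrow> start (insert t u) = t"
  unfolding start_def
  by (rule Max_eqI) (auto simp: time_sets_below_def time_sets_def less_imp_le)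

lemma sorted_list_of_set_append:
  fixes A B :: "real set"
  assumes "finite A" "finite B" "\<And>a b. a \<in> A \<Longrightarrow> b \<in> B \<Longrightarrow> a < b"
  shows "sorted_list_of_set (A \<union> B) = sorted_list_of_set A @ sorted_list_of_set B"
  by (rule strict_sorted_equal) (use assms in \<open>auto simp: sorted_wrt_append\<close>)

section \<open>The process of a kernel and its coherence\<close>

context markov_kernel
begin

text \<open>The probability computed from one chosen description of event and condition. Only times
  after \<open>start u\<close> are summed over, since coordinates up to there are prescribed by
  \<open>xu\<close>.\<close>

definition process_value ::
    "(real \<Rightarrow> 'x) set \<Rightarrow> (real \<Rightarrow> 'x) set \<Rightarrow> (real \<Rightarrow> 'x) set \<Rightarrow> real set \<Rightarrow> (real \<Rightarrow> 'x) \<Rightarrow>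
     real set \<Rightarrow> (real \<Rightarrow> 'x) set \<Rightarrow> real \<Rightarrow> bool" where
  "process_value \<Omega> A C u xu v B q \<longleftrightarrow>
     u \<in> time_sets \<and> xu \<in> u \<rightarrow>\<^sub>E UNIV \<and> C = evs \<Omega> u xu \<and>
     finite v \<and> v \<subseteq> {0..} \<and> (\<forall>r\<in>v. r \<in> u \<or> start u < r) \<and> A = \<Omega> \<inter> B \<and> depends_on (\<lambda>w. w \<in> B) v \<and>
     q = expect K (start u) xu (sorted_list_of_set {r\<in>v. start u < r}) (indicator B)"

definition process :: "(real \<Rightarrow> 'x) set \<Rightarrow> (real \<Rightarrow> 'x) set \<times> (real \<Rightarrow> 'x) set \<Rightarrow> real" where
  "process \<Omega> = (\<lambda>(A, C).
     if (A, C) \<in> C_SP \<Omega> then SOME q. \<exists>u xu v B. process_value \<Omega> A C u xu v B q else undefined)"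

lemma depends_on_indicator:
  fixes B :: "(real \<Rightarrow> 'x) set"
  assumes "depends_on (\<lambda>w. w \<in> B) v"
  shows "depends_on (indicator B :: _ \<Rightarrow> real) v"
proof (rule depends_onI)
  fix w w' :: "real \<Rightarrow> 'x"
  assume "\<And>r. r \<in> v \<Longrightarrow> w r = w' r"
  then have "(w \<in> B) = (w' \<in> B)"
    by (rule depends_onD[OF assms])
  then show "(indicator B w :: real) = indicator B w'"
    by (simp add: indicator_def)
qed

text \<open>\<open>\<Omega>\<close> determines \<open>B\<close>, and with two states also
  \<open>u\<close> and \<open>xu\<close>; only the time set \<open>v\<close> remains ambiguous, and
  the value does not depend on it.\<close>

lemma process_value_unique:
  assumes \<Omega>: "path_space \<Omega>"
    and 1: "process_value \<Omega> A C u xu v B q" and 2: "process_value \<Omega> A C u' xu' v' B' q'"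
  shows "q = q'"
proof -
  have B: "B = B'"
    by (rule cylinder_unique[OF \<Omega>, of B B' v v']) (use 1 2 in \<open>auto simp: process_value_def\<close>)
  have fin: "finite v" "v \<subseteq> {0..}" "finite v'" "v' \<subseteq> {0..}"
    using 1 2 by (auto simp: process_value_def)
  show ?thesis
  proof (cases "\<exists>a b :: 'x. a \<noteq> b")
    \<comment> \<open>A one-point state space: the condition no longer determines \<open>u\<close>,
      but all paths coincide and both values are expectations of one and the same constant.\<close>
    case False
    then have all_eq: "w = w'" for w w' :: "real \<Rightarrow> 'x"
      by (intro ext) blast
    have const: "expect K t w (sorted_list_of_set {r\<in>v. t < r}) (indicator B) = indicator B xu"
      if "finite v" "v \<subseteq> {0..}" for t w v
    proof -
      have "(indicator B :: _ \<Rightarrow> real) = (\<lambda>_. indicator B xu)"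
        by (rule ext) (rule arg_cong[OF all_eq])
      then have "expect K t w (sorted_list_of_set {r\<in>v. t < r}) (indicator B)
          = expect K t w (sorted_list_of_set {r\<in>v. t < r}) (\<lambda>_. indicator B xu)"
        by simp
      also have "\<dots> = indicator B xu"
        by (rule expect_const, rule increasing_after_sorted_list) (use that in auto)
      finally show ?thesis .
    qed
    have "q = indicator B xu"
      using 1 const[OF fin(1,2)] by (simp add: process_value_def)
    moreover have "q' = indicator B xu"
      using 2 const[OF fin(3,4)] by (simp add: process_value_def B)
    ultimately show ?thesis by simp
  next
    case True
    then obtain a b :: 'x where ab: "a \<noteq> b" by blast
    have u: "u \<in> time_sets" "u' \<in> time_sets" and eq: "evs \<Omega> u xu = evs \<Omega> u' xu'"
      and xu: "xu \<in> u \<rightarrow>\<^sub>E UNIV" "xu' \<in> u' \<rightarrow>\<^sub>E UNIV"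
      using 1 2 by (auto simp: process_value_def)
    have uu: "u = u'" and agree: "\<forall>r\<in>u. xu r = xu' r"
      using evs_inject[OF \<Omega> u eq ab] by blast+
    have "xu = xu'"
      by (rule PiE_ext[OF xu(1)]) (use xu(2) uu agree in auto)
    \<comment> \<open>Both time sets are compared with their union; \<open>B\<close> depends on
      either set alone, so the additional times are irrelevant.\<close>
    let ?V = "{r\<in>v \<union> v'. start u < r}"
    have "expect K (start u) xu (sorted_list_of_set ?V) (indicator B)
        = expect K (start u) xu (sorted_list_of_set {r\<in>w. start u < r}) (indicator B)"
      if "w = v \<or> w = v'" for w
    proof (rule expect_mono_times)
      show "depends_on (indicator B :: _ \<Rightarrow> real) w"
        using that 1 2 B by (auto simp: process_value_def intro: depends_on_indicator)
    qed (use that fin in auto)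
    from this[of v] this[of v'] show ?thesis
      using 1 2 uu \<open>xu = xu'\<close> B by (simp add: process_value_def)
  qed
qed

lemma process_value_exists:
  assumes "(A, C) \<in> C_SP \<Omega>"
  shows "\<exists>u xu v B q. process_value \<Omega> A C u xu v B q"
proof -
  obtain u xu where u: "u \<in> time_sets" "xu \<in> u \<rightarrow>\<^sub>E UNIV" "A \<in> event_algebra \<Omega> u" "C = evs \<Omega> u xu"
    using assms by (auto simp: C_SP_def)
  obtain v B where v: "finite v" "v \<subseteq> {0..}" "\<forall>r\<in>v. r \<in> u \<or> (\<forall>q\<in>u. q < r)" "A = \<Omega> \<inter> B"
    "depends_on (\<lambda>w. w \<in> B) v"
    using event_algebra_cylinder[OF u(1,3)] by blast
  have "\<forall>r\<in>v. r \<in> u \<or> start u < r"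
  proof
    fix r assume r: "r \<in> v"
    with v(2) have "0 \<le> r" by auto
    then show "r \<in> u \<or> start u < r"
      using bspec[OF v(3) r] start_less_iff[OF u(1)] by blast
  qed
  with u v show ?thesis
    unfolding process_value_def by blast
qed

lemma process_eqI:
  assumes \<Omega>: "path_space \<Omega>" and C_SP: "(A, C) \<in> C_SP \<Omega>" and val: "process_value \<Omega> A C u xu v B q"
  shows "process \<Omega> (A, C) = q"
proof -
  have "(SOME q. \<exists>u xu v B. process_value \<Omega> A C u xu v B q) = q"
  proof (rule some_equality)
    show "\<exists>u xu v B. process_value \<Omega> A C u xu v B q" using val by blast
    show "q' = q" if "\<exists>u xu v B. process_value \<Omega> A C u xu v B q'" for q'
      using that process_value_unique[OF \<Omega> _ val] by blast
  qed
  then show ?thesis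
    using C_SP by (simp add: process_def)
qed

text \<open>Conditional on the history \<open>X\<^sub>u = x\<^sub>u\<close>, a bet on \<open>A\<close> at the rate \<open>P(A|X\<^sub>u = x\<^sub>u)\<close> is fair
  for every chain that is released no later than the last time of \<open>u\<close>.\<close>

lemma fair_bet:
  assumes val: "process_value \<Omega> A C u xu v B q"
    and V: "finite V" "V \<subseteq> {0..}" "u \<subseteq> V" "v \<subseteq> V" and k: "- 1 \<le> k" "k \<le> start u"
  shows "expect K k w (sorted_list_of_set {r\<in>V. k < r})
    (\<lambda>w. indicator {w. \<forall>r\<in>u. w r = xu r} w * (q - indicator B w)) = 0"
proof -
  define m where "m = start u"
  have u: "u \<in> time_sets" and q: "q = expect K m xu (sorted_list_of_set {r\<in>v. m < r}) (indicator B)"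
    and vu: "\<And>r. r \<in> v \<Longrightarrow> r \<in> u \<or> m < r" and dep: "depends_on (indicator B :: _ \<Rightarrow> real) v"
    using val by (auto simp: process_value_def m_def intro: depends_on_indicator)
  let ?C = "{w. \<forall>r\<in>u. w r = xu r}"
  let ?G = "\<lambda>w. indicator ?C w * (q - indicator B w)"
  define rs1 where "rs1 = sorted_list_of_set {r\<in>V. k < r \<and> r \<le> m}"
  define rs2 where "rs2 = sorted_list_of_set {r\<in>V. m < r}"
  have "{r\<in>V. k < r} = {r\<in>V. k < r \<and> r \<le> m} \<union> {r\<in>V. m < r}"
    using k by (auto simp: m_def)
  moreover have "sorted_list_of_set ({r\<in>V. k < r \<and> r \<le> m} \<union> {r\<in>V. m < r}) = rs1 @ rs2"
    unfolding rs1_def rs2_def by (rule sorted_list_of_set_append) (use V(1) in auto)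
  ultimately have split: "sorted_list_of_set {r\<in>V. k < r} = rs1 @ rs2"
    by simp
  have set1: "set rs1 = {r\<in>V. k < r \<and> r \<le> m}" and set2: "set rs2 = {r\<in>V. m < r}"
    using V(1) by (simp_all add: rs1_def rs2_def)
  \<comment> \<open>After the times in \<open>rs1\<close> the chain stands at the conditioning time
    \<open>m\<close>: either it starts there, or \<open>m\<close> lies in \<open>u\<close> and is
    the last element of \<open>rs1\<close>. An empty history forces
    \<open>k = m = - 1\<close>.\<close>
  have last: "last (k # rs1) = m"
  proof (cases "k = m")
    case True
    then have "set rs1 = {}" unfolding set1 by auto
    with True show ?thesis by simp
  next
    case False
    with k have "k < m" by (simp add: m_def)
    show ?thesis
    proof (cases "m \<in> u")
      case True
      then have m: "m \<in> set rs1"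
        unfolding set1 using V(3) \<open>k < m\<close> by auto
      then have ne: "rs1 \<noteq> []" by (cases rs1) simp_all
      have sorted: "sorted rs1" by (simp add: rs1_def)
      have "last rs1 \<in> set rs1" using ne by simp
      then have "last rs1 \<le> m" unfolding set1 by simp
      moreover have "m \<le> last rs1"
      proof -
        obtain i where i: "i < length rs1" "rs1 ! i = m"
          using m unfolding in_set_conv_nth by blast
        then show ?thesis
          using sorted_nth_mono[OF sorted, of i "length rs1 - 1"] ne by (simp add: last_conv_nth)
      qed
      ultimately show ?thesis using ne by simp
    next
      case False
      then have "m = - 1" using start_cases[OF u] by (auto simp: m_def)
      with \<open>k < m\<close> k(1) show ?thesis by simp
    qed
  qed
  have inc2: "increasing_after m rs2"
    unfolding rs2_def by (rule increasing_after_sorted_list) (use V in auto)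
  \<comment> \<open>Seen from time \<open>m\<close>, the condition is already decided: if it fails
    the bet is off, and if it holds the expectation of the indicator of \<open>B\<close> is exactly
    the rate \<open>q\<close>.\<close>
  have inner: "expect K m w' rs2 ?G = 0" for w'
  proof (cases "w' \<in> ?C")
    case False
    have "expect K m w' rs2 ?G = expect K m w' rs2 (\<lambda>_. 0)"
    proof (rule expect_cong)
      fix w'' assume w'': "\<And>r. r \<notin> set rs2 \<Longrightarrow> w'' r = w' r"
      have "w'' r = w' r" if "r \<in> u" for r
        by (rule w'') (use le_start[OF u that] set2 in \<open>auto simp: m_def\<close>)
      then have "w'' \<notin> ?C" using False by simp
      then show "?G w'' = 0" by simp
    qed
    then show ?thesis
      using expect_const[OF inc2] by simp
  next
    case True
    have "expect K m w' rs2 ?G = expect K m w' rs2 (\<lambda>w. \<Sum>j\<in>{True, False}. (if j then 1 else - 1) *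
        (if j then (\<lambda>_. q) else indicator B) w)"
    proof (rule expect_cong)
      fix w'' assume w'': "\<And>r. r \<notin> set rs2 \<Longrightarrow> w'' r = w' r"
      have "w'' r = w' r" if "r \<in> u" for r
        by (rule w'') (use le_start[OF u that] set2 in \<open>auto simp: m_def\<close>)
      then have "w'' \<in> ?C" using True by simp
      then show "?G w'' = (\<Sum>j\<in>{True, False}. (if j then 1 else - 1) *
          (if j then (\<lambda>_. q) else indicator B) w'')" by simp
    qed
    also have "\<dots> = q - expect K m w' rs2 (indicator B)"
      unfolding expect_sum by (simp add: expect_const[OF inc2])
    also have "expect K m w' rs2 (indicator B) = expect K m xu rs2 (indicator B)"
    proof -
      have agree: "w' r = xu r" if "r \<in> v" "r \<notin> set rs2" for r
        using that vu[OF that(1)] True V(4) set2 by auto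
      show ?thesis
      proof (cases "u = {}")
        case True
        then have "m < 0" by (simp add: m_def)
        show ?thesis
          by (rule expect_agree_initial[OF dep]) (use agree \<open>m < 0\<close> in auto)
      next
        case False
        then have "m \<in> u" using start_cases[OF u] by (auto simp: m_def)
        with True have "w' m = xu m" by simp
        show ?thesis
          by (rule expect_agree[OF dep]) (use agree \<open>w' m = xu m\<close> in auto)
      qed
    qed
    also have "\<dots> = q"
      unfolding q rs2_def by (rule expect_mono_times[OF _ _ _ dep]) (use V in auto)
    finally show ?thesis by simp
  qed
  have "increasing_after k rs1"
    unfolding rs1_def by (rule increasing_after_sorted_list) (use V in auto)
  then show ?thesis
    unfolding split expect_append last inner by (rule expect_const)
qed

text \<open>All bets are fair for the chain released at the earliest conditioning time along a path in
  that condition, so the total gain cannot be negative everywhere on it.\<close>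

lemma process_coherent:
  assumes \<Omega>: "path_space \<Omega>"
  shows "coherent \<Omega> (process \<Omega>)"
  unfolding coherent_def
proof (intro allI impI)
  fix n :: nat and A C :: "nat \<Rightarrow> (real \<Rightarrow> 'x) set" and c :: "nat \<Rightarrow> real"
  assume n: "1 \<le> n" and C_SP: "\<forall>i\<in>{1..n}. (A i, C i) \<in> C_SP \<Omega>"
  let ?I = "{1..n}"
  let ?p = "\<lambda>i. process \<Omega> (A i, C i)"
  have "\<forall>i\<in>?I. \<exists>u xu v B. process_value \<Omega> (A i) (C i) u xu v B (?p i)"
  proof
    fix i assume i: "i \<in> ?I"
    obtain u xu v B q where val: "process_value \<Omega> (A i) (C i) u xu v B q"
      using process_value_exists[OF bspec[OF C_SP i]] by blast
    with process_eqI[OF \<Omega> bspec[OF C_SP i] val]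
    show "\<exists>u xu v B. process_value \<Omega> (A i) (C i) u xu v B (?p i)" by blast
  qed
  then obtain u xu v B where
    val: "\<And>i. i \<in> ?I \<Longrightarrow> process_value \<Omega> (A i) (C i) (u i) (xu i) (v i) (B i) (?p i)"
    by metis
  have ut: "u i \<in> time_sets" and C: "C i = evs \<Omega> (u i) (xu i)" and A: "A i = \<Omega> \<inter> B i"
    and fin: "finite (v i)" "v i \<subseteq> {0..}" and dep: "depends_on (\<lambda>w. w \<in> B i) (v i)" if "i \<in> ?I" for i
    using val[OF that] by (auto simp: process_value_def)
  define k where "k = Min ((\<lambda>i. start (u i)) ` ?I)"
  have "k \<in> (\<lambda>i. start (u i)) ` ?I"
    unfolding k_def using n by (intro Min_in) auto
  then obtain i0 where i0: "i0 \<in> ?I" "k = start (u i0)" by blast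
  have k_le: "k \<le> start (u i)" if "i \<in> ?I" for i
    unfolding k_def using that by (intro Min_le) auto
  have k_ge: "- 1 \<le> k"
    using start_cases[OF ut[OF i0(1)]] i0(2) by auto
  define V where "V = (\<Union>i\<in>?I. u i \<union> v i)"
  have uf: "finite (u i)" "u i \<subseteq> {0..}" if "i \<in> ?I" for i
    using ut[OF that] by (simp_all add: time_sets_def)
  have V: "finite V" "V \<subseteq> {0..}"
    unfolding V_def by (intro finite_UN_I finite_Un[THEN iffD2] conjI UN_least Un_least uf fin; simp)+
  have uv: "u i \<subseteq> V" "v i \<subseteq> V" if "i \<in> ?I" for i
    using that by (auto simp: V_def)
  obtain w where w: "w \<in> evs \<Omega> (u i0) (xu i0)"
    using evs_nonempty[OF \<Omega> ut[OF i0(1)], of "xu i0"] by blast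
  define rs where "rs = sorted_list_of_set {r\<in>V. k < r}"
  have inc: "increasing_after k rs"
    unfolding rs_def by (rule increasing_after_sorted_list) (use V in auto)
  define G where "G i w = indicator {w. \<forall>r\<in>u i. w r = xu i r} w * (?p i - indicator (B i) w)" for i w
  have "expect K k w rs (\<lambda>w. \<Sum>i\<in>?I. c i * G i w) = (\<Sum>i\<in>?I. c i * expect K k w rs (G i))"
    by (rule expect_sum)
  also have "\<dots> = 0"
  proof (rule sum.neutral, rule ballI)
    fix i assume i: "i \<in> ?I"
    have "expect K k w rs (G i) = 0"
      unfolding rs_def G_def by (rule fair_bet[OF val[OF i] V uv[OF i] k_ge k_le[OF i]])
    then show "c i * expect K k w rs (G i) = 0" by simp
  qed
  finally obtain w' where w': "\<And>r. r \<notin> set rs \<Longrightarrow> w' r = w r" "0 \<le> (\<Sum>i\<in>?I. c i * G i w')"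
    using expect_attained[OF inc, of w "\<lambda>w. \<Sum>i\<in>?I. c i * G i w"] by auto
  \<comment> \<open>\<open>w'\<close> need not belong to \<open>\<Omega>\<close>, but the gains look
    only at the finitely many times in \<open>V\<close>.\<close>
  obtain \<omega> where \<omega>: "\<omega> \<in> \<Omega>" "\<And>r. r \<in> V \<Longrightarrow> \<omega> r = w' r"
    using path_space_extend[OF \<Omega> V] by blast
  \<comment> \<open>The maximum runs over the union of the conditions only, so
    \<open>\<omega>\<close> must satisfy one of them. The times of \<open>u i0\<close> do not exceed
    \<open>k\<close> and are never overwritten, so the values fixed by \<open>w\<close>
    persist.\<close>
  have "\<omega> r = xu i0 r" if r: "r \<in> u i0" for r
  proof -
    have "r \<notin> set rs"
      using le_start[OF ut[OF i0(1)] r] V(1) i0(2) by (simp add: rs_def)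
    then show ?thesis
      using \<omega>(2)[of r] w'(1)[of r] w r uv(1)[OF i0(1)] by (auto simp: evs_def)
  qed
  then have "\<omega> \<in> C i0"
    using \<omega>(1) C[OF i0(1)] by (simp add: evs_def)
  with i0(1) have in_C: "\<omega> \<in> (\<Union>i\<in>?I. C i)"
    by (rule UN_I)
  let ?g = "\<lambda>\<omega>. \<Sum>i=1..n. c i * indicator (C i) \<omega> * (?p i - indicator (A i) \<omega>)"
  have "c i * indicator (C i) \<omega> * (?p i - indicator (A i) \<omega>) = c i * G i w'" if i: "i \<in> ?I" for i
  proof -
    have "\<omega> \<in> C i \<longleftrightarrow> (\<forall>r\<in>u i. \<omega> r = xu i r)"
      using \<omega>(1) by (simp add: C[OF i] evs_def)
    also have "\<dots> \<longleftrightarrow> (\<forall>r\<in>u i. w' r = xu i r)"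
      by (rule ball_cong[OF refl]) (simp add: \<omega>(2)[OF subsetD[OF uv(1)[OF i]]])
    finally have "\<omega> \<in> C i \<longleftrightarrow> w' \<in> {w. \<forall>r\<in>u i. w r = xu i r}"
      by simp
    moreover have "\<omega> \<in> A i \<longleftrightarrow> w' \<in> B i"
    proof -
      have "\<omega> \<in> B i \<longleftrightarrow> w' \<in> B i"
        by (rule depends_onD[OF dep[OF i]]) (use \<omega>(2) uv(2)[OF i] in auto)
      with A[OF i] \<omega>(1) show ?thesis by simp
    qed
    ultimately show ?thesis
      unfolding G_def indicator_def by simp
  qed
  then have "?g \<omega> = (\<Sum>i\<in>?I. c i * G i w')"
    by (rule sum.cong[OF refl])
  with w'(2) have "0 \<le> ?g \<omega>" by simp
  also have "\<dots> \<le> Max (?g ` (\<Union>i\<in>?I. C i))"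
    by (rule Max_ge[OF finite_gains imageI[OF in_C]]) simp
  finally show "0 \<le> Max (?g ` (\<Union>i\<in>?I. C i))" .
qed

lemma process_stochastic:
  assumes "path_space \<Omega>"
  shows "stochastic_process \<Omega> (process \<Omega>)"
proof -
  have "process \<Omega> \<in> extensional (C_SP \<Omega>)"
    by (auto simp: extensional_def process_def)
  with process_coherent[OF assms] show ?thesis
    by (simp add: stochastic_process_def)
qed

text \<open>The last conditioning time is \<open>t\<close>, so the expectation starts from
  \<open>t\<close> and \<open>x\<close> and earlier values cannot enter; this is the source of the
  Markov property.\<close>

lemma process_transition:
  assumes \<Omega>: "path_space \<Omega>" and t: "0 \<le> t" "t \<le> s" and u: "u \<in> time_sets_below t"
  shows "process \<Omega> (ev \<Omega> s y, ev \<Omega> t x \<inter> evs \<Omega> u xu) = (if t = s then indicator {y} x else K t s x y)"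
proof -
  define xu' where "xu' = restrict (xu(t := x)) (insert t u)"
  have tu: "t \<notin> u" and ut: "insert t u \<in> time_sets" "\<And>r. r \<in> u \<Longrightarrow> r < t"
    using u t by (auto simp: time_sets_below_def time_sets_def)
  have C: "ev \<Omega> t x \<inter> evs \<Omega> u xu = evs \<Omega> (insert t u) xu'"
    using tu by (auto simp: xu'_def evs_def ev_def)
  have st: "start (insert t u) = t"
    by (rule start_insert[OF u t(1)])
  have xt: "xu' t = x"
    by (simp add: xu'_def)
  have "expect K t xu' (sorted_list_of_set {r\<in>{s}. t < r}) (indicator {w. w s = y})
      = (if t = s then indicator {y} x else K t s x y)"
  proof (cases "t = s")
    case True
    then have "{r \<in> {s}. t < r} = {}" by auto
    then have "sorted_list_of_set {r \<in> {s}. t < r} = []" by (simp only: sorted_list_of_set_empty)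
    then show ?thesis using True xt by (simp only: expect.simps) (simp add: indicator_def)
  next
    case False
    with t have "{r \<in> {s}. t < r} = {s}" by auto
    then show ?thesis
      using False by (simp add: xt indicator_def if_distrib[of "\<lambda>a. _ * a"] cong: if_cong)
  qed
  then have "process_value \<Omega> (ev \<Omega> s y) (evs \<Omega> (insert t u) xu') (insert t u) xu' {s} {w. w s = y}
      (if t = s then indicator {y} x else K t s x y)"
    unfolding process_value_def st using ut(1) t
    by (auto simp: xu'_def ev_def depends_on_def)
  moreover have "(ev \<Omega> s y, evs \<Omega> (insert t u) xu') \<in> C_SP \<Omega>"
    by (rule C_SP_I[OF ut(1)], rule ev_in_event_algebra) (use t ut(2) in force)+
  ultimately show ?thesis
    unfolding C by (intro process_eqI[OF \<Omega>])
qed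

lemma process_marginal:
  assumes \<Omega>: "path_space \<Omega>" and s: "0 \<le> s"
  shows "process \<Omega> (ev \<Omega> s y, \<Omega>) = K (- 1) s undefined y"
proof (rule process_eqI[OF \<Omega> C_SP_unconditional[OF s]])
  have "{r \<in> {s}. - 1 < r} = {s}" using s by auto
  then have "expect K (- 1) (\<lambda>_. undefined) (sorted_list_of_set {r\<in>{s}. - 1 < r}) (indicator {w. w s = y})
      = K (- 1) s undefined y"
    by (simp add: indicator_def if_distrib[of "\<lambda>a. _ * a"] cong: if_cong)
  then show "process_value \<Omega> (ev \<Omega> s y) \<Omega> {} (\<lambda>_. undefined) {s} {w. w s = y} (K (- 1) s undefined y)"
    unfolding process_value_def using s
    by (auto simp: ev_def depends_on_def time_sets_def)
qed

end

text \<open>From a negative time the chain draws its state at time 0 from \<open>p\<close> and then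
  moves by \<open>T\<close>; the current state \<open>x\<close> is ignored, as
  \<open>K_initial\<close> demands.\<close>

definition chain_kernel ::
    "real^'x::finite \<Rightarrow> (real \<Rightarrow> real \<Rightarrow> real^'x^'x) \<Rightarrow> real \<Rightarrow> real \<Rightarrow> 'x \<Rightarrow> 'x \<Rightarrow> real" where
  "chain_kernel p T t r x y = (if t < 0 then \<Sum>z\<in>UNIV. p $ z * T 0 r $ z $ y else T t r $ x $ y)"

lemma chain_kernel_markov:
  assumes T: "transition_family \<Q> T" and p: "p \<in> mass_functions"
  shows "markov_kernel (chain_kernel p T)"
proof
  have p0: "p $ z \<ge> 0" and p1: "(\<Sum>z\<in>UNIV. p $ z) = 1" for z
    using p by (auto simp: mass_functions_def)
  fix t r :: real and x :: 'a assume tr: "t < r" "0 \<le> r"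
  have st: "stochastic_matrix (T 0 r)" "0 \<le> t \<Longrightarrow> stochastic_matrix (T t r)"
    using family_stochastic[OF T] tr by auto
  show "0 \<le> chain_kernel p T t r x y" for y
    using st p0 by (auto simp: chain_kernel_def stochastic_matrix_def intro!: sum_nonneg)
  show "(\<Sum>y\<in>UNIV. chain_kernel p T t r x y) = 1"
  proof (cases "t < 0")
    case True
    have "(\<Sum>y\<in>UNIV. chain_kernel p T t r x y) = (\<Sum>y\<in>UNIV. \<Sum>z\<in>UNIV. p $ z * T 0 r $ z $ y)"
      using True by (simp add: chain_kernel_def)
    also have "\<dots> = (\<Sum>z\<in>UNIV. \<Sum>y\<in>UNIV. p $ z * T 0 r $ z $ y)"
      by (rule sum.swap)
    also have "\<dots> = (\<Sum>z\<in>UNIV. p $ z * 1)"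
      using st(1) by (simp add: stochastic_matrix_def flip: sum_distrib_left)
    finally show ?thesis using p1 by simp
  next
    case False
    then show ?thesis
      using st(2) by (simp add: chain_kernel_def stochastic_matrix_def)
  qed
  show "(\<Sum>y\<in>UNIV. chain_kernel p T t r x y * chain_kernel p T r q y z) = chain_kernel p T t q x z"
    if rq: "r < q" for q z
  proof (cases "t < 0")
    case True
    have comp: "(\<Sum>y\<in>UNIV. T 0 r $ z' $ y * T r q $ y $ z) = T 0 q $ z' $ z" for z'
      using family_comp[OF T, of 0 r q] tr rq by (simp add: matrix_matrix_mult_def vec_eq_iff)
    have "(\<Sum>y\<in>UNIV. chain_kernel p T t r x y * chain_kernel p T r q y z)
        = (\<Sum>y\<in>UNIV. \<Sum>z'\<in>UNIV. p $ z' * (T 0 r $ z' $ y * T r q $ y $ z))"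
      using True tr by (simp add: chain_kernel_def sum_distrib_right mult.assoc)
    also have "\<dots> = (\<Sum>z'\<in>UNIV. \<Sum>y\<in>UNIV. p $ z' * (T 0 r $ z' $ y * T r q $ y $ z))"
      by (rule sum.swap)
    finally show ?thesis
      using True by (simp add: chain_kernel_def comp flip: sum_distrib_left)
  next
    case False
    have "(\<Sum>y\<in>UNIV. T t r $ x $ y * T r q $ y $ z) = T t q $ x $ z"
      using family_comp[OF T, of t r q] False tr rq by (simp add: matrix_matrix_mult_def vec_eq_iff)
    then show ?thesis
      using False tr by (simp add: chain_kernel_def)
  qed
next
  show "chain_kernel p T t r x y = chain_kernel p T t r x' y" if "t < 0" for t r x y x'
    using that by (simp add: chain_kernel_def)
qed

text \<open>The operator norm is at most the sum of absolute entries, which for the quotients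
  converges to that of \<open>Q\<close>.\<close>

lemma Limsup_op_norm_finite:
  fixes U :: "real \<Rightarrow> real^'x::finite^'x"
  assumes lim: "((\<lambda>\<Delta>. (1 / \<Delta>) *\<^sub>R (U \<Delta> - mat 1)) \<longlongrightarrow> Q) (at_right 0)"
  shows "Limsup (at_right 0) (\<lambda>\<Delta>. ereal (1 / \<Delta> * op_norm ((*v) (U \<Delta> - mat 1)))) < \<infinity>"
proof -
  let ?D = "\<lambda>\<Delta>. (1 / \<Delta>) *\<^sub>R (U \<Delta> - mat 1)"
  let ?s = "\<lambda>A::real^'x^'x. \<Sum>x\<in>UNIV. \<Sum>y\<in>UNIV. \<bar>A $ x $ y\<bar>"
  have "((\<lambda>\<Delta>. ?s (?D \<Delta>)) \<longlongrightarrow> ?s Q) (at_right 0)"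
    by (intro tendsto_sum tendsto_rabs tendsto_vec_nth lim)
  then have "\<forall>\<^sub>F \<Delta> in at_right 0. ?s (?D \<Delta>) < ?s Q + 1"
    by (rule order_tendstoD) simp
  then have "\<forall>\<^sub>F \<Delta> in at_right 0. ereal (1 / \<Delta> * op_norm ((*v) (U \<Delta> - mat 1))) \<le> ereal (?s Q + 1)"
    using eventually_at_right_less[of 0]
  proof eventually_elim
    case (elim \<Delta>)
    have "op_norm ((*v) (U \<Delta> - mat 1)) \<le> ?s (U \<Delta> - mat 1)"
    proof (rule op_norm_leI)
      fix f :: "real^'x" assume "infnorm f = 1"
      then show "infnorm ((U \<Delta> - mat 1) *v f) \<le> ?s (U \<Delta> - mat 1)"
        using infnorm_mult_vec_le[of "U \<Delta> - mat 1" f] by simp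
    qed
    then have "1 / \<Delta> * op_norm ((*v) (U \<Delta> - mat 1)) \<le> 1 / \<Delta> * ?s (U \<Delta> - mat 1)"
      by (rule mult_left_mono) (use elim(2) in simp)
    also have "\<dots> = ?s (?D \<Delta>)"
      unfolding sum_distrib_left
    proof (intro sum.cong refl)
      show "1 / \<Delta> * \<bar>(U \<Delta> - mat 1) $ x $ y\<bar> = \<bar>?D \<Delta> $ x $ y\<bar>" for x y
        using elim(2) by (simp add: abs_mult)
    qed
    finally show ?case
      using elim(1) by simp
  qed
  then have "Limsup (at_right 0) (\<lambda>\<Delta>. ereal (1 / \<Delta> * op_norm ((*v) (U \<Delta> - mat 1)))) \<le> ereal (?s Q + 1)"
    by (rule Limsup_bounded)
  also have "\<dots> < \<infinity>" by simp
  finally show ?thesis .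
qed

lemma markov_chain_exists:
  fixes \<Omega> :: "(real \<Rightarrow> 'x::finite) set"
  assumes \<Omega>: "path_space \<Omega>" and T: "transition_family \<Q> T" and p: "p \<in> mass_functions" "p \<in> \<M>"
  shows "\<exists>P\<in>P_WM \<Omega> \<Q> \<M>. \<forall>s\<ge>0. \<forall>y. P (ev \<Omega> s y, \<Omega>) = (\<Sum>z\<in>UNIV. p $ z * T 0 s $ z $ y)"
proof -
  interpret markov_kernel "chain_kernel p T"
    by (rule chain_kernel_markov[OF T p(1)])
  define P where "P = process \<Omega>"
  have entry: "P (ev \<Omega> s y, ev \<Omega> t x \<inter> evs \<Omega> u xu) = T t s $ x $ y"
    if "0 \<le> t" "t \<le> s" "u \<in> time_sets_below t" for t s u x y xu
    using process_transition[OF \<Omega> that, of y x xu] that(1) family_refl[OF T that(1)]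
    by (cases "t = s") (auto simp: P_def chain_kernel_def mat_def)
  have trans: "trans_matrix \<Omega> P u xu t s = T t s"
    if "0 \<le> t" "t \<le> s" "u \<in> time_sets_below t" for t s u xu
    by (simp add: trans_matrix_def vec_eq_iff entry[OF that])
  have marg: "P (ev \<Omega> s y, \<Omega>) = (\<Sum>z\<in>UNIV. p $ z * T 0 s $ z $ y)" if "0 \<le> s" for s y
    by (simp add: P_def process_marginal[OF \<Omega> that] chain_kernel_def)
  have right: "\<exists>Q\<in>\<Q>. ((\<lambda>\<Delta>. (1 / \<Delta>) *\<^sub>R (trans_matrix \<Omega> P u xu t (t + \<Delta>) - mat 1)) \<longlongrightarrow> Q) (at_right 0)"
    if t: "0 \<le> t" "u \<in> time_sets_below t" for t u xu
  proof -
    have "\<forall>\<^sub>F \<Delta> in at_right 0. (1 / \<Delta>) *\<^sub>R (trans_matrix \<Omega> P u xu t (t + \<Delta>) - mat 1)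
        = (1 / \<Delta>) *\<^sub>R (T t (t + \<Delta>) - mat 1)"
      by (rule eventually_at_right_0I[of 1]) (simp_all add: trans t)
    from tendsto_cong[OF this] show ?thesis
      using family_right[OF T t(1)] by simp
  qed
  have left: "\<exists>Q\<in>\<Q>. ((\<lambda>\<Delta>. (1 / \<Delta>) *\<^sub>R (trans_matrix \<Omega> P u xu (t - \<Delta>) t - mat 1)) \<longlongrightarrow> Q) (at_right 0)"
    if t: "0 < t" "u \<in> time_sets_below t" for t u xu
  proof -
    \<comment> \<open>Left quotients agree with those of \<open>T\<close> only once
      \<open>t - \<Delta>\<close> is non-negative and exceeds \<open>u\<close>, that is, for
      \<open>\<Delta> < t - m\<close>.\<close>
    define m where "m = Max (insert 0 u)"
    have fin: "finite u" using t by (simp add: time_sets_below_def time_sets_def)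
    have m: "0 \<le> m" "\<And>r. r \<in> u \<Longrightarrow> r \<le> m" "m < t"
      using t fin by (auto simp: m_def time_sets_below_def)
    have "u \<in> time_sets_below (t - \<Delta>)" if "\<Delta> < t - m" for \<Delta>
      using t(2) m(2) that by (force simp: time_sets_below_def)
    then have "\<forall>\<^sub>F \<Delta> in at_right 0. (1 / \<Delta>) *\<^sub>R (trans_matrix \<Omega> P u xu (t - \<Delta>) t - mat 1)
        = (1 / \<Delta>) *\<^sub>R (T (t - \<Delta>) t - mat 1)"
      using m by (intro eventually_at_right_0I[of "t - m"]) (simp_all add: trans)
    from tendsto_cong[OF this] show ?thesis
      using family_left[OF T t(1)] by simp
  qed
  have "markov_chain \<Omega> P"
    unfolding markov_chain_def
  proof (intro conjI allI impI ballI)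
    show "stochastic_process \<Omega> P"
      unfolding P_def by (rule process_stochastic[OF \<Omega>])
    fix t s u xu x y
    assume t: "(0::real) \<le> t" "t \<le> s" "u \<in> time_sets_below t"
    have "{} \<in> time_sets_below t"
      by (simp add: time_sets_below_def time_sets_def)
    moreover have "ev \<Omega> t x \<inter> \<Omega> = ev \<Omega> t x"
      by (auto simp: ev_def)
    ultimately have "P (ev \<Omega> s y, ev \<Omega> t x) = T t s $ x $ y"
      using entry[OF t(1,2), of "{}" y x] by simp
    then show "P (ev \<Omega> s y, ev \<Omega> t x \<inter> evs \<Omega> u xu) = P (ev \<Omega> s y, ev \<Omega> t x)"
      using entry[OF t] by simp
  qed
  moreover have "well_behaved \<Omega> P"
    unfolding well_behaved_def
  proof (intro allI impI ballI conjI)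
    fix t u xu assume t: "(0::real) \<le> t" "u \<in> time_sets_below t"
    show "Limsup (at_right 0)
        (\<lambda>\<Delta>. ereal (1 / \<Delta> * op_norm ((*v) (trans_matrix \<Omega> P u xu t (t + \<Delta>) - mat 1)))) < \<infinity>"
      using right[OF t, of xu] by (elim bexE) (rule Limsup_op_norm_finite)
    show "Limsup (at_right 0)
        (\<lambda>\<Delta>. ereal (1 / \<Delta> * op_norm ((*v) (trans_matrix \<Omega> P u xu (t - \<Delta>) t - mat 1)))) < \<infinity>"
      if "0 < t"
      using left[OF that t(2), of xu] by (elim bexE) (rule Limsup_op_norm_finite)
  qed
  moreover have "consistent_rates \<Omega> \<Q> P"
    unfolding consistent_rates_def
  proof (intro allI impI ballI subsetI)
    fix t u xu Q
    assume t: "(0::real) \<le> t" "u \<in> time_sets_below t" and Q: "Q \<in> outer_derivative \<Omega> P u xu t"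
    \<comment> \<open>The full one-sided derivatives exist, so along every sequence of increments
      the quotients have the same limit, which lies in \<open>\<Q>\<close>.\<close>
    have uniq: "Q \<in> \<Q>"
      if ex: "\<exists>Q\<in>\<Q>. (D \<longlongrightarrow> Q) (at_right 0)"
        and \<Delta>: "filterlim \<Delta> (at_right 0) sequentially" "(\<lambda>i. D (\<Delta> i)) \<longlonglongrightarrow> Q"
      for D :: "real \<Rightarrow> real^'x^'x" and \<Delta> :: "nat \<Rightarrow> real"
    proof -
      obtain Q' where Q': "Q' \<in> \<Q>" "(D \<longlongrightarrow> Q') (at_right 0)" using ex by blast
      have "(\<lambda>i. D (\<Delta> i)) \<longlonglongrightarrow> Q'"
        by (rule filterlim_compose[OF Q'(2) \<Delta>(1)])
      with \<Delta>(2) have "Q = Q'" by (rule LIMSEQ_unique)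
      with Q'(1) show ?thesis by simp
    qed
    obtain \<Delta> where \<Delta>: "filterlim \<Delta> (at_right 0) sequentially" and
      "(\<lambda>i. (1 / \<Delta> i) *\<^sub>R (trans_matrix \<Omega> P u xu t (t + \<Delta> i) - mat 1)) \<longlonglongrightarrow> Q \<or>
       t > 0 \<and> (\<lambda>i. (1 / \<Delta> i) *\<^sub>R (trans_matrix \<Omega> P u xu (t - \<Delta> i) t - mat 1)) \<longlonglongrightarrow> Q"
      using Q unfolding outer_derivative_def by blast
    then show "Q \<in> \<Q>"
      using uniq[OF right[OF t] \<Delta>] uniq[OF left[OF _ t(2)] \<Delta>] by blast
  qed
  moreover have "consistent_initial \<Omega> \<M> P"
  proof -
    have "(\<Sum>z\<in>UNIV. p $ z * T 0 0 $ z $ y) = (\<Sum>z\<in>UNIV. if z = y then p $ z else 0)" for y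
      unfolding family_refl[OF T order_refl] by (rule sum.cong) (auto simp: mat_def)
    then have "(\<chi> x. P (ev \<Omega> 0 x, \<Omega>)) = p"
      by (simp add: vec_eq_iff marg)
    with p(2) show ?thesis
      by (simp add: consistent_initial_def)
  qed
  ultimately have "P \<in> P_WM \<Omega> \<Q> \<M>"
    by (simp add: P_WM_def)
  with marg show ?thesis by blast
qed

lemma P_WM_subset_P_W: "P_WM \<Omega> \<Q> \<M> \<subseteq> P_W \<Omega> \<Q> \<M>"
  by (auto simp: P_WM_def P_W_def markov_chain_def)

theorem proposition9p4:
  fixes \<Omega> :: "(real \<Rightarrow> 'x::finite) set"
    and \<M> :: "(real^'x) set"
    and \<Q> :: "(real^'x^'x) set"
    and s :: real
    and f :: "real^'x"
  assumes "path_space \<Omega>"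
    and "\<M> \<noteq> {}" and "\<M> \<subseteq> mass_functions"
    and "\<Q> \<noteq> {}" and "\<Q> \<subseteq> rate_matrices"
    and "bounded_rates \<Q>" and "separately_specified_rows \<Q>"
    and "s \<ge> 0"
  shows "lower_exp_of \<Omega> (P_W \<Omega> \<Q> \<M>) s f = lower_exp_of \<Omega> (P_WM \<Omega> \<Q> \<M>) s f \<and>
         lower_exp_of \<Omega> (P_WM \<Omega> \<Q> \<M>) s f
           = lower_expectation \<M> (lower_transition (lower_envelope \<Q>) 0 s f)"
proof -
  obtain B where B: "B > 0" "\<And>Q x y. Q \<in> \<Q> \<Longrightarrow> \<bar>Q $ x $ y\<bar> \<le> B"
    using bounded_rates_entries[OF assms(6)] by blast
  \<comment> \<open>With this choice \<open>h0 * B = 1\<close>, the longest step for which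
    \<open>rate_matrix_step_ge\<close> applies to all members of \<open>\<Q>\<close>.\<close>
  define h0 where "h0 = 1 / B"
  have h0: "h0 > 0" "h0 * B \<le> 1" using B(1) by (simp_all add: h0_def)
  interpret rate_operator "lower_envelope \<Q>" h0
    by (rule lower_envelope_rate_operator[OF assms(4,5) B(2) h0])
  define L where "L = S s f"
  have L: "lower_transition (lower_envelope \<Q>) 0 s f = L"
    unfolding L_def lower_transition_eq_S[OF assms(8)] ..
  define e where "e p = (\<Sum>x\<in>UNIV. p $ x * L $ x)" for p
  have e_le: "lower_expectation \<M> L \<le> e p" if "p \<in> \<M>" for p
    unfolding lower_expectation_def e_def
  proof (rule cINF_lower[OF _ that])
    show "bdd_below ((\<lambda>p. \<Sum>x\<in>UNIV. p $ x * L $ x) ` \<M>)"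
    proof (rule bdd_belowI2)
      fix p assume "p \<in> \<M>"
      then have p: "\<And>x. p $ x \<ge> 0" "(\<Sum>x\<in>UNIV. p $ x) = 1"
        using assms(3) by (auto simp: mass_functions_def)
      have "- infnorm L = (\<Sum>x\<in>UNIV. p $ x * (- infnorm L))"
        unfolding sum_distrib_right[symmetric] p(2) by simp
      also have "\<dots> \<le> (\<Sum>x\<in>UNIV. p $ x * L $ x)"
        by (intro sum_mono mult_left_mono minus_infnorm_le_nth p(1))
      finally show "- infnorm L \<le> (\<Sum>x\<in>UNIV. p $ x * L $ x)" .
    qed
  qed
  define val where "val P = (\<Sum>x\<in>UNIV. f $ x * P (ev \<Omega> s x, \<Omega>))" for P
  have lower: "lower_expectation \<M> L \<le> val P" if P: "P \<in> P_W \<Omega> \<Q> \<M>" for P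
  proof -
    have "(\<chi> x. P (ev \<Omega> 0 x, \<Omega>)) \<in> \<M>"
      using P by (simp add: P_W_def consistent_initial_def)
    from e_le[OF this] have "lower_expectation \<M> L \<le> (\<Sum>x\<in>UNIV. P (ev \<Omega> 0 x, \<Omega>) * L $ x)"
      by (simp add: e_def)
    also have "\<dots> \<le> val P"
      unfolding L_def val_def by (rule expectation_lower_bound[OF assms(4,5) B(2) h0 assms(1) P assms(8)])
    finally show ?thesis .
  qed
  have upper: "\<exists>P\<in>P_WM \<Omega> \<Q> \<M>. val P \<le> e p + \<epsilon>" if p: "p \<in> \<M>" and \<epsilon>: "\<epsilon> > 0" for p \<epsilon>
  proof -
    have pm: "p \<in> mass_functions" using p assms(3) by blast
    obtain T where T: "transition_family \<Q> T" "\<And>x. (T 0 s *v f) $ x \<le> S s f $ x + \<epsilon>"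
      using approximating_family[OF assms(4,5) B(2) assms(7) h0 assms(8) \<epsilon>, where f = f] by blast
    obtain P where P: "P \<in> P_WM \<Omega> \<Q> \<M>"
      "\<And>y. P (ev \<Omega> s y, \<Omega>) = (\<Sum>z\<in>UNIV. p $ z * T 0 s $ z $ y)"
      using markov_chain_exists[OF assms(1) T(1) pm p] assms(8) by blast
    have "val P = (\<Sum>y\<in>UNIV. \<Sum>z\<in>UNIV. p $ z * (T 0 s $ z $ y * f $ y))"
      by (simp add: val_def P(2) sum_distrib_left mult_ac)
    also have "\<dots> = (\<Sum>z\<in>UNIV. \<Sum>y\<in>UNIV. p $ z * (T 0 s $ z $ y * f $ y))"
      by (rule sum.swap)
    also have "\<dots> = (\<Sum>z\<in>UNIV. p $ z * (T 0 s *v f) $ z)"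
      by (simp add: mult_vec_nth sum_distrib_left)
    also have "\<dots> \<le> (\<Sum>z\<in>UNIV. p $ z * (L $ z + \<epsilon>))"
      unfolding L_def by (intro sum_mono mult_left_mono T(2)) (use pm in \<open>simp add: mass_functions_def\<close>)
    also have "\<dots> = e p + \<epsilon>"
      using pm by (simp add: e_def mass_functions_def distrib_left sum.distrib flip: sum_distrib_right)
    finally show ?thesis
      using P(1) by blast
  qed
  \<comment> \<open>One argument for every set of processes between \<open>P_WM\<close> and
    \<open>P_W\<close>: the lower bound holds on the larger set, and the constructed chains, which
    also show non-emptiness, belong to the smaller one.\<close>
  have eq: "lower_exp_of \<Omega> \<P> s f = lower_expectation \<M> L"
    if sub: "\<P> \<subseteq> P_W \<Omega> \<Q> \<M>" and sup: "P_WM \<Omega> \<Q> \<M> \<subseteq> \<P>" for \<P>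
  proof (rule antisym)
    have INF: "lower_exp_of \<Omega> \<P> s f = (INF P\<in>\<P>. val P)"
      by (simp add: lower_exp_of_def val_def)
    have ne: "\<P> \<noteq> {}"
      using upper[of _ 1] assms(2) sup by fastforce
    show "lower_expectation \<M> L \<le> lower_exp_of \<Omega> \<P> s f"
      unfolding INF by (rule cINF_greatest[OF ne]) (use lower sub in blast)
    have bdd: "bdd_below (val ` \<P>)"
      by (rule bdd_belowI2[of _ "lower_expectation \<M> L"]) (use lower sub in blast)
    have "lower_exp_of \<Omega> \<P> s f \<le> e p" if p: "p \<in> \<M>" for p
    proof (rule field_le_epsilon)
      fix \<epsilon> :: real assume "\<epsilon> > 0"
      from upper[OF p this] obtain P where P: "P \<in> \<P>" "val P \<le> e p + \<epsilon>"
        using sup by blast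
      have "(INF P\<in>\<P>. val P) \<le> val P"
        by (rule cINF_lower[OF bdd P(1)])
      with P(2) show "lower_exp_of \<Omega> \<P> s f \<le> e p + \<epsilon>"
        unfolding INF by linarith
    qed
    then show "lower_exp_of \<Omega> \<P> s f \<le> lower_expectation \<M> L"
      unfolding lower_expectation_def e_def[symmetric] by (intro cINF_greatest[OF assms(2)])
  qed
  show ?thesis
    unfolding L using eq[OF order_refl P_WM_subset_P_W] eq[OF P_WM_subset_P_W order_refl] by simp
qed

end
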